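(* Let $C>1$ and $\varepsilon=\min\{C-1,1/3\}$. There are constants $\alpha=\alpha(\varepsilon)>0$, $\alpha'=\alpha'(\varepsilon)>0$, $\Delta_0=\Delta_0(\varepsilon)$ and $\ell_0=\ell_0(\varepsilon)$, depending only on $\varepsilon$, such that for all integers $\Delta>\Delta_0$, every integer $k>C\Delta/\ln\Delta$, every color $c\in[k]$, and every integer $\ell>\ell_0$, $$\mathbf{Pr}_{\tau\sim\mu_\ell}\Big[\big|\mu_\ell\big(\sigma(\mathrm{root})=c\mid\sigma(L)=\tau(L)\big)-1/k\big|>\Delta^{-\alpha\ell}\Big]\le e^{-\Delta^{\alpha'\ell}}.$$
   Context: $[k]=\{1,\dots,k\}$. $T_\ell=(V_\ell,E_\ell)$ denotes the complete rooted tree of depth $\ell$ in which every non-leaf vertex has exactly $\Delta$ children, and $L=L_\ell$ denotes its set of leaves (the $\Delta^\ell$ vertices at depth $\ell$). A $k$-coloring of $T_\ell$ is a map $\sigma:V_\ell\to[k]$ with $\sigma(v)\ne\sigma(w)$ whenever $(v,w)\in E_\ell$. $\mu_\ell$ is the uniform probability measure on $k$-colorings of $T_\ell$. For a coloring $\sigma$, $\sigma(L)$ denotes its restriction to the leaves. In the conditional probability, $\sigma$ is distributed as $\mu_\ell$. *)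

theory Defs
  imports "HOL-Probability.Probability"
begin

text \<open>
  The vertices of the complete \<open>\<Delta>\<close>-ary tree of depth \<open>l\<close> are encoded by their addresses: the list
  of child indices on the path from the root, so the root is the empty list and the depth of a
  vertex is its length.
\<close>

definition tree_verts :: "nat \<Rightarrow> nat \<Rightarrow> nat list set" where
  "tree_verts \<Delta> l = {v. length v \<le> l \<and> set v \<subseteq> {..<\<Delta>}}"

definition tree_edges :: "nat \<Rightarrow> nat \<Rightarrow> (nat list \<times> nat list) set" where
  "tree_edges \<Delta> l = {(v, v @ [i]) | v i. v \<in> tree_verts \<Delta> l \<and> v @ [i] \<in> tree_verts \<Delta> l}"

definition tree_root :: "nat list" where
  "tree_root = []"

definition leaves :: "nat \<Rightarrow> nat \<Rightarrow> nat list set" where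
  "leaves \<Delta> l = {v \<in> tree_verts \<Delta> l. length v = l}"

text \<open>
  Colorings are extensional functions (\<open>undefined\<close> off the vertex set), so that each map from the
  vertices to the colors is represented, and hence counted, exactly once.
\<close>

definition colorings :: "nat \<Rightarrow> nat \<Rightarrow> nat \<Rightarrow> (nat list \<Rightarrow> nat) set" where
  "colorings k \<Delta> l =
     {\<sigma> \<in> tree_verts \<Delta> l \<rightarrow>\<^sub>E {1..k}. \<forall>(v, w) \<in> tree_edges \<Delta> l. \<sigma> v \<noteq> \<sigma> w}"

text \<open>
  The uniform distribution on colorings; it is meaningful for \<open>k \<ge> 2\<close>, when the set of colorings is
  finite and nonempty (see below).
\<close>

definition coloring_pmf :: "nat \<Rightarrow> nat \<Rightarrow> nat \<Rightarrow> (nat list \<Rightarrow> nat) pmf" where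
  "coloring_pmf k \<Delta> l = pmf_of_set (colorings k \<Delta> l)"

lemma finite_tree_verts: "finite (tree_verts \<Delta> l)"
  using finite_lists_length_le[of "{..<\<Delta>}" l] by (simp add: tree_verts_def conj_commute)

lemma finite_colorings: "finite (colorings k \<Delta> l)"
  unfolding colorings_def by (simp add: finite_PiE finite_tree_verts)

lemma colorings_nonempty:
  assumes "k \<ge> 2"
  shows "colorings k \<Delta> l \<noteq> {}"
proof -
  have "(\<lambda>v\<in>tree_verts \<Delta> l. length v mod 2 + 1) \<in> colorings k \<Delta> l"
    using assms by (auto simp: colorings_def tree_edges_def mod_Suc split: if_splits)
  then show ?thesis by blast
qed

end

theory Submission
  imports Defs "HOL-Real_Asymp.Real_Asymp"
begin

text \<open>
  Given the leaves, the law of the root color satisfies a recursion: the belief of a vertex is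
  proportional to the product over its children of one minus their beliefs (belief propagation,
  \<open>bp\<close>). The subtrees at the children of the root are not independent, but their joint law has
  density at most \<open>(k / (k - 1)) ^ \<Delta> \<le> \<Delta>\<close> with respect to the product of the uniform
  distributions, under which every belief has mean exactly \<open>1 / k\<close>. As all failure probabilities
  are below \<open>exp (- \<Delta> powr \<gamma>)\<close> for a small \<open>\<gamma> > 0\<close>, this factor is harmless. (The lemmas write
  \<open>n\<close> for \<open>\<Delta>\<close> and \<open>g\<close> for \<open>\<gamma>\<close>.)

  If \<open>k \<ge> \<Delta>\<^sup>2\<close>, the recursion contracts deterministically. Otherwise an occupancy bound shows that one
  level above the leaves all beliefs are at most \<open>\<Delta> powr (- a)\<close>, and Bernstein's inequality then
  makes the deviation \<open>dev\<close> of the beliefs from \<open>1 / k\<close> smaller than \<open>\<Delta> powr (- 1 - 4 \<gamma>)\<close> at the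
  second level. From there on the invariant is the stretched exponential tail
  \<open>Pr (dev > s) \<le> exp (- \<Delta> powr \<gamma> * (s / e) powr \<gamma>)\<close> for \<open>s \<ge> e\<close>, where the scale \<open>e\<close> gains a factor
  \<open>\<Delta> powr (- 1/8)\<close> with every level: children with deviation at most \<open>e\<close> cancel by
  concentration, and the total deviation of the others, each of which influences its parent with
  weight of order \<open>1 / k\<close>, inherits the tail because \<open>x powr \<gamma>\<close> is subadditive.
\<close>

section \<open>Uniform distributions on finite sets\<close>

text \<open>The claimed failure probability decays doubly exponentially in the depth, while
  concentration at one vertex gains only a fixed power of \<open>\<Delta>\<close> in the exponent.
  This is why a whole tail is propagated instead of a single probability: at depth \<open>l\<close>
  the scale is about \<open>\<Delta> powr (- l/8)\<close>, and reading the tail at the far larger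
  deviation \<open>\<Delta> powr (- l/16)\<close> makes \<open>(s / e) powr \<gamma>\<close> at
  least of order \<open>\<Delta> powr (\<gamma> * l / 16)\<close>. The gap between the two rates is
  thus traded for probability, which fixes \<open>\<alpha> = 1/16\<close> and
  \<open>\<alpha>' = \<gamma> / 16\<close>. The gain \<open>1/8\<close> per level is not tight:
  \<open>\<Delta>\<close> centred terms of size \<open>e\<close> fluctuate by about
  \<open>sqrt \<Delta> * e\<close>, and the parent divides by \<open>k\<close>, at least
  \<open>\<Delta> powr (15/16)\<close>. The surplus pays for logarithms, union bounds and the
  density factor. The two lowest levels are separate because a leaf is a point mass: the product
  over children can be expanded around the uniform belief only once \<open>\<Delta>\<close> times
  the typical deviation is small, hence an entry scale below \<open>1 / \<Delta>\<close>.\<close>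

definition avg :: "'a set \<Rightarrow> ('a \<Rightarrow> real) \<Rightarrow> real" where
  "avg A f = (\<Sum>x\<in>A. f x) / real (card A)"

definition freq :: "'a set \<Rightarrow> ('a \<Rightarrow> bool) \<Rightarrow> real" where
  "freq A P = real (card {x \<in> A. P x}) / real (card A)"

lemma freq_eq_avg: "finite A \<Longrightarrow> freq A P = avg A (\<lambda>x. of_bool (P x))"
  by (simp add: freq_def avg_def Collect_conj_eq Int_commute sum.If_cases of_bool_def)

lemma avg_mono: "(\<And>x. x \<in> A \<Longrightarrow> f x \<le> g x) \<Longrightarrow> avg A f \<le> avg A g"
  unfolding avg_def by (intro divide_right_mono sum_mono) auto

lemma avg_cmult: "avg A (\<lambda>x. c * f x) = c * avg A f"
  by (simp add: avg_def sum_distrib_left)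

lemma avg_add: "avg A (\<lambda>x. f x + g x) = avg A f + avg A g"
  by (simp add: avg_def sum.distrib add_divide_distrib)

lemma avg_sum: "avg A (\<lambda>x. \<Sum>i\<in>I. f i x) = (\<Sum>i\<in>I. avg A (f i))"
proof -
  have "(\<Sum>x\<in>A. \<Sum>i\<in>I. f i x) = (\<Sum>i\<in>I. \<Sum>x\<in>A. f i x)" by (rule sum.swap)
  then show ?thesis by (simp add: avg_def sum_divide_distrib)
qed

lemma avg_const: "finite A \<Longrightarrow> A \<noteq> {} \<Longrightarrow> avg A (\<lambda>_. c) = c"
  by (simp add: avg_def)

lemma freq_nonneg: "0 \<le> freq A P"
  by (simp add: freq_def)

lemma freq_mono:
  assumes "finite A" "\<And>x. x \<in> A \<Longrightarrow> P x \<Longrightarrow> Q x"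
  shows "freq A P \<le> freq A Q"
  unfolding freq_eq_avg[OF assms(1)] by (intro avg_mono) (use assms(2) in auto)

lemma freq_eq_0: "(\<And>x. x \<in> A \<Longrightarrow> \<not> P x) \<Longrightarrow> freq A P = 0"
proof -
  assume "\<And>x. x \<in> A \<Longrightarrow> \<not> P x"
  then have "{x \<in> A. P x} = {}" by auto
  show ?thesis unfolding freq_def \<open>{x \<in> A. P x} = {}\<close> by simp
qed

lemma freq_disj_le:
  assumes "finite A"
  shows "freq A (\<lambda>x. P x \<or> Q x) \<le> freq A P + freq A Q"
  unfolding freq_eq_avg[OF assms] avg_add[symmetric] by (intro avg_mono) auto

lemma freq_bex_le:
  assumes "finite A" "finite S"
  shows "freq A (\<lambda>x. \<exists>c\<in>S. P c x) \<le> (\<Sum>c\<in>S. freq A (P c))"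
  unfolding freq_eq_avg[OF assms(1)] avg_sum[symmetric]
proof (intro avg_mono)
  fix x assume "x \<in> A"
  show "of_bool (\<exists>c\<in>S. P c x) \<le> (\<Sum>c\<in>S. of_bool (P c x) :: real)"
  proof (cases "\<exists>c\<in>S. P c x")
    case True
    then obtain c where "c \<in> S" "P c x" by blast
    then have "of_bool (P c x) \<le> (\<Sum>c\<in>S. of_bool (P c x) :: real)"
      using assms(2) by (intro member_le_sum) auto
    with True \<open>P c x\<close> show ?thesis by simp
  qed (simp add: sum_nonneg)
qed

section \<open>Exponential moments of sums of independent samples\<close>

text \<open>Exponential Markov inequality: the coordinates of a uniform element of
  \<open>I \<rightarrow>\<^sub>E A\<close> are independent, so the exponential moment factorizes.
  The rate is absorbed into \<open>g\<close>, so that unbounded summands can use it as well.\<close>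

lemma freq_PiE_chernoff:
  assumes A: "finite A" "A \<noteq> {}" and I: "finite I"
  shows "freq (I \<rightarrow>\<^sub>E A) (\<lambda>f. w \<le> (\<Sum>i\<in>I. g (f i)))
           \<le> exp (- w) * avg A (\<lambda>x. exp (g x)) ^ card I"
proof -
  have fin: "finite (I \<rightarrow>\<^sub>E A)" using A I by (simp add: finite_PiE)
  have "freq (I \<rightarrow>\<^sub>E A) (\<lambda>f. w \<le> (\<Sum>i\<in>I. g (f i)))
      \<le> avg (I \<rightarrow>\<^sub>E A) (\<lambda>f. exp (- w) * (\<Prod>i\<in>I. exp (g (f i))))"
    unfolding freq_eq_avg[OF fin]
    by (intro avg_mono) (auto simp: of_bool_def exp_sum[OF I, symmetric] exp_add[symmetric])
  also have "\<dots> = exp (- w) * avg (I \<rightarrow>\<^sub>E A) (\<lambda>f. \<Prod>i\<in>I. exp (g (f i)))"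
    by (rule avg_cmult)
  also have "avg (I \<rightarrow>\<^sub>E A) (\<lambda>f. \<Prod>i\<in>I. exp (g (f i))) = avg A (\<lambda>x. exp (g x)) ^ card I"
  proof -
    have "(\<Sum>f\<in>I \<rightarrow>\<^sub>E A. \<Prod>i\<in>I. exp (g (f i))) = (\<Prod>i\<in>I. \<Sum>x\<in>A. exp (g x))"
      using prod_sum_PiE[of I "\<lambda>_. A" "\<lambda>_ x. exp (g x)"] A I by simp
    then show ?thesis
      using I by (simp add: avg_def card_PiE power_divide)
  qed
  finally show ?thesis .
qed

text \<open>Only an upper bound on \<open>x\<close> is required, as in one-sided Bernstein
  estimates. For negative \<open>x\<close>, the right-hand side times the quadratic Taylor lower
  bound of \<open>exp (- x)\<close> is at least 1.\<close>

lemma exp_le_quadratic: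
  fixes x :: real
  assumes "x \<le> 1"
  shows "exp x \<le> 1 + x + x\<^sup>2"
proof (cases "x \<ge> 0")
  case True
  then show ?thesis using exp_bound[of x] assms by simp
next
  case False
  then have pos: "1 + (- x) + (- x)\<^sup>2 / 2 \<le> exp (- x)"
    by (intro exp_lower_Taylor_quadratic) simp
  have q: "0 < 1 + x + x\<^sup>2"
  proof -
    have "1 + x + x\<^sup>2 = (x + 1/2)\<^sup>2 + 3/4" by (simp add: power2_eq_square algebra_simps)
    moreover have "0 \<le> (x + 1/2)\<^sup>2" by simp
    ultimately show ?thesis by linarith
  qed
  have "1 \<le> 1 + x\<^sup>2 / 2 - x * x\<^sup>2 / 2 + x\<^sup>2 * x\<^sup>2 / 2"
  proof -
    have "x * x\<^sup>2 \<le> 0" using False by (intro mult_nonpos_nonneg) auto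
    moreover have "0 \<le> x\<^sup>2" "0 \<le> x\<^sup>2 * x\<^sup>2" by simp_all
    ultimately show ?thesis by linarith
  qed
  also have "\<dots> = (1 + x + x\<^sup>2) * (1 + (- x) + (- x)\<^sup>2 / 2)"
    by (simp add: power2_eq_square field_simps)
  also have "\<dots> \<le> (1 + x + x\<^sup>2) * exp (- x)"
    using pos q by (intro mult_left_mono) auto
  finally have "exp x * 1 \<le> exp x * ((1 + x + x\<^sup>2) * exp (- x))"
    by (intro mult_left_mono) auto
  also have "\<dots> = (1 + x + x\<^sup>2) * (exp x * exp (- x))" by (simp add: algebra_simps)
  also have "exp x * exp (- x) = 1" by (simp add: exp_minus)
  finally show ?thesis by simp
qed

text \<open>The mean bound \<open>m\<close> need not be 0: beliefs are truncated before this is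
  applied, which destroys their exact centring, and \<open>m\<close> carries the resulting
  bias.\<close>

lemma freq_PiE_bernstein:
  fixes t b m v \<theta> :: real
  assumes A: "finite A" "A \<noteq> {}" and I: "finite I"
    and lam: "0 \<le> t" "t * b \<le> 1"
    and Z: "\<And>x. x \<in> A \<Longrightarrow> Z x \<le> b" and m: "avg A Z \<le> m" and v: "avg A (\<lambda>x. (Z x)\<^sup>2) \<le> v"
  shows "freq (I \<rightarrow>\<^sub>E A) (\<lambda>f. \<theta> \<le> (\<Sum>i\<in>I. Z (f i)))
           \<le> exp (- t * \<theta> + card I * (t * m + t\<^sup>2 * v))"
proof -
  have fin: "finite (I \<rightarrow>\<^sub>E A)" using A I by (simp add: finite_PiE)
  have "freq (I \<rightarrow>\<^sub>E A) (\<lambda>f. \<theta> \<le> (\<Sum>i\<in>I. Z (f i)))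
      \<le> freq (I \<rightarrow>\<^sub>E A) (\<lambda>f. t * \<theta> \<le> (\<Sum>i\<in>I. t * Z (f i)))"
    by (intro freq_mono fin) (auto simp: sum_distrib_left[symmetric] lam(1) mult_left_mono)
  also have "\<dots> \<le> exp (- (t * \<theta>)) * avg A (\<lambda>x. exp (t * Z x)) ^ card I"
    by (rule freq_PiE_chernoff[OF A I])
  also have "avg A (\<lambda>x. exp (t * Z x)) \<le> exp (t * m + t\<^sup>2 * v)"
  proof -
    have "avg A (\<lambda>x. exp (t * Z x)) \<le> avg A (\<lambda>x. 1 + (t * Z x + t\<^sup>2 * (Z x)\<^sup>2))"
    proof (intro avg_mono)
      fix x assume "x \<in> A"
      then have "t * Z x \<le> 1" using Z[of x] lam mult_left_mono[of "Z x" b t] by linarith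
      from exp_le_quadratic[OF this]
      show "exp (t * Z x) \<le> 1 + (t * Z x + t\<^sup>2 * (Z x)\<^sup>2)" by (simp add: power_mult_distrib)
    qed
    also have "\<dots> = 1 + (t * avg A Z + t\<^sup>2 * avg A (\<lambda>x. (Z x)\<^sup>2))"
      by (simp add: avg_add avg_cmult avg_const A)
    also have "\<dots> \<le> 1 + (t * m + t\<^sup>2 * v)"
      using m v lam by (intro add_mono mult_left_mono) auto
    also have "\<dots> \<le> exp (t * m + t\<^sup>2 * v)" by (rule exp_ge_add_one_self)
    finally show ?thesis .
  qed
  then have "exp (- (t * \<theta>)) * avg A (\<lambda>x. exp (t * Z x)) ^ card I
      \<le> exp (- (t * \<theta>)) * exp (t * m + t\<^sup>2 * v) ^ card I"
    by (intro mult_left_mono power_mono) (auto simp: avg_def intro!: divide_nonneg_nonneg sum_nonneg)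
  also have "\<dots> = exp (- t * \<theta> + card I * (t * m + t\<^sup>2 * v))"
    by (simp add: exp_of_nat_mult[symmetric] exp_add[symmetric])
  finally show ?thesis .
qed

text \<open>Cut the range of \<open>W\<close> into unit layers. On layer \<open>j\<close> the
  integrand is at most \<open>exp (L / 3 * (j + 2))\<close> and the frequency at most
  \<open>exp (- L * (1 + j))\<close>; giving up two thirds of the rate leaves a geometric series
  with ratio at most 1/2.\<close>

lemma avg_exp_tail:
  assumes A: "finite A" "A \<noteq> {}" and L: "L \<ge> 2"
    and tail: "\<And>w. w \<ge> 1 \<Longrightarrow> freq A (\<lambda>x. W x > w) \<le> exp (- (L * w))"
  shows "avg A (\<lambda>x. if W x > 1 then exp (L / 3 * W x) else 0) \<le> 2 * exp (- (L / 3))"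
proof -
  obtain B where B: "\<And>x. x \<in> A \<Longrightarrow> W x \<le> B"
    using A(1) by (metis finite_imageI Max_ge imageI)
  define J where "J = nat \<lceil>B\<rceil>"
  have "avg A (\<lambda>x. if W x > 1 then exp (L / 3 * W x) else 0)
      \<le> avg A (\<lambda>x. \<Sum>j<J. exp (L / 3 * (real j + 2)) * of_bool (W x > 1 + real j))"
  proof (intro avg_mono)
    fix x assume x: "x \<in> A"
    show "(if W x > 1 then exp (L / 3 * W x) else 0)
        \<le> (\<Sum>j<J. exp (L / 3 * (real j + 2)) * of_bool (W x > 1 + real j))"
    proof (cases "W x > 1")
      case True
      \<comment> \<open>The layer with \<open>1 + j < W x\<close> and
        \<open>W x \<le> j + 2\<close>; since \<open>W x > 1\<close> the ceiling is at least 2, so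
        \<open>nat\<close> loses nothing.\<close>
      define j where "j = nat (\<lceil>W x\<rceil> - 2)"
      have j: "1 + real j < W x" "W x \<le> real j + 2" using True unfolding j_def by linarith+
      have "j < J" using j B[OF x] unfolding J_def by linarith
      have "exp (L / 3 * W x) \<le> exp (L / 3 * (real j + 2))"
        using j L by simp
      also have "\<dots> = exp (L / 3 * (real j + 2)) * of_bool (W x > 1 + real j)" using j by simp
      also have "\<dots> \<le> (\<Sum>j<J. exp (L / 3 * (real j + 2)) * of_bool (W x > 1 + real j))"
        using \<open>j < J\<close> by (intro member_le_sum) auto
      finally show ?thesis using True by simp
    qed (auto intro!: sum_nonneg)
  qed
  also have "\<dots> = (\<Sum>j<J. exp (L / 3 * (real j + 2)) * freq A (\<lambda>x. W x > 1 + real j))"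
    by (simp only: avg_sum avg_cmult freq_eq_avg[OF A(1)])
  also have "\<dots> \<le> (\<Sum>j<J. exp (- (L / 3)) * (1/2) ^ j)"
  proof (intro sum_mono)
    fix j
    have "exp (L / 3 * (real j + 2)) * freq A (\<lambda>x. W x > 1 + real j)
        \<le> exp (L / 3 * (real j + 2)) * exp (- (L * (1 + real j)))"
      by (intro mult_left_mono tail) auto
    also have "\<dots> = exp (- (L / 3)) * exp (j * (- (2 * L / 3)))"
      by (simp add: exp_add[symmetric] algebra_simps)
    also have "exp (j * (- (2 * L / 3))) = exp (- (2 * L / 3)) ^ j"
      by (simp only: exp_of_nat_mult)
    also have "exp (- (2 * L / 3)) \<le> 1 / 2"
    proof -
      have "2 \<le> 1 + 2 * L / 3" using L by simp
      also have "\<dots> \<le> exp (2 * L / 3)" by (rule exp_ge_add_one_self)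
      finally show ?thesis by (simp add: exp_minus field_simps)
    qed
    then have "exp (- (L / 3)) * exp (- (2 * L / 3)) ^ j \<le> exp (- (L / 3)) * (1/2) ^ j"
      by (intro mult_left_mono power_mono) auto
    finally show "exp (L / 3 * (real j + 2)) * freq A (\<lambda>x. W x > 1 + real j) \<le> exp (- (L / 3)) * (1/2) ^ j" .
  qed
  also have "\<dots> = exp (- (L / 3)) * (\<Sum>j<J. (1/2) ^ j)" by (simp add: sum_distrib_left)
  also have "(\<Sum>j<J. (1/2 :: real) ^ j) \<le> 2"
    by (simp add: sum_gp_strict)
  then have "exp (- (L / 3)) * (\<Sum>j<J. (1/2 :: real) ^ j) \<le> exp (- (L / 3)) * 2"
    by (intro mult_left_mono) auto
  finally show ?thesis by (simp add: mult.commute)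
qed

section \<open>The belief recursion\<close>

definition dev :: "nat \<Rightarrow> (nat \<Rightarrow> real) \<Rightarrow> real" where
  "dev k x = Max ((\<lambda>c. \<bar>x c - 1 / real k\<bar>) ` {1..k})"

definition prob_vec :: "nat \<Rightarrow> (nat \<Rightarrow> real) \<Rightarrow> bool" where
  "prob_vec k x \<longleftrightarrow> (\<forall>c\<in>{1..k}. 0 \<le> x c) \<and> (\<Sum>c\<in>{1..k}. x c) = 1"

text \<open>If the children block every color, the denominator is 0 and \<open>bp\<close> is
  constantly 0. Positivity of the denominator is therefore a separate hypothesis wherever
  \<open>bp\<close> must be a probability vector.\<close>

definition bp :: "nat \<Rightarrow> 'i set \<Rightarrow> ('i \<Rightarrow> nat \<Rightarrow> real) \<Rightarrow> nat \<Rightarrow> real" where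
  "bp k I X c = (\<Prod>i\<in>I. 1 - X i c) / (\<Sum>c'\<in>{1..k}. \<Prod>i\<in>I. 1 - X i c')"

lemma dev_ge: "c \<in> {1..k} \<Longrightarrow> \<bar>x c - 1 / real k\<bar> \<le> dev k x"
  unfolding dev_def by (intro Max_ge) auto

lemma dev_le_iff: "k > 0 \<Longrightarrow> dev k x \<le> b \<longleftrightarrow> (\<forall>c\<in>{1..k}. \<bar>x c - 1 / real k\<bar> \<le> b)"
  unfolding dev_def by (subst Max_le_iff) auto

lemma dev_nonneg: "k > 0 \<Longrightarrow> 0 \<le> dev k x"
  using dev_ge[of 1 k x] by auto

lemma prob_vec_le_1: "prob_vec k x \<Longrightarrow> c \<in> {1..k} \<Longrightarrow> x c \<le> 1"
  unfolding prob_vec_def using member_le_sum[of c "{1..k}" x] by simp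

lemma dev_le_1: "k > 0 \<Longrightarrow> prob_vec k x \<Longrightarrow> dev k x \<le> 1"
proof (subst dev_le_iff, assumption, intro ballI)
  fix c assume k: "k > 0" and x: "prob_vec k x" and c: "c \<in> {1..k}"
  have "0 \<le> x c" "x c \<le> 1" using x c prob_vec_le_1 by (auto simp: prob_vec_def)
  moreover have "0 \<le> 1 / real k" "1 / real k \<le> 1" using k by auto
  ultimately show "\<bar>x c - 1 / real k\<bar> \<le> 1" by linarith
qed

lemma bp_cong:
  assumes "\<And>i c. i \<in> I \<Longrightarrow> c \<in> {1..k} \<Longrightarrow> X i c = Y i c" "c \<in> {1..k}"
  shows "bp k I X c = bp k I Y c"
  unfolding bp_def using assms by (auto intro!: arg_cong2[where f="(/)"] sum.cong prod.cong)

lemma prob_vec_bp: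
  assumes "\<And>i c. i \<in> I \<Longrightarrow> c \<in> {1..k} \<Longrightarrow> X i c \<le> 1"
    and "(\<Sum>c\<in>{1..k}. \<Prod>i\<in>I. 1 - X i c) > 0"
  shows "prob_vec k (bp k I X)"
  using assms unfolding prob_vec_def bp_def
  by (auto simp: sum_divide_distrib[symmetric] intro!: divide_nonneg_pos prod_nonneg)

text \<open>Adding one child changes the belief \<open>F\<close> to \<open>F c (1 - x c) / (1 - \<langle>F, x\<rangle>)\<close>; as \<open>\<langle>F, x\<rangle>\<close> is at
  most the maximal belief, a single child moves a spread-out belief only a little, however
  biased it is.\<close>
lemma bp_insert:
  assumes I: "finite I" "i \<notin> I" and x: "prob_vec k (X i)" and c: "c \<in> {1..k}"
    and F: "prob_vec k (bp k I X)" and M: "\<And>c. c \<in> {1..k} \<Longrightarrow> bp k I X c \<le> M" "M < 1"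
    and pos: "(\<Sum>c\<in>{1..k}. \<Prod>i\<in>I. 1 - X i c) > 0"
  shows "(\<Sum>c\<in>{1..k}. \<Prod>i\<in>insert i I. 1 - X i c) > 0"
    and "bp k (insert i I) X c \<le> M / (1 - M)"
    and "\<bar>bp k (insert i I) X c - bp k I X c\<bar> \<le> M / (1 - M) * (2 * dev k (X i))"
proof -
  have k: "k > 0" using c by auto
  define F where "F = bp k I X"
  define D where "D = (\<Sum>c\<in>{1..k}. \<Prod>i\<in>I. 1 - X i c)"
  define s where "s = (\<Sum>c\<in>{1..k}. F c * X i c)"
  have F0: "F c \<ge> 0" if "c \<in> {1..k}" for c using F that by (auto simp: prob_vec_def F_def)
  have FM: "F c \<le> M" if "c \<in> {1..k}" for c using M that by (auto simp: F_def)
  have F1: "(\<Sum>c\<in>{1..k}. F c) = 1" using F by (auto simp: prob_vec_def F_def)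
  have x0: "X i c \<ge> 0" "X i c \<le> 1" if "c \<in> {1..k}" for c
    using x that prob_vec_le_1[OF x that] by (auto simp: prob_vec_def)
  have x1: "(\<Sum>c\<in>{1..k}. X i c) = 1" using x by (auto simp: prob_vec_def)
  have num: "(\<Prod>i\<in>I. 1 - X i c) = D * F c" for c using pos by (simp add: F_def bp_def D_def)
  have "s \<le> (\<Sum>c\<in>{1..k}. M * X i c)"
    unfolding s_def using FM x0 by (intro sum_mono mult_right_mono) auto
  then have sM: "s \<le> M" by (simp only: sum_distrib_left[symmetric] x1 mult_1_right)
  have prod: "(\<Prod>i\<in>insert i I. 1 - X i c) = D * (F c * (1 - X i c))" for c
    using I by (simp add: num)
  have D': "(\<Sum>c\<in>{1..k}. \<Prod>i\<in>insert i I. 1 - X i c) = D * (1 - s)"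
    by (simp only: prod sum_distrib_left[symmetric] s_def right_diff_distrib sum_subtractf F1 mult_1_right)
  show "(\<Sum>c\<in>{1..k}. \<Prod>i\<in>insert i I. 1 - X i c) > 0"
    unfolding D' using pos sM M(2) by (intro mult_pos_pos) (auto simp: D_def)
  have bp': "bp k (insert i I) X c = F c * (1 - X i c) / (1 - s)"
  proof -
    have "bp k (insert i I) X c = D * (F c * (1 - X i c)) / (D * (1 - s))"
      unfolding bp_def D' by (simp only: prod)
    moreover have "D \<noteq> 0" using pos by (simp add: D_def)
    ultimately show ?thesis by simp
  qed
  have "F c * (1 - X i c) / (1 - s) \<le> F c / (1 - s)"
    using F0[OF c] x0[OF c] sM M(2) by (intro divide_right_mono) (auto simp: mult_left_le)
  also have "\<dots> \<le> M / (1 - M)"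
    using F0[OF c] FM[OF c] sM M(2) by (intro frac_le) auto
  finally show "bp k (insert i I) X c \<le> M / (1 - M)" by (simp add: bp')
  \<comment> \<open>\<open>s\<close> averages the entries of \<open>X i\<close> with weights
    \<open>F\<close>, so both \<open>s\<close> and \<open>X i c\<close> lie within
    \<open>dev k (X i)\<close> of \<open>1 / k\<close>.\<close>
  have "\<bar>s - X i c\<bar> \<le> 2 * dev k (X i)"
  proof -
    have "s - 1 / k = (\<Sum>c\<in>{1..k}. F c * (X i c - 1 / k))"
      by (simp add: s_def right_diff_distrib sum_subtractf sum_divide_distrib[symmetric] F1[simplified])
    also have "\<bar>\<dots>\<bar> \<le> (\<Sum>c\<in>{1..k}. F c * dev k (X i))"
      using F0 dev_ge[of _ k "X i"]
      by (intro order_trans[OF sum_abs] sum_mono) (auto simp: abs_mult mult_left_mono)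
    finally have "\<bar>s - 1 / k\<bar> \<le> dev k (X i)" by (simp add: sum_distrib_right[symmetric] F1[simplified])
    with dev_ge[OF c, of "X i"] show ?thesis by linarith
  qed
  have "F c * (1 - X i c) / (1 - s) - F c = F c / (1 - s) * (s - X i c)"
    using sM M(2) by (simp add: field_simps)
  then have "\<bar>F c * (1 - X i c) / (1 - s) - F c\<bar> = F c / (1 - s) * \<bar>s - X i c\<bar>"
    using F0[OF c] sM M(2) by (simp add: abs_mult)
  also have "\<dots> \<le> M / (1 - M) * (2 * dev k (X i))"
    using F0[OF c] FM[OF c] sM M(2) \<open>\<bar>s - X i c\<bar> \<le> 2 * dev k (X i)\<close>
    by (intro mult_mono frac_le) auto
  finally show "\<bar>bp k (insert i I) X c - bp k I X c\<bar> \<le> M / (1 - M) * (2 * dev k (X i))"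
    by (simp add: bp' F_def)
qed

text \<open>The children in \<open>E\<close> are added one at a time. Measured by its reciprocal
  \<open>r\<close>, the bound on the maximal belief drops by exactly 1 per child, because
  \<open>M = 1 / r\<close> gives \<open>M / (1 - M) = 1 / (r - 1)\<close>. As long as
  \<open>r\<close> stays above \<open>k / 2\<close>, each child costs at most \<open>4 / k\<close>
  times its own deviation, even if it is a point mass.\<close>

lemma bp_union_perturb:
  fixes r d0 :: real
  assumes E: "finite E" and J: "finite J" "J \<inter> E = {}" and k: "k > 0"
    and x: "\<And>i. i \<in> J \<union> E \<Longrightarrow> prob_vec k (X i)"
    and pos: "(\<Sum>c\<in>{1..k}. \<Prod>i\<in>J. 1 - X i c) > 0"
    and r: "\<And>c. c \<in> {1..k} \<Longrightarrow> bp k J X c \<le> 1 / r" "r - real (card E) \<ge> real k / 2" "r - real (card E) \<ge> 1"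
    and d0: "\<And>c. c \<in> {1..k} \<Longrightarrow> \<bar>bp k J X c - 1 / k\<bar> \<le> d0"
    and c: "c \<in> {1..k}"
  shows "\<bar>bp k (J \<union> E) X c - 1 / k\<bar> \<le> d0 + 4 / k * (\<Sum>i\<in>E. dev k (X i))"
proof -
  have "(\<Sum>c\<in>{1..k}. \<Prod>i\<in>J \<union> E'. 1 - X i c) > 0 \<and>
      (\<forall>c\<in>{1..k}. bp k (J \<union> E') X c \<le> 1 / (r - card E') \<and>
        \<bar>bp k (J \<union> E') X c - 1 / k\<bar> \<le> d0 + 4 / k * (\<Sum>i\<in>E'. dev k (X i)))"
    if "E' \<subseteq> E" for E'
    using finite_subset[OF that E] that
  proof (induction E')
    case empty
    then show ?case using pos r d0 by simp
  next
    case (insert i E')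
    then have IH: "(\<Sum>c\<in>{1..k}. \<Prod>i\<in>J \<union> E'. 1 - X i c) > 0"
      "\<And>c. c \<in> {1..k} \<Longrightarrow> bp k (J \<union> E') X c \<le> 1 / (r - card E')"
      "\<And>c. c \<in> {1..k} \<Longrightarrow> \<bar>bp k (J \<union> E') X c - 1 / k\<bar> \<le> d0 + 4 / k * (\<Sum>i\<in>E'. dev k (X i))"
      by auto
    have "card (insert i E') \<le> card E" using insert.prems E by (intro card_mono) auto
    then have cardE: "real (card E') + 1 \<le> card E" using insert by simp
    define M where "M = 1 / (r - card E')"
    have rr: "r - card E' > 1" "r - card E' - 1 \<ge> real k / 2" using cardE r k by linarith+
    have M1: "M < 1" using rr by (simp add: M_def)
    have "1 / (1 / M - 1) = M / (1 - M)" using rr M1 by (simp add: M_def field_simps)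
    then have MM: "M / (1 - M) = 1 / (r - card (insert i E'))"
      using insert rr by (simp add: M_def algebra_simps)
    have M2: "M / (1 - M) * 2 \<le> 4 / k"
    proof -
      have "M / (1 - M) = 1 / (r - card E' - 1)" unfolding MM using insert by (simp add: algebra_simps)
      also have "\<dots> \<le> 1 / (real k / 2)" using rr k by (intro divide_left_mono) auto
      finally have "M / (1 - M) * 2 \<le> 1 / (real k / 2) * 2" by (intro mult_right_mono) auto
      then show ?thesis by simp
    qed
    have nin: "i \<notin> J \<union> E'" "finite (J \<union> E')" "i \<in> J \<union> E" using insert J by auto
    have pv: "prob_vec k (bp k (J \<union> E') X)"
    proof (rule prob_vec_bp)
      fix j c assume "j \<in> J \<union> E'" "c \<in> {1..k}"
      then show "X j c \<le> 1" using x[of j] insert.prems prob_vec_le_1 by auto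
    qed (rule IH(1))
    have un: "J \<union> insert i E' = insert i (J \<union> E')" by auto
    note step = bp_insert[OF nin(2,1) x[OF nin(3)] _ pv IH(2)[folded M_def] M1 IH(1)]
    show ?case unfolding un
    proof (intro conjI ballI)
      show "(\<Sum>c\<in>{1..k}. \<Prod>i\<in>insert i (J \<union> E'). 1 - X i c) > 0" using step(1)[of 1] k by auto
    next
      fix c assume c: "c \<in> {1..k}"
      show "bp k (insert i (J \<union> E')) X c \<le> 1 / (r - card (insert i E'))"
        using step(2)[OF c] by (simp only: MM)
      have "M / (1 - M) * (2 * dev k (X i)) \<le> 4 / k * dev k (X i)"
        using mult_right_mono[OF M2, of "dev k (X i)"] dev_nonneg[OF k, of "X i"] by simp
      then show "\<bar>bp k (insert i (J \<union> E')) X c - 1 / k\<bar> \<le> d0 + 4 / k * (\<Sum>i\<in>insert i E'. dev k (X i))"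
        using step(3)[OF c] IH(3)[OF c] insert by (simp add: distrib_left)
    qed
  qed
  from this[of E] c show ?thesis by auto
qed

text \<open>Writing \<open>1 - X i c = q * (1 - a i c)\<close>, the common factor
  \<open>q ^ card I\<close> cancels and the belief becomes a softmax of \<open>U c\<close>, the sum
  of \<open>ln (1 - a i c)\<close>. A second-order expansion of the logarithm bounds all
  \<open>U c\<close> by \<open>t\<close>, and a softmax of numbers within \<open>t\<close> of 0 is
  \<open>1 / k\<close> up to a factor between \<open>exp (- 2 * t)\<close> and
  \<open>exp (2 * t)\<close>.\<close>

lemma bp_bulk:
  assumes I: "finite I" and k: "k \<ge> 4"
    and Y: "\<And>i c. i \<in> I \<Longrightarrow> c \<in> {1..k} \<Longrightarrow> \<bar>X i c - 1 / k\<bar> \<le> 1 / 4"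
    and A: "\<And>c. c \<in> {1..k} \<Longrightarrow> \<bar>\<Sum>i\<in>I. (X i c - 1 / k)\<bar> \<le> A"
    and B: "\<And>c. c \<in> {1..k} \<Longrightarrow> (\<Sum>i\<in>I. (X i c - 1 / k)\<^sup>2) \<le> B"
    and AB: "A + B \<le> 1 / 8"
  shows "(\<Sum>c\<in>{1..k}. \<Prod>i\<in>I. 1 - X i c) > 0"
    and "c \<in> {1..k} \<Longrightarrow> \<bar>bp k I X c - 1 / k\<bar> \<le> 16 * (A + B) / k"
proof -
  define q where "q = 1 - 1 / real k"
  have q: "3 / 4 \<le> q" "q < 1" using k by (auto simp: q_def field_simps)
  define a where "a i c = (X i c - 1 / k) / q" for i c
  have a: "\<bar>a i c\<bar> \<le> 1 / 2" "1 - X i c = q * (1 - a i c)" if "i \<in> I" "c \<in> {1..k}" for i c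
  proof -
    have "\<bar>a i c\<bar> = \<bar>X i c - 1 / k\<bar> / q" using q by (simp add: a_def abs_divide)
    also have "\<dots> \<le> (1 / 4) / (3 / 4)" using Y[OF that] q by (intro frac_le) auto
    finally show "\<bar>a i c\<bar> \<le> 1 / 2" by simp
    have "q * a i c = X i c - 1 / k" using q by (simp add: a_def)
    then have "q * (1 - a i c) = q - (X i c - 1 / k)" by (simp only: right_diff_distrib mult_1_right)
    then show "1 - X i c = q * (1 - a i c)" by (simp add: q_def)
  qed
  define U where "U c = (\<Sum>i\<in>I. ln (1 - a i c))" for c
  \<comment> \<open>The factor 4 covers both \<open>1 / q\<close> and \<open>2 / q\<^sup>2\<close>,
    as \<open>q\<close> is at least 3/4. The hypothesis \<open>AB\<close> then says
    \<open>2 * t \<le> 1\<close>, the range in which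
    \<open>exp (2 * t) \<le> 1 + 4 * t\<close>.\<close>
  define t where "t = 4 * (A + B)"
  have U: "\<bar>U c\<bar> \<le> t" if c: "c \<in> {1..k}" for c
  proof -
    have "\<bar>U c - (\<Sum>i\<in>I. - a i c)\<bar> = \<bar>\<Sum>i\<in>I. ln (1 + - a i c) - (- a i c)\<bar>"
      by (simp only: U_def sum_subtractf) simp
    also have "\<dots> \<le> (\<Sum>i\<in>I. 2 * (- a i c)\<^sup>2)"
      using a(1) c by (intro order_trans[OF sum_abs] sum_mono abs_ln_one_plus_x_minus_x_bound) auto
    also have "\<dots> = 2 / q\<^sup>2 * (\<Sum>i\<in>I. (X i c - 1 / k)\<^sup>2)"
      by (simp add: a_def power_divide sum_distrib_left sum_divide_distrib)
    also have "\<dots> \<le> 4 * B"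
    proof -
      have "(3/4)\<^sup>2 \<le> q\<^sup>2" using q by (intro power_mono) auto
      then have "2 / q\<^sup>2 \<le> 2 / (9/16)" by (intro divide_left_mono) (auto simp: power2_eq_square)
      then have "2 / q\<^sup>2 \<le> 4" by simp
      then show ?thesis using B[OF c] by (intro mult_mono) (auto intro!: sum_nonneg)
    qed
    finally have 1: "\<bar>U c - (\<Sum>i\<in>I. - a i c)\<bar> \<le> 4 * B" .
    have "\<bar>\<Sum>i\<in>I. - a i c\<bar> = \<bar>\<Sum>i\<in>I. X i c - 1 / k\<bar> / q"
      using q by (simp add: a_def sum_negf sum_divide_distrib[symmetric] abs_divide)
    also have "\<dots> \<le> A / (1/4)" using A[OF c] q by (intro frac_le) auto
    finally show ?thesis using 1 by (simp add: t_def)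
  qed
  have t: "2 * t \<le> 1" "0 \<le> t" using AB U[of 1] k by (auto simp: t_def)
  have P: "(\<Prod>i\<in>I. 1 - X i c) = q ^ card I * exp (U c)" if c: "c \<in> {1..k}" for c
  proof -
    have "(\<Prod>i\<in>I. 1 - X i c) = (\<Prod>i\<in>I. q * exp (ln (1 - a i c)))"
    proof (intro prod.cong refl)
      fix i assume i: "i \<in> I"
      have "1 - a i c > 0" using a(1)[OF i c] by linarith
      then show "1 - X i c = q * exp (ln (1 - a i c))" using a(2)[OF i c] by simp
    qed
    then show ?thesis using I by (simp add: prod.distrib U_def exp_sum)
  qed
  have S: "(\<Sum>c\<in>{1..k}. \<Prod>i\<in>I. 1 - X i c) = q ^ card I * (\<Sum>c\<in>{1..k}. exp (U c))"
    unfolding sum_distrib_left by (intro sum.cong refl P)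
  have S0: "(\<Sum>c\<in>{1..k}. exp (U c)) > 0" using k by (intro sum_pos) auto
  then show "(\<Sum>c\<in>{1..k}. \<Prod>i\<in>I. 1 - X i c) > 0"
    unfolding S using q by (intro mult_pos_pos) auto
  assume c: "c \<in> {1..k}"
  have bp: "bp k I X c = exp (U c) / (\<Sum>c\<in>{1..k}. exp (U c))"
    unfolding bp_def S P[OF c] using q by simp
  have lo: "k * exp (- t) \<le> (\<Sum>c\<in>{1..k}. exp (U c))"
  proof -
    have "real (card {1..k}) * exp (- t) \<le> (\<Sum>c\<in>{1..k}. exp (U c))"
      by (intro sum_bounded_below) (use U in \<open>force simp: abs_le_iff\<close>)
    then show ?thesis by simp
  qed
  have hi: "(\<Sum>c\<in>{1..k}. exp (U c)) \<le> k * exp t"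
  proof -
    have "(\<Sum>c\<in>{1..k}. exp (U c)) \<le> real (card {1..k}) * exp t"
      by (intro sum_bounded_above) (use U in \<open>force simp: abs_le_iff\<close>)
    then show ?thesis by simp
  qed
  have k0: "real k > 0" using k by simp
  have "bp k I X c \<le> exp t / (k * exp (- t))"
    unfolding bp using U[OF c] lo k0 by (intro frac_le) auto
  also have "\<dots> = exp (2 * t) / k" by (simp add: exp_minus field_simps exp_add[symmetric])
  also have "\<dots> \<le> (1 + 4 * t) / k"
  proof (intro divide_right_mono)
    have "exp (2 * t) \<le> 1 + 2 * t + (2 * t)\<^sup>2" by (rule exp_le_quadratic[OF t(1)])
    also have "(2 * t)\<^sup>2 \<le> 2 * t" unfolding power2_eq_square using t mult_left_mono[of "2*t" 1 "2*t"] by simp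
    finally show "exp (2 * t) \<le> 1 + 4 * t" by simp
  qed (use k0 in auto)
  finally have up: "bp k I X c \<le> 1 / k + 4 * t / k" by (simp add: add_divide_distrib)
  have "(1 - 2 * t) / k \<le> exp (- (2 * t)) / k"
    using k0 exp_ge_add_one_self[of "- (2 * t)"] by (intro divide_right_mono) auto
  also have "\<dots> = exp (- t) / (k * exp t)" by (simp add: exp_minus field_simps exp_add[symmetric])
  also have "\<dots> \<le> bp k I X c"
    unfolding bp using U[OF c] hi S0 k0 by (intro frac_le) auto
  finally have "1 / k - 2 * t / k \<le> bp k I X c" by (simp add: diff_divide_distrib)
  moreover have "2 * t / k \<le> 4 * t / k" using t k0 by (intro divide_right_mono) auto
  ultimately have "\<bar>bp k I X c - 1 / k\<bar> \<le> 4 * t / k" using up by (simp add: abs_le_iff)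
  then show "\<bar>bp k I X c - 1 / k\<bar> \<le> 16 * (A + B) / k" by (simp add: t_def)
qed

text \<open>Subadditivity in normalized form: every \<open>d i / u\<close> is at most 1 and hence at
  most its own \<open>g\<close>-th power.\<close>

lemma sum_le_of_sum_powr_le:
  fixes d :: "'a \<Rightarrow> real"
  assumes S: "finite S" and d: "\<And>i. i \<in> S \<Longrightarrow> 0 \<le> d i" and g: "0 < g" "g \<le> 1" and u: "u > 0"
    and le: "(\<Sum>i\<in>S. d i powr g) \<le> u powr g"
  shows "(\<Sum>i\<in>S. d i) \<le> u"
proof -
  have "d i / u \<le> d i powr g / u powr g" if i: "i \<in> S" for i
  proof (cases "d i = 0")
    case False
    then have pos: "d i > 0" using d[OF i] by simp
    have "d i powr g \<le> (\<Sum>i\<in>S. d i powr g)"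
      using member_le_sum[of i S "\<lambda>i. d i powr g"] S i by simp
    from order_trans[OF this le] have "d i powr g \<le> u powr g" .
    have "d i \<le> u"
    proof (rule ccontr)
      assume "\<not> d i \<le> u"
      then have "u powr g < d i powr g" using g u by (intro powr_less_mono2) auto
      with \<open>d i powr g \<le> u powr g\<close> show False by simp
    qed
    then have "(d i / u) powr 1 \<le> (d i / u) powr g"
      using pos u g by (intro powr_mono') auto
    then show ?thesis using pos u by (simp add: powr_divide)
  qed (use u in simp)
  then have "(\<Sum>i\<in>S. d i / u) \<le> (\<Sum>i\<in>S. d i powr g / u powr g)" by (rule sum_mono)
  also have "\<dots> = (\<Sum>i\<in>S. d i powr g) / u powr g" by (simp add: sum_divide_distrib)
  also have "\<dots> \<le> 1" using le u by simp
  finally show ?thesis using u by (simp add: sum_divide_distrib[symmetric])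
qed

text \<open>Two thresholds sort the children. Up to \<open>e\<close> they enter with cancellation,
  through \<open>\<theta>\<close>; between \<open>e\<close> and \<open>s0\<close> they are summed in
  absolute value, through \<open>u\<close>; beyond \<open>s0\<close> they do not fit the logarithmic
  expansion and are added one by one to the belief formed by the others.\<close>

lemma bp_deviation:
  fixes e s0 u \<theta> :: real
  assumes I: "finite I" and k: "k \<ge> 4" and x: "\<And>i. i \<in> I \<Longrightarrow> prob_vec k (X i)"
    and e: "0 \<le> e" "e \<le> s0" "s0 \<le> 1/4" and th: "\<theta> \<ge> 0"
    and u: "(\<Sum>i | i \<in> I \<and> dev k (X i) > e. dev k (X i)) \<le> u"
    and E: "real (card {i \<in> I. dev k (X i) > s0}) \<le> real k / 4"
    and bulk: "\<And>c. c \<in> {1..k} \<Longrightarrow>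
      \<bar>\<Sum>i\<in>I. if dev k (X i) \<le> e then X i c - 1 / k else 0\<bar> \<le> \<theta>"
    and small: "48 * (card I * s0 + card I * s0\<^sup>2) \<le> 1"
    and c: "c \<in> {1..k}"
  shows "\<bar>bp k I X c - 1 / k\<bar> \<le> (16 * (\<theta> + u + (card I * e\<^sup>2 + s0 * u)) + 4 * u) / k"
proof -
  define d where "d i = dev k (X i)" for i
  define Ex where "Ex = {i \<in> I. d i > s0}"
  define J where "J = I - Ex"
  define n where "n = real (card I)"
  have d0: "0 \<le> d i" for i using dev_nonneg[of k] k by (simp add: d_def)
  have dY: "\<bar>X i c - 1 / k\<bar> \<le> d i" if "c \<in> {1..k}" for i c using dev_ge[OF that] by (simp add: d_def)
  have fin: "finite J" "finite Ex" "J \<inter> Ex = {}" "J \<union> Ex = I"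
    using I by (auto simp: J_def Ex_def)
  have dJ: "d i \<le> s0" if "i \<in> J" for i using that by (auto simp: J_def Ex_def)
  have cJ: "real (card J) \<le> n" using card_mono[of I J] I by (simp add: J_def n_def)
  have s0: "s0 \<ge> 0" using e by simp
  define M where "M = {i \<in> J. d i > e}"
  define B where "B = {i \<in> J. d i \<le> e}"
  have MB: "finite M" "finite B" "M \<inter> B = {}" "J = M \<union> B"
    using fin(1) by (auto simp: M_def B_def)
  have MB5: "B = {i \<in> I. d i \<le> e}"
    using e(2) by (auto simp: B_def J_def Ex_def)
  have "card B \<le> card I" unfolding MB5 using I by (intro card_mono) auto
  then have Bn: "real (card B) \<le> n" by (simp add: n_def)
  have sub: "(\<Sum>i\<in>S. d i) \<le> u" if "S \<subseteq> {i \<in> I. d i > e}" for S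
  proof -
    have "(\<Sum>i\<in>S. d i) \<le> (\<Sum>i | i \<in> I \<and> d i > e. d i)"
      using I that d0 by (intro sum_mono2) auto
    then show ?thesis using u unfolding d_def by (rule order_trans)
  qed
  have uM: "(\<Sum>i\<in>M. d i) \<le> u" by (rule sub) (auto simp: M_def J_def)
  have uE: "(\<Sum>i\<in>Ex. d i) \<le> u" by (rule sub) (use e in \<open>auto simp: Ex_def\<close>)
  have u0: "u \<ge> 0" using order_trans[OF sum_nonneg uE] d0 by blast
  \<comment> \<open>Both bounds in the minimum matter: the crude one keeps the expansion valid
    however large \<open>\<theta>\<close> and \<open>u\<close> are, the fine one enters the
    conclusion. The same holds for \<open>B2\<close>.\<close>
  define A where "A = min (n * s0) (\<theta> + u)"
  define B2 where "B2 = min (n * s0\<^sup>2) (n * e\<^sup>2 + s0 * u)"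
  have A: "\<bar>\<Sum>i\<in>J. (X i c - 1 / k)\<bar> \<le> A" if c: "c \<in> {1..k}" for c
  proof -
    have "\<bar>\<Sum>i\<in>J. (X i c - 1 / k)\<bar> \<le> real (card J) * s0"
      by (intro order_trans[OF sum_abs] sum_bounded_above order_trans[OF dY[OF c] dJ])
    also have "\<dots> \<le> n * s0" using cJ s0 by (intro mult_right_mono)
    finally have 1: "\<bar>\<Sum>i\<in>J. (X i c - 1 / k)\<bar> \<le> n * s0" .
    have "(\<Sum>i\<in>J. (X i c - 1 / k)) = (\<Sum>i\<in>M. (X i c - 1 / k)) + (\<Sum>i\<in>B. (X i c - 1 / k))"
      unfolding MB(4) by (rule sum.union_disjoint) (use MB in auto)
    also have "(\<Sum>i\<in>B. (X i c - 1 / k)) = (\<Sum>i\<in>I. if d i \<le> e then X i c - 1 / k else 0)"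
      unfolding MB5 by (rule sum.inter_filter[OF I])
    finally have "\<bar>\<Sum>i\<in>J. (X i c - 1 / k)\<bar> \<le> \<bar>\<Sum>i\<in>M. (X i c - 1 / k)\<bar> + \<theta>"
      using bulk[OF c] unfolding d_def by linarith
    also have "\<bar>\<Sum>i\<in>M. (X i c - 1 / k)\<bar> \<le> (\<Sum>i\<in>M. d i)"
      using dY[OF c] by (intro order_trans[OF sum_abs] sum_mono)
    finally show ?thesis using 1 uM by (simp add: A_def)
  qed
  have sq: "(X i c - 1 / k)\<^sup>2 \<le> b * d i" if "c \<in> {1..k}" "d i \<le> b" for i c b
  proof -
    have "\<bar>X i c - 1 / k\<bar> * \<bar>X i c - 1 / k\<bar> \<le> b * d i"
      using dY[OF that(1), of i] that(2) d0[of i] by (intro mult_mono) linarith+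
    then show ?thesis by (simp add: power2_eq_square abs_mult_self_eq)
  qed
  have B2: "(\<Sum>i\<in>J. (X i c - 1 / k)\<^sup>2) \<le> B2" if c: "c \<in> {1..k}" for c
  proof -
    have sq2: "(X i c - 1 / k)\<^sup>2 \<le> b\<^sup>2" if "d i \<le> b" for i b
      using sq[OF c that] that d0[of i] mult_left_mono[of "d i" b b] unfolding power2_eq_square by linarith
    have "(\<Sum>i\<in>J. (X i c - 1 / k)\<^sup>2) \<le> real (card J) * s0\<^sup>2"
      using dJ sq2 by (intro sum_bounded_above) auto
    also have "\<dots> \<le> n * s0\<^sup>2" using cJ by (intro mult_right_mono) auto
    finally have 1: "(\<Sum>i\<in>J. (X i c - 1 / k)\<^sup>2) \<le> n * s0\<^sup>2" .
    have "(\<Sum>i\<in>J. (X i c - 1 / k)\<^sup>2) = (\<Sum>i\<in>M. (X i c - 1 / k)\<^sup>2) + (\<Sum>i\<in>B. (X i c - 1 / k)\<^sup>2)"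
      unfolding MB(4) by (rule sum.union_disjoint) (use MB in auto)
    also have "(\<Sum>i\<in>B. (X i c - 1 / k)\<^sup>2) \<le> real (card B) * e\<^sup>2"
      using sq2 by (intro sum_bounded_above) (auto simp: B_def)
    also have "real (card B) * e\<^sup>2 \<le> n * e\<^sup>2" using Bn by (intro mult_right_mono) auto
    also have "(\<Sum>i\<in>M. (X i c - 1 / k)\<^sup>2) \<le> (\<Sum>i\<in>M. s0 * d i)"
      using sq[OF c] dJ by (intro sum_mono) (auto simp: M_def)
    also have "\<dots> \<le> s0 * u" using uM s0 by (simp add: sum_distrib_left[symmetric] mult_left_mono)
    finally show ?thesis using 1 by (simp add: B2_def)
  qed
  \<comment> \<open>The constant 48 makes \<open>16 * (A + B2)\<close> at most 1/3, so beliefs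
    formed by \<open>J\<close> are at most \<open>4 / (3 * k)\<close>. This is
    \<open>r = 3 * k / 4\<close>, and up to \<open>k / 4\<close> further children leave the
    \<open>k / 2\<close> that adding them requires.\<close>
  have "A \<le> n * s0" "B2 \<le> n * s0\<^sup>2" by (auto simp: A_def B2_def)
  then have "48 * (A + B2) \<le> 48 * (n * s0 + n * s0\<^sup>2)" by (intro mult_left_mono add_mono) auto
  also have "\<dots> \<le> 1" using small by (simp add: n_def)
  finally have AB48: "48 * (A + B2) \<le> 1" .
  then have AB: "A + B2 \<le> 1 / 8" by simp
  have Y: "\<bar>X i c - 1 / k\<bar> \<le> 1 / 4" if "i \<in> J" "c \<in> {1..k}" for i c
    using dY[OF that(2), of i] dJ[OF that(1)] e by linarith
  have bulkJ: "(\<Sum>c\<in>{1..k}. \<Prod>i\<in>J. 1 - X i c) > 0"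
    "c \<in> {1..k} \<Longrightarrow> \<bar>bp k J X c - 1 / k\<bar> \<le> 16 * (A + B2) / k" for c
    by (rule bp_bulk[OF fin(1) k _ _ _ AB]; (rule Y A B2)?; assumption)+
  have k0: "real k > 0" using k by simp
  have "bp k J X c \<le> 1 / (3 * real k / 4)" if c: "c \<in> {1..k}" for c
  proof -
    have "16 * (A + B2) / k \<le> (1/3) / k" using AB48 k0 by (intro divide_right_mono) auto
    then have "bp k J X c \<le> 1 / k + (1/3) / k" using bulkJ(2)[OF c] by linarith
    also have "\<dots> = 1 / (3 * real k / 4)" using k0 by (simp add: field_simps)
    finally show ?thesis .
  qed
  moreover have "3 * real k / 4 - real (card Ex) \<ge> real k / 2"
    using E by (simp add: Ex_def d_def)
  moreover have "3 * real k / 4 - real (card Ex) \<ge> 1" using E k by (simp add: Ex_def d_def)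
  ultimately have "\<bar>bp k (J \<union> Ex) X c - 1 / k\<bar> \<le> 16 * (A + B2) / k + 4 / k * (\<Sum>i\<in>Ex. dev k (X i))"
    using fin k x bulkJ c by (intro bp_union_perturb[where r = "3 * real k / 4"]) auto
  also have "\<dots> \<le> 16 * (\<theta> + u + (n * e\<^sup>2 + s0 * u)) / k + 4 / k * u"
    using uE k0 by (intro add_mono divide_right_mono mult_left_mono) (auto simp: A_def B2_def d_def)
  also have "\<dots> = (16 * (\<theta> + u + (n * e\<^sup>2 + s0 * u)) + 4 * u) / k"
    by (simp add: add_divide_distrib)
  finally show ?thesis using fin(4) by (simp add: n_def)
qed

section \<open>The recursion for the tails\<close>

text \<open>Every largeness requirement is an explicit inequality here, so the recursion itself
  involves no limits. The exponent \<open>15/16\<close> in \<open>k_lower\<close> absorbs the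
  logarithm in \<open>n / ln n\<close>.\<close>

locale large_degree =
  fixes n k :: nat and g :: real
  assumes g: "0 < g" "g \<le> 1 / 8" and n: "n \<ge> 2"
    and k_lower: "real n powr (15/16) \<le> real k" and k_upper: "real k \<le> (real n)\<^sup>2"
    and large1: "96 \<le> real n powr (4 * g)"
    and large2: "2 * real n * exp (- (real n powr g / 3)) \<le> 1"
    and large3: "3 / g \<le> real n powr g"
    and large4: "6 \<le> real n powr (g / 2)"
    and large5: "6 * real n \<le> exp (real n powr g)"
    and large6: "4 * real n ^ 3 * exp (- (real n powr (1/2))) \<le> exp (- (real n powr (2 * g)))"
    and large7: "64 * (1 + 2 * real n powr (1/2)) \<le> real n powr (9/16)"
    and large8: "64 \<le> real n powr (1/16)"
begin

abbreviation "D \<equiv> real n"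

text \<open>The entry scale of the recursion: even without any cancellation, \<open>n\<close>
  deviations of this size add up to only \<open>D powr (- 4 * g)\<close>.\<close>

definition "s0 = D powr (- 1 - 4 * g)"
definition "L = D powr g"

lemma D: "D > 1" "D \<noteq> 0" "D > 0" "D \<ge> 1"
  using n by auto

lemma powr_absorb:
  assumes "c \<le> 64" "a + 1/16 \<le> b"
  shows "c * D powr a \<le> D powr b"
proof -
  have "c * D powr a \<le> D powr (1/16) * D powr a"
    using assms large8 by (intro mult_right_mono) auto
  also have "\<dots> \<le> D powr b" unfolding powr_add[symmetric] using assms D by (intro powr_mono) auto
  finally show ?thesis .
qed

lemma k_ge: "a + 1/16 \<le> 15/16 \<Longrightarrow> 64 * D powr a \<le> real k"
  using powr_absorb[of 64 a "15/16"] k_lower by simp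

lemma k4: "k \<ge> 4"
  using k_ge[of 0] D by simp

lemma s0: "0 < s0" "D * s0 \<le> 1 / 96" "s0 \<le> 1 / 4" "48 * (D * s0 + D * s0\<^sup>2) \<le> 1" "1 / D\<^sup>2 \<le> s0"
proof -
  show pos: "0 < s0" using D by (simp add: s0_def)
  have "D * s0 = D powr 1 * D powr (- 1 - 4 * g)" using D by (simp add: s0_def)
  also have "\<dots> = D powr (- (4 * g))" unfolding powr_add[symmetric] by simp
  also have "\<dots> = 1 / D powr (4 * g)" by (simp add: powr_minus_divide)
  also have "\<dots> \<le> 1 / 96" using large1 D by (intro divide_left_mono) auto
  finally show le: "D * s0 \<le> 1 / 96" .
  have "s0 \<le> D * s0" using D pos mult_right_mono[of 1 D s0] by simp
  with le show s4: "s0 \<le> 1 / 4" by simp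
  have "D * s0\<^sup>2 = D * s0 * s0" by (simp add: power2_eq_square)
  also have "\<dots> \<le> D * s0 * 1" using D pos s4 by (intro mult_left_mono) auto
  finally show "48 * (D * s0 + D * s0\<^sup>2) \<le> 1" using le by simp
  have "1 / D\<^sup>2 = D powr (- 2)" using D by (simp add: powr_minus_divide powr_numeral)
  also have "\<dots> \<le> s0" unfolding s0_def using D g by (intro powr_mono) auto
  finally show "1 / D\<^sup>2 \<le> s0" .
qed

lemma L: "L > 0" "L \<ge> 3 / g" "L \<ge> 2" "2 * D * exp (- (L / 3)) \<le> 1" "6 * D \<le> exp L"
proof -
  show "L > 0" using D by (simp add: L_def)
  show 1: "L \<ge> 3 / g" using large3 by (simp add: L_def)
  have "3 / g \<ge> 3 / (1/8)" using g by (intro divide_left_mono) auto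
  with 1 show "L \<ge> 2" by simp
qed (use large2 large5 in \<open>simp_all add: L_def\<close>)

end

section \<open>One level of the tail recursion\<close>

text \<open>\<open>A\<close> stands for the colorings of a child's subtree and \<open>X\<close> for
  the belief they induce. The children are sampled independently, as an element of
  \<open>{..<n} \<rightarrow>\<^sub>E A\<close>; the dependence present in the tree is paid for by
  the factor \<open>D\<close> in \<open>step_tail\<close>.\<close>

locale belief_step = large_degree n k g
  for n k :: nat and g :: real +
  fixes A :: "'a set" and X :: "'a \<Rightarrow> nat \<Rightarrow> real" and e :: real
  assumes A: "finite A" "A \<noteq> {}"
    and vec: "\<And>x. x \<in> A \<Longrightarrow> prob_vec k (X x)"
    and mean: "\<And>c. c \<in> {1..k} \<Longrightarrow> avg A (\<lambda>x. X x c) = 1 / k"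
    and e: "0 < e" "e \<le> s0"
    and tail: "\<And>s. s \<ge> e \<Longrightarrow> freq A (\<lambda>x. dev k (X x) > s) \<le> exp (- (L * (s / e) powr g))"
begin

text \<open>On this scale the stretched exponential tail is an ordinary exponential tail of rate
  \<open>L\<close>, so \<open>W\<close> has exponential moments although \<open>dev\<close> need not
  have useful ones.\<close>

definition "W x = (dev k (X x) / e) powr g"

lemma dev0: "0 \<le> dev k (X x)"
  using dev_nonneg[of k] k4 by simp

lemma W_gt_iff:
  assumes "w > 0"
  shows "W x > (w / e) powr g \<longleftrightarrow> dev k (X x) > w"
proof
  assume "dev k (X x) > w"
  then show "W x > (w / e) powr g"
    unfolding W_def using assms e g by (intro powr_less_mono2) (auto simp: divide_strict_right_mono)
next
  assume *: "W x > (w / e) powr g"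
  show "dev k (X x) > w"
  proof (rule ccontr)
    assume "\<not> dev k (X x) > w"
    then have "W x \<le> (w / e) powr g"
      unfolding W_def using assms e g dev0[of x] by (intro powr_mono2) (auto simp: divide_right_mono)
    with * show False by simp
  qed
qed

lemma W_gt_1_iff: "W x > 1 \<longleftrightarrow> dev k (X x) > e"
  using W_gt_iff[OF e(1), of x] e by simp

lemma avg_exp_W: "avg A (\<lambda>x. if W x > 1 then exp (L / 3 * W x) else 0) \<le> 2 * exp (- (L / 3))"
proof (rule avg_exp_tail[OF A L(3)])
  fix w :: real assume w: "w \<ge> 1"
  define s where "s = e * w powr (1 / g)"
  have w1: "1 \<le> w powr (1 / g)" using w g by (intro ge_one_powr_ge_zero) auto
  then have "s \<ge> e" using e mult_left_mono[OF w1, of e] by (simp add: s_def)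
  then have s: "s \<ge> e" "s > 0" using e by linarith+
  have sw: "(s / e) powr g = w" using e w g by (simp add: s_def powr_powr)
  have "freq A (\<lambda>x. W x > w) = freq A (\<lambda>x. dev k (X x) > s)"
    using W_gt_iff[OF s(2)] by (simp add: sw)
  also have "\<dots> \<le> exp (- (L * w))" using tail[OF s(1)] by (simp add: sw)
  finally show "freq A (\<lambda>x. W x > w) \<le> exp (- (L * w))" .
qed

text \<open>At rate \<open>L / 3\<close> the exponential moment of a single child exceeds 1 by at
  most \<open>2 * exp (- (L / 3))\<close>. By \<open>large2\<close> this excess is below
  \<open>1 / n\<close>, so all children together cost only a factor \<open>exp 1\<close>.\<close>

lemma freq_exceptional:
  "freq ({..<n} \<rightarrow>\<^sub>E A) (\<lambda>f. w \<le> (\<Sum>i<n. if W (f i) > 1 then W (f i) else 0)) \<le> 3 * exp (- (L / 3 * w))"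
proof -
  have fin: "finite ({..<n} \<rightarrow>\<^sub>E A)" using A by (simp add: finite_PiE)
  define h where "h x = (if W x > 1 then L / 3 * W x else 0)" for x
  have "freq ({..<n} \<rightarrow>\<^sub>E A) (\<lambda>f. w \<le> (\<Sum>i<n. if W (f i) > 1 then W (f i) else 0))
      \<le> freq ({..<n} \<rightarrow>\<^sub>E A) (\<lambda>f. L / 3 * w \<le> (\<Sum>i<n. h (f i)))"
  proof (intro freq_mono fin)
    fix f assume "w \<le> (\<Sum>i<n. if W (f i) > 1 then W (f i) else 0)"
    then have "L / 3 * w \<le> L / 3 * (\<Sum>i<n. if W (f i) > 1 then W (f i) else 0)"
      using L by (intro mult_left_mono) auto
    also have "\<dots> = (\<Sum>i<n. h (f i))"
      unfolding sum_distrib_left h_def by (intro sum.cong) auto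
    finally show "L / 3 * w \<le> (\<Sum>i<n. h (f i))" .
  qed
  also have "\<dots> \<le> exp (- (L / 3 * w)) * avg A (\<lambda>x. exp (h x)) ^ card {..<n}"
    by (rule freq_PiE_chernoff[OF A]) simp
  also have "avg A (\<lambda>x. exp (h x)) \<le> exp (2 * exp (- (L / 3)))"
  proof -
    have "avg A (\<lambda>x. exp (h x)) \<le> avg A (\<lambda>x. 1 + (if W x > 1 then exp (L / 3 * W x) else 0))"
      by (intro avg_mono) (auto simp: h_def)
    also have "\<dots> \<le> 1 + 2 * exp (- (L / 3))"
      using avg_exp_W by (simp add: avg_add avg_const A)
    also have "\<dots> \<le> exp (2 * exp (- (L / 3)))" by (rule exp_ge_add_one_self)
    finally show ?thesis .
  qed
  then have "avg A (\<lambda>x. exp (h x)) ^ card {..<n} \<le> exp (2 * exp (- (L / 3))) ^ n"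
    by (simp, intro power_mono) (auto simp: avg_def intro!: divide_nonneg_nonneg sum_nonneg)
  also have "\<dots> = exp (2 * D * exp (- (L / 3)))" by (simp add: exp_of_nat_mult[symmetric] algebra_simps)
  also have "\<dots> \<le> exp 1" using L(4) by simp
  also have "\<dots> \<le> 3" by (rule exp_le)
  finally show ?thesis by simp
qed

text \<open>Since the full mean is exactly \<open>1 / k\<close>, the mean of the truncated part is
  the negative of the mean of the discarded part. The latter is an exponential moment of
  \<open>W\<close>: the deviation equals \<open>e * W powr (1 / g)\<close>, and
  \<open>L \<ge> 3 / g\<close> bounds this by \<open>e * exp (L / 3 * W)\<close>. The sign
  \<open>\<sigma>\<close> serves both tails.\<close>

lemma avg_truncated:
  assumes c: "c \<in> {1..k}" and \<sigma>: "\<bar>\<sigma>\<bar> = 1"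
  shows "avg A (\<lambda>x. \<sigma> * (if dev k (X x) \<le> e then X x c - 1 / k else 0)) \<le> e * (2 * exp (- (L / 3)))"
proof -
  have "avg A (\<lambda>x. \<sigma> * (if dev k (X x) \<le> e then X x c - 1 / k else 0)) =
      avg A (\<lambda>x. \<sigma> * (X x c + - (1 / k)) + - \<sigma> * (if dev k (X x) > e then X x c - 1 / k else 0))"
    by (intro arg_cong[where f = "avg A"] ext) auto
  also have "\<dots> = avg A (\<lambda>x. - \<sigma> * (if dev k (X x) > e then X x c - 1 / k else 0))"
    by (subst avg_add, simp only: avg_cmult avg_add mean[OF c] avg_const[OF A]) simp
  also have "\<dots> \<le> avg A (\<lambda>x. e * (if W x > 1 then exp (L / 3 * W x) else 0))"
  proof (intro avg_mono)
    fix x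
    show "- \<sigma> * (if dev k (X x) > e then X x c - 1 / k else 0)
        \<le> e * (if W x > 1 then exp (L / 3 * W x) else 0)"
    proof (cases "dev k (X x) > e")
      case True
      then have W1: "W x > 1" by (simp add: W_gt_1_iff)
      have "- \<sigma> * (X x c - 1 / k) \<le> \<bar>- \<sigma> * (X x c - 1 / k)\<bar>" by (rule abs_ge_self)
      also have "\<dots> \<le> dev k (X x)" using dev_ge[OF c, of "X x"] \<sigma> by (simp add: abs_mult)
      also have "\<dots> = e * exp (1 / g * ln (W x))"
        using e g dev0[of x] True by (simp add: W_def ln_powr)
      also have "1 / g * ln (W x) \<le> L / 3 * W x"
        using L W1 g ln_le_minus_one[of "W x"] by (intro mult_mono) (auto simp: field_simps)
      then have "e * exp (1 / g * ln (W x)) \<le> e * exp (L / 3 * W x)" using e by simp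
      finally show ?thesis using True W1 by simp
    qed (auto simp: W_gt_1_iff)
  qed
  also have "\<dots> \<le> e * (2 * exp (- (L / 3)))"
    using avg_exp_W e by (simp add: avg_cmult)
  finally show ?thesis .
qed

lemma freq_bulk:
  fixes s :: real
  assumes s: "s \<ge> e * D powr (- (1/8))"
  shows "freq ({..<n} \<rightarrow>\<^sub>E A) (\<lambda>f. \<exists>c\<in>{1..k}. s * k / 64 \<le>
      \<bar>\<Sum>i<n. if dev k (X (f i)) \<le> e then X (f i) c - 1 / k else 0\<bar>) \<le> 2 * k * exp (- (D powr (1/2)))"
proof -
  have fin: "finite ({..<n} \<rightarrow>\<^sub>E A)" using A by (simp add: finite_PiE)
  define Z where "Z \<sigma> c x = \<sigma> * (if dev k (X x) \<le> e then X x c - 1 / k else 0)" for \<sigma> c x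
  \<comment> \<open>With this rate the variance term is
    \<open>D * (t * e)\<^sup>2 = D powr (1/2)\<close>, while \<open>t * \<theta>\<close> is at least
    \<open>D powr (9/16) / 64\<close>, since 15/16 - 1/8 - 1/4 = 9/16. \<open>large7\<close> says
    that the latter wins.\<close>
  define t where "t = D powr (- (1/4)) / e"
  define \<theta> where "\<theta> = s * k / 64"
  have t: "t > 0" "t * e = D powr (- (1/4))" using e D by (auto simp: t_def)
  have D1: "D powr (- (1/4)) \<le> 1" using D powr_mono[of "-(1/4)" 0 D] by simp
  have one: "freq ({..<n} \<rightarrow>\<^sub>E A) (\<lambda>f. \<theta> \<le> (\<Sum>i<n. Z \<sigma> c (f i))) \<le> exp (- (D powr (1/2)))"
    if \<sigma>: "\<bar>\<sigma>\<bar> = 1" and c: "c \<in> {1..k}" for \<sigma> c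
  proof -
    have Zb: "\<bar>Z \<sigma> c x\<bar> \<le> e" for x
      using dev_ge[OF c, of "X x"] \<sigma> e by (auto simp: Z_def abs_mult)
    have "freq ({..<n} \<rightarrow>\<^sub>E A) (\<lambda>f. \<theta> \<le> (\<Sum>i<n. Z \<sigma> c (f i)))
        \<le> exp (- t * \<theta> + real (card {..<n}) * (t * (e * (2 * exp (- (L / 3)))) + t\<^sup>2 * e\<^sup>2))"
    proof (intro freq_PiE_bernstein[OF A, where b = e])
      show "avg A (Z \<sigma> c) \<le> e * (2 * exp (- (L / 3)))"
        using avg_truncated[OF c \<sigma>] by (simp add: Z_def[abs_def])
      have "avg A (\<lambda>x. (Z \<sigma> c x)\<^sup>2) \<le> avg A (\<lambda>x. e\<^sup>2)"
        using Zb e by (intro avg_mono) (metis abs_le_square_iff abs_of_pos)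
      then show "avg A (\<lambda>x. (Z \<sigma> c x)\<^sup>2) \<le> e\<^sup>2" by (simp add: avg_const A)
    qed (use t D1 Zb in \<open>auto simp: abs_le_iff\<close>)
    also have "\<dots> = exp (- t * \<theta> + (t * e) * (2 * D * exp (- (L / 3))) + D * (t * e)\<^sup>2)"
      by (simp add: algebra_simps power_mult_distrib)
    also have "\<dots> \<le> exp (- (D powr (9/16) / 64) + 1 + D powr (1/2))"
    proof -
      have "D powr (9/16) = D powr (- (1/4)) * D powr (- (1/8)) * D powr (15/16)"
        unfolding powr_add[symmetric] by simp
      also have "\<dots> \<le> D powr (- (1/4)) * D powr (- (1/8)) * k"
        using k_lower by (intro mult_left_mono) auto
      also have "\<dots> = D powr (- (1/4)) * (e * D powr (- (1/8)) * k) / e" using e by simp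
      also have "\<dots> \<le> D powr (- (1/4)) * (s * k) / e"
        using s e by (intro divide_right_mono mult_left_mono mult_right_mono) auto
      finally have 1: "D powr (9/16) / 64 \<le> t * \<theta>" by (simp add: t_def \<theta>_def)
      have 2: "(t * e) * (2 * D * exp (- (L / 3))) \<le> 1 * 1"
        using L(4) t D1 D by (intro mult_mono) auto
      have "D * (t * e)\<^sup>2 = D powr 1 * (D powr (- (1/4)) * D powr (- (1/4)))"
        using D by (simp add: t power2_eq_square)
      also have "\<dots> = D powr (1/2)" unfolding powr_add[symmetric] by simp
      finally have 3: "D * (t * e)\<^sup>2 = D powr (1/2)" .
      show ?thesis using 1 2 unfolding 3 by simp
    qed
    also have "\<dots> \<le> exp (- (D powr (1/2)))" using large7 by simp
    finally show ?thesis .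
  qed
  have "freq ({..<n} \<rightarrow>\<^sub>E A) (\<lambda>f. \<exists>c\<in>{1..k}. \<theta> \<le>
      \<bar>\<Sum>i<n. if dev k (X (f i)) \<le> e then X (f i) c - 1 / k else 0\<bar>)
    \<le> freq ({..<n} \<rightarrow>\<^sub>E A) (\<lambda>f. \<exists>c\<in>{1..k}. \<theta> \<le> (\<Sum>i<n. Z 1 c (f i)) \<or> \<theta> \<le> (\<Sum>i<n. Z (- 1) c (f i)))"
    by (intro freq_mono fin) (fastforce simp: Z_def sum_negf abs_if split: if_splits)
  also have "\<dots> \<le> (\<Sum>c\<in>{1..k}. freq ({..<n} \<rightarrow>\<^sub>E A) (\<lambda>f. \<theta> \<le> (\<Sum>i<n. Z 1 c (f i)) \<or> \<theta> \<le> (\<Sum>i<n. Z (- 1) c (f i))))"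
    by (rule freq_bex_le[OF fin]) simp
  also have "\<dots> \<le> (\<Sum>c\<in>{1..k}. exp (- (D powr (1/2))) + exp (- (D powr (1/2))))"
    by (intro sum_mono order_trans[OF freq_disj_le[OF fin]] add_mono one) auto
  also have "\<dots> = 2 * k * exp (- (D powr (1/2)))" by simp
  finally show ?thesis by (simp add: \<theta>_def)
qed

text \<open>The deterministic half of the step: outside the two bad events, for the weights of the
  exceptional children and for the sum over the bulk, no further randomness is used.\<close>

lemma step_dev_le:
  fixes s :: real
  assumes s: "s \<ge> e * D powr (- (1/8))" "s \<le> 1" and f: "f \<in> {..<n} \<rightarrow>\<^sub>E A"
    and w: "(\<Sum>i<n. if W (f i) > 1 then W (f i) else 0) < (s * k / 64 / e) powr g"
    and bulk: "\<And>c. c \<in> {1..k} \<Longrightarrow>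
      \<bar>\<Sum>i<n. if dev k (X (f i)) \<le> e then X (f i) c - 1 / k else 0\<bar> \<le> s * k / 64"
  shows "dev k (bp k {..<n} (\<lambda>i. X (f i))) \<le> s"
proof -
  \<comment> \<open>The 64 is the total budget in \<open>bp_deviation\<close> with
    \<open>\<theta> = u\<close>: the terms linear in \<open>\<theta>\<close> and \<open>u\<close>
    take 36, the term \<open>16 * D * e\<^sup>2\<close> is granted 24, and
    \<open>16 * s0 * u\<close> takes 4.\<close>
  define u where "u = s * k / 64"
  have k0: "real k > 0" using k4 by simp
  have spos: "s > 0"
  proof -
    have "0 < e * D powr (- (1/8))" using e D by simp
    then show ?thesis using s(1) by (rule less_le_trans)
  qed
  then have u: "u > 0" using k0 by (simp add: u_def)
  define S where "S = {i \<in> {..<n}. dev k (X (f i)) > e}"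
  have finS: "finite S" by (simp add: S_def)
  have W0: "0 \<le> W x" for x by (simp add: W_def)
  have WS: "(\<Sum>i\<in>S. W (f i)) < (u / e) powr g"
  proof -
    have "(\<Sum>i\<in>S. W (f i)) = (\<Sum>i<n. if W (f i) > 1 then W (f i) else 0)"
      unfolding S_def by (subst sum.inter_filter) (auto simp: W_gt_1_iff)
    then show ?thesis using w by (simp add: u_def)
  qed
  have sumS: "(\<Sum>i\<in>S. dev k (X (f i))) \<le> u"
  proof (rule sum_le_of_sum_powr_le[OF finS, of _ g])
    have "(\<Sum>i\<in>S. W (f i)) = (\<Sum>i\<in>S. dev k (X (f i)) powr g) / e powr g"
      using e dev0 by (simp add: W_def powr_divide sum_divide_distrib)
    then have "(\<Sum>i\<in>S. dev k (X (f i)) powr g) / e powr g \<le> u powr g / e powr g"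
      using WS u e by (simp add: powr_divide)
    then show "(\<Sum>i\<in>S. dev k (X (f i)) powr g) \<le> u powr g"
      using e by (simp add: divide_le_cancel)
  qed (use dev0 g u in auto)
  define Ex where "Ex = {i \<in> {..<n}. dev k (X (f i)) > s0}"
  \<comment> \<open>Each child beyond \<open>s0\<close> uses at least \<open>(s0 / e) powr g\<close>
    of the weight budget. This allows fewer than \<open>(u / s0) powr g\<close> of them, at most
    \<open>D powr (4 * g)\<close> and thus well below \<open>k / 4\<close>.\<close>
  have "real (card Ex) * (s0 / e) powr g \<le> (\<Sum>i\<in>Ex. W (f i))"
  proof (rule sum_bounded_below)
    fix i assume "i \<in> Ex"
    then show "(s0 / e) powr g \<le> W (f i)"
      using W_gt_iff[OF s0(1), of "f i"] by (auto simp: Ex_def)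
  qed
  also have "\<dots> \<le> (\<Sum>i\<in>S. W (f i))"
    using e W0 by (intro sum_mono2) (auto simp: S_def Ex_def)
  also note WS
  finally have "real (card Ex) * (s0 / e) powr g < (u / e) powr g" .
  then have "real (card Ex) < (u / e) powr g / (s0 / e) powr g"
    using s0(1) e by (simp add: pos_less_divide_eq)
  also have "\<dots> = (u / s0) powr g"
    using u e s0(1) by (simp add: powr_divide)
  also have "\<dots> \<le> (D powr 4) powr g"
  proof (intro powr_mono2)
    have "s * k \<le> 1 * D\<^sup>2" using s k_upper k0 spos by (intro mult_mono) auto
    moreover have "u \<le> s * k" using spos k0 by (simp add: u_def)
    ultimately have "u \<le> D\<^sup>2" by linarith
    then have "u / s0 \<le> D\<^sup>2 / (1 / D\<^sup>2)" using u s0 D by (intro frac_le) auto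
    also have "\<dots> = D powr 4" using D by (simp add: powr_numeral power2_eq_square power4_eq_xxxx)
    finally show "u / s0 \<le> D powr 4" .
  qed (use u s0 g in auto)
  also have "\<dots> = D powr (4 * g)" by (simp only: powr_powr)
  also have "\<dots> \<le> D powr (1/2)" by (rule powr_mono) (use D(4) g(2) in simp_all)
  also have "\<dots> \<le> real k / 4"
  proof -
    have "64 * D powr (1/2) \<le> real k" by (rule k_ge) simp
    moreover have "0 \<le> D powr (1/2)" by simp
    ultimately show ?thesis by linarith
  qed
  finally have cEx: "real (card Ex) \<le> real k / 4" by simp
  have "\<bar>bp k {..<n} (\<lambda>i. X (f i)) c - 1 / k\<bar> \<le> s" if c: "c \<in> {1..k}" for c
  proof -
    have "\<bar>bp k {..<n} (\<lambda>i. X (f i)) c - 1 / k\<bar> \<le>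
        (16 * (u + u + (card {..<n} * e\<^sup>2 + s0 * u)) + 4 * u) / k"
    proof (rule bp_deviation)
      fix i assume "i \<in> {..<n}"
      then show "prob_vec k (X (f i))" using f by (intro vec) auto
    next
      show "(\<Sum>i | i \<in> {..<n} \<and> e < dev k (X (f i)). dev k (X (f i))) \<le> u"
        using sumS by (simp only: S_def)
      show "real (card {i \<in> {..<n}. s0 < dev k (X (f i))}) \<le> real k / 4"
        using cEx by (simp only: Ex_def)
      show "48 * (real (card {..<n}) * s0 + real (card {..<n}) * s0\<^sup>2) \<le> 1"
        using s0(4) by simp
    qed (use k4 e s0(3) u in simp_all, use bulk c in \<open>simp_all add: u_def\<close>)
    also have "\<dots> \<le> (64 * u) / k"
    proof (intro divide_right_mono)
      have "s0 * u \<le> 1 / 4 * u" using s0 u by (intro mult_right_mono) auto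
      moreover have "16 * (D * e\<^sup>2) \<le> 24 * u"
      proof -
        have "D * e \<le> D * s0" using e D by (intro mult_left_mono) auto
        then have "D * e \<le> 1" using s0 by simp
        then have "D * e * e \<le> 1 * e" using e by (intro mult_right_mono) auto
        then have "D * e\<^sup>2 \<le> e" by (simp add: power2_eq_square)
        also have "e = e * D powr (- (1/8)) * D powr (1/8)"
          using D by (simp add: powr_minus)
        also have "\<dots> \<le> s * D powr (1/8)" using s by (intro mult_right_mono) auto
        also have "64 * (s * D powr (1/8)) \<le> s * k" using k_ge[of "1/8"] spos by simp
        finally have "64 * (D * e\<^sup>2) \<le> 64 * u" by (simp add: u_def)
        then show ?thesis using u by linarith
      qed
      ultimately show "16 * (u + u + (card {..<n} * e\<^sup>2 + s0 * u)) + 4 * u \<le> 64 * u" by simp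
    qed (use k0 in auto)
    also have "\<dots> = s" using k0 by (simp add: u_def)
    finally show ?thesis .
  qed
  then show ?thesis using k4 by (subst dev_le_iff) auto
qed

text \<open>In the product space the children may block every color; \<open>bp\<close> is then 0,
  which still lies in the unit interval.\<close>

lemma dev_bp_le_1:
  assumes "f \<in> {..<n} \<rightarrow>\<^sub>E A"
  shows "dev k (bp k {..<n} (\<lambda>i. X (f i))) \<le> 1"
proof -
  have "\<bar>bp k {..<n} (\<lambda>i. X (f i)) c - 1 / k\<bar> \<le> 1" if c: "c \<in> {1..k}" for c
  proof -
    have nn: "0 \<le> (\<Prod>i<n. 1 - X (f i) c)" if "c \<in> {1..k}" for c
    proof (intro prod_nonneg ballI)
      fix i assume "i \<in> {..<n}"
      then have "prob_vec k (X (f i))" using assms by (intro vec) auto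
      from prob_vec_le_1[OF this that] show "0 \<le> 1 - X (f i) c" by simp
    qed
    have "(\<Prod>i<n. 1 - X (f i) c) \<le> (\<Sum>c\<in>{1..k}. \<Prod>i<n. 1 - X (f i) c)"
      using nn c member_le_sum[of c "{1..k}" "\<lambda>c. \<Prod>i<n. 1 - X (f i) c"] by simp
    moreover have "0 \<le> (\<Prod>i<n. 1 - X (f i) c)" by (rule nn[OF c])
    ultimately have "0 \<le> bp k {..<n} (\<lambda>i. X (f i)) c" "bp k {..<n} (\<lambda>i. X (f i)) c \<le> 1"
      unfolding bp_def by (auto intro: divide_nonneg_nonneg order_trans simp: divide_le_eq_1 less_le)
    moreover have "0 \<le> 1 / real k" "1 / real k \<le> 1" using k4 by auto
    ultimately show ?thesis by linarith
  qed
  then show ?thesis using k4 by (subst dev_le_iff) auto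
qed

text \<open>The factor \<open>D\<close> on the left is the density that a real level of the tree
  charges, so it must be absorbed within this step. Above \<open>s = 1\<close> there is nothing to
  prove, and below it each of the two bad events receives half of the target.\<close>

lemma step_tail:
  fixes s :: real
  assumes s: "s \<ge> e * D powr (- (1/8))"
  shows "D * freq ({..<n} \<rightarrow>\<^sub>E A) (\<lambda>f. dev k (bp k {..<n} (\<lambda>i. X (f i))) > s)
    \<le> exp (- (L * (s / (e * D powr (- (1/8)))) powr g))"
proof (cases "s \<le> 1")
  case False
  then have "freq ({..<n} \<rightarrow>\<^sub>E A) (\<lambda>f. dev k (bp k {..<n} (\<lambda>i. X (f i))) > s) = 0"
    using dev_bp_le_1 by (intro freq_eq_0) force
  then show ?thesis by simp
next
  case True
  have fin: "finite ({..<n} \<rightarrow>\<^sub>E A)" using A by (simp add: finite_PiE)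
  define e' where "e' = e * D powr (- (1/8))"
  define R where "R = L * (s / e') powr g"
  define u where "u = s * k / 64"
  have e': "0 < e'" "e' \<le> s" using e D s by (auto simp: e'_def)
  have k0: "real k > 0" using k4 by simp
  have "1 \<le> (s / e') powr g" using e' g by (intro ge_one_powr_ge_zero) auto
  then have RL: "R \<ge> L" using L mult_left_mono[of 1 "(s / e') powr g" L] by (simp add: R_def)
  define Ev1 where "Ev1 f \<longleftrightarrow> (u / e) powr g \<le> (\<Sum>i<n. if W (f i) > 1 then W (f i) else 0)" for f
  define Ev2 where "Ev2 f \<longleftrightarrow> (\<exists>c\<in>{1..k}. u < \<bar>\<Sum>i<n. if dev k (X (f i)) \<le> e then X (f i) c - 1 / k else 0\<bar>)" for f
  have "freq ({..<n} \<rightarrow>\<^sub>E A) Ev1 \<le> 3 * exp (- (L / 3 * (u / e) powr g))"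
    unfolding Ev1_def by (rule freq_exceptional)
  \<comment> \<open>\<open>u / e\<close> exceeds \<open>s / e'\<close> by a factor of at least
    \<open>D powr (1/2)\<close>, whose \<open>g\<close>-th power is at least 6. The doubled exponent
    leaves a spare \<open>exp (- R)\<close> to pay for \<open>6 * D\<close>.\<close>
  also have "L / 3 * (u / e) powr g \<ge> 2 * R"
  proof -
    have "D powr (1/2) \<le> D powr (- (1/8)) * k / 64"
    proof -
      have "64 * (D powr (1/2) * D powr (1/8)) \<le> k"
        using k_ge[of "1/2 + 1/8"] unfolding powr_add by simp
      then show ?thesis using D by (simp add: powr_minus field_simps)
    qed
    then have "(s / e') * D powr (1/2) \<le> (s / e') * (D powr (- (1/8)) * k / 64)"
      using e' by (intro mult_left_mono) auto
    also have "\<dots> = u / e" using e D by (simp add: u_def e'_def)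
    finally have "((s / e') * D powr (1/2)) powr g \<le> (u / e) powr g"
      using e' g by (intro powr_mono2) auto
    moreover have "((s / e') * D powr (1/2)) powr g = (s / e') powr g * D powr (g / 2)"
      unfolding powr_mult powr_powr by (simp only: mult.commute mult_1 times_divide_eq_right mult_1_right)
    moreover have "(s / e') powr g * 6 \<le> (s / e') powr g * D powr (g / 2)"
      using large4 by (intro mult_left_mono) auto
    ultimately have "(s / e') powr g * 6 \<le> (u / e) powr g"
      by (metis order_trans)
    then have "L / 3 * ((s / e') powr g * 6) \<le> L / 3 * (u / e) powr g"
      using L by (intro mult_left_mono) auto
    then show ?thesis by (simp add: R_def)
  qed
  then have "3 * exp (- (L / 3 * (u / e) powr g)) \<le> 3 * exp (- (2 * R))" by simp
  finally have "D * freq ({..<n} \<rightarrow>\<^sub>E A) Ev1 \<le> D * (3 * exp (- (2 * R)))"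
    using D by (intro mult_left_mono) auto
  also have "\<dots> = 6 * D * exp (- R) * (exp (- R) / 2)" by (simp add: exp_add[symmetric])
  also have "\<dots> \<le> exp L * exp (- R) * (exp (- R) / 2)"
    using L(5) by (intro mult_right_mono) auto
  also have "\<dots> = exp (L - R) * (exp (- R) / 2)" by (simp add: exp_add[symmetric])
  also have "\<dots> \<le> 1 * (exp (- R) / 2)" using RL by (intro mult_right_mono) auto
  finally have p1: "D * freq ({..<n} \<rightarrow>\<^sub>E A) Ev1 \<le> exp (- R) / 2" by simp
  have p2: "D * freq ({..<n} \<rightarrow>\<^sub>E A) Ev2 \<le> exp (- R) / 2"
  \<comment> \<open>The bound of \<open>freq_bulk\<close> does not improve as \<open>s\<close>
    grows, so it beats the target only while \<open>s / e' \<le> D\<close>. For larger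
    \<open>s\<close> the event is impossible: \<open>n\<close> terms of size at most
    \<open>e\<close> cannot exceed \<open>D * e\<close>.\<close>
  proof (cases "u \<ge> D * e")
    case True
    have "\<not> Ev2 f" for f
    proof -
      have "\<bar>\<Sum>i<n. if dev k (X (f i)) \<le> e then X (f i) c - 1 / k else 0\<bar> \<le> u" if c: "c \<in> {1..k}" for c
      proof -
        have "\<bar>if dev k (X (f i)) \<le> e then X (f i) c - 1 / k else 0\<bar> \<le> e" for i
          using dev_ge[OF c, of "X (f i)"] e by auto
        then have "\<bar>\<Sum>i<n. if dev k (X (f i)) \<le> e then X (f i) c - 1 / k else 0\<bar> \<le> real (card {..<n}) * e"
          by (intro order_trans[OF sum_abs] sum_bounded_above)
        then show ?thesis using True by simp
      qed
      then show ?thesis unfolding Ev2_def by (auto simp: not_less)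
    qed
    then have "freq ({..<n} \<rightarrow>\<^sub>E A) Ev2 = 0" by (intro freq_eq_0)
    then show ?thesis by simp
  next
    case False
    have "s / e' \<le> D"
    proof -
      have "s * k < 64 * D * e" using False by (simp add: u_def)
      also have "\<dots> = 64 * D powr (1 + 1/8) * e'"
        unfolding powr_add using D by (simp add: e'_def powr_minus)
      also have "\<dots> \<le> (D powr 1 * D powr (15/16)) * e'"
        unfolding powr_add[symmetric] using e' by (intro mult_right_mono powr_absorb) auto
      also have "\<dots> \<le> (D * k) * e'"
        using k_lower D e' by (intro mult_right_mono mult_mono) auto
      finally have "s * k < (D * e') * k" by (simp add: algebra_simps)
      then have "s < D * e'" using k0 by simp
      then show ?thesis using e' by (simp add: pos_divide_le_eq)
    qed
    then have "(s / e') powr g \<le> D powr g" using e' g by (intro powr_mono2) auto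
    then have "R \<le> D powr g * D powr g"
      using L by (simp add: R_def L_def mult_left_mono)
    then have R2: "R \<le> D powr (2 * g)" by (simp add: powr_add[symmetric])
    have "freq ({..<n} \<rightarrow>\<^sub>E A) Ev2 \<le> 2 * k * exp (- (D powr (1/2)))"
      unfolding Ev2_def u_def
      by (intro order_trans[OF freq_mono[OF fin] freq_bulk[OF s]]) (auto intro: less_imp_le)
    also have "\<dots> \<le> 2 * D\<^sup>2 * exp (- (D powr (1/2)))" using k_upper by (intro mult_right_mono) auto
    finally have "D * freq ({..<n} \<rightarrow>\<^sub>E A) Ev2 \<le> D * (2 * D\<^sup>2 * exp (- (D powr (1/2))))"
      using D by (intro mult_left_mono) auto
    also have "\<dots> = 4 * D ^ 3 * exp (- (D powr (1/2))) / 2" by (simp add: power2_eq_square power3_eq_cube)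
    also have "\<dots> \<le> exp (- (D powr (2 * g))) / 2" using large6 by simp
    also have "\<dots> \<le> exp (- R) / 2" using R2 by simp
    finally show ?thesis .
  qed
  have "freq ({..<n} \<rightarrow>\<^sub>E A) (\<lambda>f. dev k (bp k {..<n} (\<lambda>i. X (f i))) > s)
      \<le> freq ({..<n} \<rightarrow>\<^sub>E A) (\<lambda>f. Ev1 f \<or> Ev2 f)"
  proof (intro freq_mono fin)
    fix f assume f: "f \<in> {..<n} \<rightarrow>\<^sub>E A" and gt: "dev k (bp k {..<n} (\<lambda>i. X (f i))) > s"
    show "Ev1 f \<or> Ev2 f"
    proof (rule ccontr)
      assume "\<not> (Ev1 f \<or> Ev2 f)"
      then have "dev k (bp k {..<n} (\<lambda>i. X (f i))) \<le> s"
        using s True f by (intro step_dev_le) (auto simp: Ev1_def Ev2_def u_def not_le not_less)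
      with gt show False by simp
    qed
  qed
  also have "\<dots> \<le> freq ({..<n} \<rightarrow>\<^sub>E A) Ev1 + freq ({..<n} \<rightarrow>\<^sub>E A) Ev2"
    by (rule freq_disj_le[OF fin])
  finally have "D * freq ({..<n} \<rightarrow>\<^sub>E A) (\<lambda>f. dev k (bp k {..<n} (\<lambda>i. X (f i))) > s)
      \<le> D * (freq ({..<n} \<rightarrow>\<^sub>E A) Ev1 + freq ({..<n} \<rightarrow>\<^sub>E A) Ev2)"
    using D by (intro mult_left_mono) auto
  then show ?thesis using p1 p2 unfolding distrib_left R_def e'_def by linarith
qed

end

section \<open>The two levels above the leaves\<close>

lemma sum_PiE_Suc:
  fixes h :: "(nat \<Rightarrow> 'a) \<Rightarrow> real"
  shows "(\<Sum>f\<in>{..<Suc n} \<rightarrow>\<^sub>E A. h f) = (\<Sum>f\<in>{..<n} \<rightarrow>\<^sub>E A. \<Sum>x\<in>A. h (f(n := x)))"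
proof -
  have "(\<Sum>f\<in>{..<Suc n} \<rightarrow>\<^sub>E A. h f) = (\<Sum>f\<in>(\<lambda>(y, f). f(n := y)) ` (A \<times> ({..<n} \<rightarrow>\<^sub>E A)). h f)"
    by (simp add: lessThan_Suc PiE_insert_eq)
  also have "\<dots> = (\<Sum>(y, f)\<in>A \<times> ({..<n} \<rightarrow>\<^sub>E A). h (f(n := y)))"
    using inj_combinator[of n "{..<n}" "\<lambda>_. A"] by (subst sum.reindex) (auto simp: o_def case_prod_unfold)
  also have "\<dots> = (\<Sum>y\<in>A. \<Sum>f\<in>{..<n} \<rightarrow>\<^sub>E A. h (f(n := y)))"
    by (simp add: sum.cartesian_product)
  finally show ?thesis by (subst (asm) sum.swap)
qed

section \<open>Occupancy: the colors missed by independent samples\<close>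

lemma avg_fibres:
  fixes \<kappa> :: "'a \<Rightarrow> nat"
  assumes A: "finite A" and col: "\<And>x. x \<in> A \<Longrightarrow> \<kappa> x \<in> {1..k}"
    and unif: "\<And>c. c \<in> {1..k} \<Longrightarrow> freq A (\<lambda>x. \<kappa> x = c) = 1 / k"
  shows "avg A (\<lambda>x. h (\<kappa> x)) = (\<Sum>c\<in>{1..k}. h c) / k"
proof -
  have "avg A (\<lambda>x. h (\<kappa> x)) = avg A (\<lambda>x. \<Sum>c\<in>{1..k}. h c * of_bool (\<kappa> x = c))"
  proof -
    have "h (\<kappa> x) = (\<Sum>c\<in>{1..k}. h c * of_bool (\<kappa> x = c))" if "x \<in> A" for x
    proof -
      have "(\<Sum>c\<in>{1..k}. h c * of_bool (\<kappa> x = c)) = (\<Sum>c\<in>{1..k}. if \<kappa> x = c then h c else 0)"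
        by (intro sum.cong) auto
      also have "\<dots> = (if \<kappa> x \<in> {1..k} then h (\<kappa> x) else 0)" by (rule sum.delta') simp
      finally show ?thesis using col[OF that] by simp
    qed
    then show ?thesis unfolding avg_def by (intro arg_cong2[where f = "(/)"] sum.cong refl)
  qed
  also have "\<dots> = (\<Sum>c\<in>{1..k}. h c * freq A (\<lambda>x. \<kappa> x = c))"
    by (simp only: avg_sum avg_cmult freq_eq_avg[OF A])
  also have "\<dots> = (\<Sum>c\<in>{1..k}. h c * (1 / k))"
    by (intro sum.cong refl arg_cong2[where f = "(*)"] unif)
  finally show ?thesis by (simp add: sum_divide_distrib)
qed

text \<open>Throwing in one more ball turns \<open>z ^ m\<close>, with \<open>m\<close> the number of empty bins, into
  \<open>z ^ m (1 + m (1 / z - 1) / k)\<close> on average, and by Bernoulli's inequality this is at most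
  \<open>z' ^ m\<close> where \<open>1 - z' = (1 - z) (1 - 1 / k)\<close>.\<close>
lemma avg_power_card_missing:
  fixes \<kappa> :: "'a \<Rightarrow> nat"
  assumes A: "finite A" "A \<noteq> {}" and col: "\<And>x. x \<in> A \<Longrightarrow> \<kappa> x \<in> {1..k}"
    and unif: "\<And>c. c \<in> {1..k} \<Longrightarrow> freq A (\<lambda>x. \<kappa> x = c) = 1 / k"
    and z: "0 < z" "z \<le> (1::real)"
  shows "avg ({..<n} \<rightarrow>\<^sub>E A) (\<lambda>f. z ^ card ({1..k} - \<kappa> ` f ` {..<n})) \<le> (1 - (1 - z) * (1 - 1 / k) ^ n) ^ k"
  using z
proof (induction n arbitrary: z)
  case 0
  then show ?case by (simp add: avg_def)
next
  case (Suc n)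
  have k: "k > 0" using A col by fastforce
  define z' where "z' = z + (1 - z) / k"
  have "(1 - z) * (1 / real k) \<le> (1 - z) * 1" using Suc.prems k by (intro mult_left_mono) auto
  then have z': "0 < z'" "z' \<le> 1" "1 - z' = (1 - z) * (1 - 1 / k)"
    using Suc.prems by (auto simp: z'_def algebra_simps add_pos_nonneg)
  define M where "M f = {1..k} - \<kappa> ` f ` {..<n}" for f
  have cardA: "real (card ({..<Suc n} \<rightarrow>\<^sub>E A)) = real (card ({..<n} \<rightarrow>\<^sub>E A)) * real (card A)"
    by (simp add: card_PiE)
  have "avg ({..<Suc n} \<rightarrow>\<^sub>E A) (\<lambda>f. z ^ card ({1..k} - \<kappa> ` f ` {..<Suc n}))
      = avg ({..<n} \<rightarrow>\<^sub>E A) (\<lambda>f. avg A (\<lambda>x. z ^ card (M f - {\<kappa> x})))"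
  proof -
    have "{1..k} - \<kappa> ` (f(n := x)) ` {..<Suc n} = M f - {\<kappa> x}" if "f \<in> {..<n} \<rightarrow>\<^sub>E A" for f x
      by (auto simp: M_def lessThan_Suc)
    then have "(\<Sum>f\<in>{..<Suc n} \<rightarrow>\<^sub>E A. z ^ card ({1..k} - \<kappa> ` f ` {..<Suc n})) =
        (\<Sum>f\<in>{..<n} \<rightarrow>\<^sub>E A. \<Sum>x\<in>A. z ^ card (M f - {\<kappa> x}))"
      unfolding sum_PiE_Suc by (intro sum.cong refl) simp
    then show ?thesis by (simp add: avg_def cardA sum_divide_distrib mult.commute)
  qed
  also have "\<dots> \<le> avg ({..<n} \<rightarrow>\<^sub>E A) (\<lambda>f. z' ^ card (M f))"
  proof (intro avg_mono)
    fix f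
    define m where "m = card (M f)"
    have fin: "finite (M f)" "M f \<subseteq> {1..k}" by (auto simp: M_def)
    have mk: "m \<le> k" using card_mono[OF _ fin(2)] by (simp add: m_def)
    have "avg A (\<lambda>x. z ^ card (M f - {\<kappa> x})) = (\<Sum>c\<in>{1..k}. z ^ card (M f - {c})) / k"
      by (rule avg_fibres[OF A(1) col unif])
    also have "(\<Sum>c\<in>{1..k}. z ^ card (M f - {c})) = (\<Sum>c\<in>{1..k}. if c \<in> M f then z ^ (m - 1) else z ^ m)"
      using fin by (intro sum.cong refl) (auto simp: m_def)
    also have "\<dots> = (\<Sum>c\<in>{1..k} \<inter> M f. z ^ (m - 1)) + (\<Sum>c\<in>{1..k} \<inter> - M f. z ^ m)"
      by (simp add: sum.If_cases)
    also have "{1..k} \<inter> M f = M f" using fin by auto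
    also have "{1..k} \<inter> - M f = {1..k} - M f" by auto
    also have "(\<Sum>c\<in>M f. z ^ (m - 1)) + (\<Sum>c\<in>{1..k} - M f. z ^ m) =
        real m * z ^ (m - 1) + (real k - real m) * z ^ m"
      using fin mk by (simp add: m_def[symmetric] card_Diff_subset of_nat_diff)
    \<comment> \<open>For \<open>m = 0\<close> the exponent \<open>m - 1\<close> is truncated to 0,
      but its coefficient \<open>m\<close> vanishes.\<close>
    also have "\<dots> / k = z ^ m * (1 + m * ((1 / z - 1) / k))"
      using Suc.prems k by (cases m) (auto simp: field_simps)
    also have "\<dots> \<le> z ^ m * (1 + (1 / z - 1) / k) ^ m"
    proof (intro mult_left_mono Bernoulli_inequality)
      have "0 \<le> (1 / z - 1) / k" using Suc.prems by simp
      then show "- 1 \<le> (1 / z - 1) / k" by linarith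
    qed (use Suc.prems in auto)
    also have "\<dots> = (z * (1 + (1 / z - 1) / k)) ^ m" by (simp only: power_mult_distrib)
    also have "z * (1 + (1 / z - 1) / k) = z'"
      using Suc.prems by (simp add: z'_def distrib_left right_diff_distrib times_divide_eq_right)
    finally show "avg A (\<lambda>x. z ^ card (M f - {\<kappa> x})) \<le> z' ^ card (M f)" by (simp add: m_def)
  qed
  also have "\<dots> \<le> (1 - (1 - z') * (1 - 1 / k) ^ n) ^ k"
    unfolding M_def by (rule Suc.IH[OF z'(1,2)])
  finally show ?case by (simp add: z'(3) mult.assoc)
qed

text \<open>A lower-tail Chernoff bound at \<open>z = 1/2\<close>. Here \<open>m\<close> is a
  quarter of the expected number of missing colors, so the moment is at most
  \<open>exp (- 2 * m)\<close>; since 2 is below \<open>exp 1\<close>, Markov's inequality costs at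
  most \<open>exp m\<close>.\<close>

lemma freq_few_missing:
  fixes m :: real and k n :: nat and \<kappa> :: "'a \<Rightarrow> nat"
  assumes A: "finite A" "A \<noteq> {}" and col: "\<And>x. x \<in> A \<Longrightarrow> \<kappa> x \<in> {1..k}"
    and unif: "\<And>c. c \<in> {1..k} \<Longrightarrow> freq A (\<lambda>x. \<kappa> x = c) = 1 / k"
  defines "m \<equiv> real k * (1 - 1 / real k) ^ n / 4"
  shows "freq ({..<n} \<rightarrow>\<^sub>E A) (\<lambda>f. card ({1..k} - \<kappa> ` f ` {..<n}) \<le> m) \<le> exp (- m)"
proof -
  have fin: "finite ({..<n} \<rightarrow>\<^sub>E A)" using A by (simp add: finite_PiE)
  have k: "k > 0" using A col by fastforce
  have m: "m \<ge> 0" using k by (simp add: m_def)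
  have "freq ({..<n} \<rightarrow>\<^sub>E A) (\<lambda>f. card ({1..k} - \<kappa> ` f ` {..<n}) \<le> m)
      \<le> avg ({..<n} \<rightarrow>\<^sub>E A) (\<lambda>f. exp m * (1/2) ^ card ({1..k} - \<kappa> ` f ` {..<n}))"
    unfolding freq_eq_avg[OF fin]
  proof (intro avg_mono)
    fix f
    define c where "c = card ({1..k} - \<kappa> ` f ` {..<n})"
    show "of_bool (real c \<le> m) \<le> exp m * (1/2) ^ c"
    proof (cases "real c \<le> m")
      case True
      have "(2::real) ^ c \<le> exp 1 ^ c" by (intro power_mono) (use exp_ge_add_one_self[of 1] in auto)
      also have "\<dots> = exp (real c)" by (simp add: exp_of_nat_mult[symmetric])
      also have "\<dots> \<le> exp m" using True by simp
      finally show ?thesis using True by (simp add: power_one_over field_simps)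
    qed simp
  qed
  also have "\<dots> = exp m * avg ({..<n} \<rightarrow>\<^sub>E A) (\<lambda>f. (1/2) ^ card ({1..k} - \<kappa> ` f ` {..<n}))"
    by (rule avg_cmult)
  also have "\<dots> \<le> exp m * (1 - (1 - 1/2) * (1 - 1 / k) ^ n) ^ k"
    by (intro mult_left_mono avg_power_card_missing A col unif) auto
  also have "(1 - (1 - 1/2) * (1 - 1 / real k) ^ n) ^ k \<le> exp (- ((1 - 1 / k) ^ n / 2)) ^ k"
  proof (intro power_mono)
    show "1 - (1 - 1/2) * (1 - 1 / real k) ^ n \<le> exp (- ((1 - 1 / k) ^ n / 2))"
      using exp_ge_add_one_self[of "- ((1 - 1 / real k) ^ n / 2)"] by simp
    have "(1 - 1 / real k) ^ n \<le> 1" using k by (intro power_le_one) auto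
    then show "0 \<le> 1 - (1 - 1/2) * (1 - 1 / real k) ^ n" by simp
  qed
  then have "exp m * (1 - (1 - 1/2) * (1 - 1 / real k) ^ n) ^ k \<le> exp m * exp (- ((1 - 1 / k) ^ n / 2)) ^ k"
    by (intro mult_left_mono) auto
  also have "\<dots> = exp (m + k * (- ((1 - 1 / k) ^ n / 2)))"
    by (simp only: exp_of_nat_mult exp_add)
  also have "m + k * (- ((1 - 1 / k) ^ n / 2)) = - m" by (simp add: m_def)
  finally show ?thesis .
qed

text \<open>Leaves reveal their colors, so the parent's belief is uniform on the colors that its
  children miss. If none is missing, both sides are \<open>0 / 0 = 0\<close>.\<close>

lemma bp_point_masses:
  fixes n :: nat
  assumes "c \<in> {1..k}"
  shows "bp k {..<n} (\<lambda>i c. of_bool (\<kappa> (f i) = c)) c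
    = of_bool (c \<notin> \<kappa> ` f ` {..<n}) / card ({1..k} - \<kappa> ` f ` {..<n})"
proof -
  have *: "(\<Prod>i<n. 1 - of_bool (\<kappa> (f i) = c)) = (of_bool (c \<notin> \<kappa> ` f ` {..<n}) :: real)" for c
  proof (cases "c \<in> \<kappa> ` f ` {..<n}")
    case True
    then have "\<exists>i\<in>{..<n}. 1 - of_bool (\<kappa> (f i) = c) = (0 :: real)" by force
    then have "(\<Prod>i<n. 1 - of_bool (\<kappa> (f i) = c)) = (0 :: real)" by (intro prod_zero) auto
    then show ?thesis using True by simp
  next
    case False
    then have "(\<Prod>i<n. 1 - of_bool (\<kappa> (f i) = c)) = (\<Prod>i<n. 1 :: real)"
      by (intro prod.cong) auto
    then show ?thesis using False by simp
  qed
  have "(\<Sum>c\<in>{1..k}. of_bool (c \<notin> \<kappa> ` f ` {..<n}) :: real) = card ({1..k} - \<kappa> ` f ` {..<n})"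
    by (simp add: of_bool_def sum.If_cases Diff_eq Compl_eq)
  then show ?thesis unfolding bp_def * by simp
qed

section \<open>At most \<open>n\<^sup>2\<close> colors: the beliefs at levels one and two\<close>

text \<open>The exponents form a chain: \<open>D powr (- 32 * g)\<close> bounds the beliefs at level
  one, \<open>D powr (16 * g)\<close> is the Bernstein rate at level two,
  \<open>D powr (- 8 * g)\<close> bounds the resulting sums over children, and \<open>4 * g\<close>
  occurs in both the scale and the failure exponent handed on. \<open>few\<close> starts the chain
  through the expected number of missing colors; \<open>density\<close> is the price per level of
  treating children as independent.\<close>

locale moderate_degree = large_degree n k g for n k :: nat and g :: real +
  assumes k_log: "D / ln D \<le> real k"
    and mod1: "D\<^sup>2 * exp (- (D powr (32 * g) / 2)) \<le> 1"
    and mod2: "D powr (2 + 16 * g) * exp (- (D powr (32 * g))) \<le> 1"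
    and mod3: "D powr (- 32 * g) * (2 * ln D + 1) \<le> D powr (- 8 * g)"
    and mod4: "D powr (- 8 * g) \<le> 1 / 16"
    and mod5: "32 * D powr (- 8 * g) * ln D / D \<le> D powr (- 1 - 4 * g)"
    and mod6: "D * (3 * exp (- (D powr (32 * g) / 2)) + 2 * D\<^sup>2 * exp (- (D powr (8 * g)) + 1 + 2 * ln D))
      \<le> exp (- (D powr (4 * g)))"
    and mod7: "ln D / D \<le> D powr (- 32 * g)"
    and few: "D powr (32 * g) \<le> real k * (1 - 1 / real k) ^ n / 4"
    and density: "(real k / (real k - 1)) ^ n \<le> D"
begin

lemma level_one:
  assumes A: "finite A" "A \<noteq> {}" and col: "\<And>x. x \<in> A \<Longrightarrow> \<kappa> x \<in> {1..k}"
    and unif: "\<And>c. c \<in> {1..k} \<Longrightarrow> freq A (\<lambda>x. \<kappa> x = c) = 1 / k"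
  shows "freq ({..<n} \<rightarrow>\<^sub>E A)
      (\<lambda>f. \<exists>c\<in>{1..k}. bp k {..<n} (\<lambda>i c. of_bool (\<kappa> (f i) = c)) c > D powr (- 32 * g))
    \<le> exp (- (D powr (32 * g)))"
proof -
  have fin: "finite ({..<n} \<rightarrow>\<^sub>E A)" using A by (simp add: finite_PiE)
  define m where "m = real k * (1 - 1 / real k) ^ n / 4"
  have m: "D powr (32 * g) \<le> m" using few by (simp add: m_def)
  have "freq ({..<n} \<rightarrow>\<^sub>E A)
      (\<lambda>f. \<exists>c\<in>{1..k}. bp k {..<n} (\<lambda>i c. of_bool (\<kappa> (f i) = c)) c > D powr (- 32 * g))
    \<le> freq ({..<n} \<rightarrow>\<^sub>E A) (\<lambda>f. card ({1..k} - \<kappa> ` f ` {..<n}) \<le> m)"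
  proof (intro freq_mono fin, elim bexE, rule ccontr)
    fix f c assume c: "c \<in> {1..k}"
      and gt: "bp k {..<n} (\<lambda>i c. of_bool (\<kappa> (f i) = c)) c > D powr (- 32 * g)"
      and le: "\<not> real (card ({1..k} - \<kappa> ` f ` {..<n})) \<le> m"
    have pos: "0 < D powr (32 * g)" using D by simp
    have "bp k {..<n} (\<lambda>i c. of_bool (\<kappa> (f i) = c)) c \<le> 1 / card ({1..k} - \<kappa> ` f ` {..<n})"
      unfolding bp_point_masses[OF c] by (intro divide_right_mono) auto
    also have "\<dots> \<le> 1 / D powr (32 * g)"
      using le m pos by (intro divide_left_mono mult_pos_pos) linarith+
    also have "\<dots> = D powr (- 32 * g)" using powr_minus_divide[of D "32 * g"] by simp
    finally show False using gt by simp
  qed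
  also have "\<dots> \<le> exp (- m)"
    unfolding m_def by (rule freq_few_missing[OF A col unif])
  also have "\<dots> \<le> exp (- (D powr (32 * g)))" using m by simp
  finally show ?thesis .
qed

text \<open>When all beliefs are at most \<open>b\<close>, the second moment of a belief is at most
  \<open>b\<close> times its mean, so the variances of \<open>n\<close> children add up to order
  \<open>b * D / k\<close>, at most \<open>b * ln D\<close>. The logarithm in the number of colors
  is therefore harmless once \<open>b\<close> is a negative power of \<open>D\<close>.\<close>

lemma level_two:
  assumes A: "finite A" "A \<noteq> {}"
    and vec: "\<And>x. x \<in> A \<Longrightarrow> prob_vec k (X x)"
    and mean: "\<And>c. c \<in> {1..k} \<Longrightarrow> avg A (\<lambda>x. X x c) = 1 / k"
    and bad: "freq A (\<lambda>x. \<exists>c\<in>{1..k}. X x c > D powr (- 32 * g)) \<le> D * exp (- (D powr (32 * g)))"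
  shows "D * freq ({..<n} \<rightarrow>\<^sub>E A) (\<lambda>f. dev k (bp k {..<n} (\<lambda>i. X (f i))) > D powr (- 1 - 4 * g))
    \<le> exp (- (D powr (4 * g)))"
proof -
  have fin: "finite ({..<n} \<rightarrow>\<^sub>E A)" using A by (simp add: finite_PiE)
  have k0: "real k > 0" using k4 by simp
  define b where "b = D powr (- 32 * g)"
  define \<theta> where "\<theta> = D powr (- 8 * g)"
  define Bad where "Bad x \<longleftrightarrow> (\<exists>c\<in>{1..k}. X x c > b)" for x
  define T where "T = D * exp (- (D powr (32 * g)))"
  have T: "freq A Bad \<le> T" using bad by (simp add: Bad_def[abs_def] b_def T_def)
  have lnD: "ln D > 0" using D by simp
  have kln: "1 / k \<le> ln D / D"
    using k_log lnD D k0 by (simp add: field_simps)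
  then have kb: "1 / k \<le> b" using mod7 by (simp add: b_def)
  have Dk: "D / k \<le> ln D" using kln D by (simp add: field_simps)
  have b: "b > 0" "b \<le> 1 / 4"
  proof -
    show "b > 0" using D by (simp add: b_def)
    have "b \<le> D powr (- 8 * g)" unfolding b_def using D g by (intro powr_mono) auto
    then show "b \<le> 1 / 4" using mod4 by simp
  qed
  have th: "\<theta> > 0" "\<theta> \<le> 1 / 16" using mod4 D by (auto simp: \<theta>_def)
  have X01: "0 \<le> X x c" "X x c \<le> 1" if "x \<in> A" "c \<in> {1..k}" for x c
    using vec[OF that(1)] prob_vec_le_1[OF vec[OF that(1)] that(2)] that(2) by (auto simp: prob_vec_def)
  have Yb: "\<bar>X x c - 1 / k\<bar> \<le> b" if "x \<in> A" "c \<in> {1..k}" "\<not> Bad x" for x c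
  proof -
    have "X x c \<le> b" using that by (auto simp: Bad_def not_less)
    moreover have "0 \<le> 1 / real k" using k0 by simp
    ultimately show ?thesis using X01[OF that(1,2)] kb by linarith
  qed
  define t where "t = D powr (32 * g) / 2"
  \<comment> \<open>A single bad child already reaches the level \<open>t\<close>. Taking half of
    the exponent in \<open>bad\<close> for \<open>t\<close> keeps the total moment
    \<open>D * exp t * T\<close> at most 1.\<close>
  have p1: "freq ({..<n} \<rightarrow>\<^sub>E A) (\<lambda>f. t \<le> (\<Sum>i<n. t * of_bool (Bad (f i)))) \<le> 3 * exp (- t)"
  proof -
    have "freq ({..<n} \<rightarrow>\<^sub>E A) (\<lambda>f. t \<le> (\<Sum>i<n. t * of_bool (Bad (f i))))
        \<le> exp (- t) * avg A (\<lambda>x. exp (t * of_bool (Bad x))) ^ card {..<n}"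
      by (rule freq_PiE_chernoff[OF A]) simp
    also have "avg A (\<lambda>x. exp (t * of_bool (Bad x))) \<le> exp (exp t * T)"
    proof -
      have "avg A (\<lambda>x. exp (t * of_bool (Bad x))) \<le> avg A (\<lambda>x. 1 + exp t * of_bool (Bad x))"
        by (intro avg_mono) auto
      also have "\<dots> = 1 + exp t * freq A Bad"
        by (simp add: avg_add avg_cmult avg_const A freq_eq_avg)
      also have "\<dots> \<le> 1 + exp t * T" using T by (intro add_left_mono mult_left_mono) auto
      also have "\<dots> \<le> exp (exp t * T)" by (rule exp_ge_add_one_self)
      finally show ?thesis .
    qed
    then have "avg A (\<lambda>x. exp (t * of_bool (Bad x))) ^ card {..<n} \<le> exp (exp t * T) ^ n"
      by (simp, intro power_mono) (auto simp: avg_def intro!: divide_nonneg_nonneg sum_nonneg)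
    also have "\<dots> = exp (D * (exp t * T))" by (simp only: exp_of_nat_mult)
    also have "D * (exp t * T) = D\<^sup>2 * exp (- (D powr (32 * g) / 2))"
      by (simp add: T_def t_def power2_eq_square exp_add[symmetric])
    also have "exp \<dots> \<le> exp 1" using mod1 by simp
    also have "exp (1::real) \<le> 3" by (rule exp_le)
    finally show ?thesis by simp
  qed
  define Z where "Z \<sigma> c x = \<sigma> * (if Bad x then 0 else X x c - 1 / k)" for \<sigma> c x
  \<comment> \<open>Chosen so that \<open>lam\<^sup>2 * b = 1\<close>: the variance term is then
    \<open>2 * D / k\<close>, at most \<open>2 * ln D\<close>, while
    \<open>lam * \<theta> = D powr (8 * g)\<close> still dominates.\<close>
  define lam where "lam = D powr (16 * g)"
  have one: "freq ({..<n} \<rightarrow>\<^sub>E A) (\<lambda>f. \<theta> \<le> (\<Sum>i<n. Z \<sigma> c (f i))) \<le> exp (- (D powr (8 * g)) + 1 + 2 * ln D)"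
    if \<sigma>: "\<bar>\<sigma>\<bar> = 1" and c: "c \<in> {1..k}" for \<sigma> c
  proof -
    have Zb: "\<bar>Z \<sigma> c x\<bar> \<le> b" if "x \<in> A" for x
      using Yb[OF that c] \<sigma> b by (auto simp: Z_def abs_mult)
    have lamb: "lam * b = D powr (- 16 * g)" unfolding lam_def b_def powr_add[symmetric] by simp
    have "freq ({..<n} \<rightarrow>\<^sub>E A) (\<lambda>f. \<theta> \<le> (\<Sum>i<n. Z \<sigma> c (f i)))
        \<le> exp (- lam * \<theta> + real (card {..<n}) * (lam * T + lam\<^sup>2 * (b * (2 / k))))"
    proof (intro freq_PiE_bernstein[OF A, where b = b])
      have "D powr (- 16 * g) \<le> D powr 0" using D g by (intro powr_mono) auto
      then show "lam * b \<le> 1" unfolding lamb using D by simp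
      \<comment> \<open>Exact centring again turns the bias of the truncated belief into the
        contribution of the bad samples, where each deviation is at most 1.\<close>
      have "avg A (Z \<sigma> c) = avg A (\<lambda>x. \<sigma> * (X x c + - (1 / k)) + - \<sigma> * (if Bad x then X x c - 1 / k else 0))"
        by (intro arg_cong[where f = "avg A"] ext) (auto simp: Z_def)
      also have "\<dots> = avg A (\<lambda>x. - \<sigma> * (if Bad x then X x c - 1 / k else 0))"
        by (subst avg_add, simp only: avg_cmult avg_add mean[OF c] avg_const[OF A]) simp
      also have "\<dots> \<le> avg A (\<lambda>x. of_bool (Bad x))"
      proof (intro avg_mono)
        fix x assume x: "x \<in> A"
        have "- \<sigma> * (X x c - 1 / k) \<le> \<bar>- \<sigma> * (X x c - 1 / k)\<bar>" by (rule abs_ge_self)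
        also have "\<dots> \<le> dev k (X x)" using dev_ge[OF c, of "X x"] \<sigma> by (simp add: abs_mult)
        also have "\<dots> \<le> 1" using dev_le_1[OF _ vec[OF x]] k4 by simp
        finally show "- \<sigma> * (if Bad x then X x c - 1 / k else 0) \<le> of_bool (Bad x)" by simp
      qed
      also have "\<dots> \<le> T" using T by (simp add: freq_eq_avg A)
      finally show "avg A (Z \<sigma> c) \<le> T" .
      have "avg A (\<lambda>x. (Z \<sigma> c x)\<^sup>2) \<le> avg A (\<lambda>x. b * (X x c + 1 / k))"
      proof (intro avg_mono)
        fix x assume x: "x \<in> A"
        have "\<bar>Z \<sigma> c x\<bar> \<le> X x c + 1 / k"
          using X01[OF x c] \<sigma> k0 by (auto simp: Z_def abs_mult abs_le_iff)
        then have "\<bar>Z \<sigma> c x\<bar> * \<bar>Z \<sigma> c x\<bar> \<le> b * (X x c + 1 / k)"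
          using Zb[OF x] b by (intro mult_mono) auto
        then show "(Z \<sigma> c x)\<^sup>2 \<le> b * (X x c + 1 / k)" by (simp add: power2_eq_square abs_mult_self_eq)
      qed
      also have "\<dots> = b * (2 / k)" by (simp only: avg_cmult avg_add mean[OF c] avg_const[OF A]) simp
      finally show "avg A (\<lambda>x. (Z \<sigma> c x)\<^sup>2) \<le> b * (2 / k)" .
    qed (use Zb in \<open>auto simp: lam_def abs_le_iff\<close>)
    also have "\<dots> \<le> exp (- (D powr (8 * g)) + 1 + 2 * ln D)"
    proof -
      have 1: "lam * \<theta> = D powr (8 * g)" unfolding lam_def \<theta>_def powr_add[symmetric] by simp
      have "D * (lam * T) = D powr (1 + 1 + 16 * g) * exp (- (D powr (32 * g)))"
        unfolding powr_add lam_def T_def using D by simp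
      then have 2: "D * (lam * T) \<le> 1" using mod2 by simp
      have "lam\<^sup>2 * b = 1"
        unfolding lam_def b_def power2_eq_square powr_add[symmetric] using D by simp
      moreover have "D * (lam\<^sup>2 * (b * (2 / k))) = (lam\<^sup>2 * b) * (2 * (D / k))" by simp
      ultimately have "D * (lam\<^sup>2 * (b * (2 / k))) = 2 * (D / k)" by (simp only: mult_1)
      then have 3: "D * (lam\<^sup>2 * (b * (2 / k))) \<le> 2 * ln D" using Dk by linarith
      show ?thesis using 1 2 3 by (simp add: ring_distribs)
    qed
    finally show ?thesis .
  qed
  define Ev2 where "Ev2 f \<longleftrightarrow> (\<exists>c\<in>{1..k}. \<theta> \<le> (\<Sum>i<n. Z 1 c (f i)) \<or> \<theta> \<le> (\<Sum>i<n. Z (- 1) c (f i)))" for f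
  have p2: "freq ({..<n} \<rightarrow>\<^sub>E A) Ev2 \<le> 2 * k * exp (- (D powr (8 * g)) + 1 + 2 * ln D)"
  proof -
    have "freq ({..<n} \<rightarrow>\<^sub>E A) Ev2
        \<le> (\<Sum>c\<in>{1..k}. freq ({..<n} \<rightarrow>\<^sub>E A) (\<lambda>f. \<theta> \<le> (\<Sum>i<n. Z 1 c (f i)) \<or> \<theta> \<le> (\<Sum>i<n. Z (- 1) c (f i))))"
      unfolding Ev2_def by (rule freq_bex_le[OF fin]) simp
    also have "\<dots> \<le> (\<Sum>c\<in>{1..k}. exp (- (D powr (8 * g)) + 1 + 2 * ln D) + exp (- (D powr (8 * g)) + 1 + 2 * ln D))"
      by (intro sum_mono order_trans[OF freq_disj_le[OF fin]] add_mono one) auto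
    finally show ?thesis by simp
  qed
  have "freq ({..<n} \<rightarrow>\<^sub>E A) (\<lambda>f. dev k (bp k {..<n} (\<lambda>i. X (f i))) > D powr (- 1 - 4 * g))
     \<le> freq ({..<n} \<rightarrow>\<^sub>E A) (\<lambda>f. t \<le> (\<Sum>i<n. t * of_bool (Bad (f i))) \<or> Ev2 f)"
  proof (intro freq_mono fin, rule ccontr)
    fix f assume f: "f \<in> {..<n} \<rightarrow>\<^sub>E A" and gt: "dev k (bp k {..<n} (\<lambda>i. X (f i))) > D powr (- 1 - 4 * g)"
      and nE: "\<not> (t \<le> (\<Sum>i<n. t * of_bool (Bad (f i))) \<or> Ev2 f)"
    have t0: "t \<ge> 0" by (simp add: t_def)
    have good: "\<not> Bad (f i)" if i: "i < n" for i
    proof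
      assume "Bad (f i)"
      then have "t \<le> (\<Sum>i<n. t * of_bool (Bad (f i)))"
        using member_le_sum[of i "{..<n}" "\<lambda>i. t * of_bool (Bad (f i))"] i t0 by simp
      with nE show False by blast
    qed
    have fA: "f i \<in> A" if "i \<in> {..<n}" for i using f that by auto
    have S: "\<bar>\<Sum>i<n. (X (f i) c - 1 / k)\<bar> \<le> \<theta>" if c: "c \<in> {1..k}" for c
    proof -
      have "(\<Sum>i<n. Z \<sigma> c (f i)) = \<sigma> * (\<Sum>i<n. (X (f i) c - 1 / k))" for \<sigma>
        unfolding sum_distrib_left using good by (intro sum.cong) (auto simp: Z_def)
      note this[of 1] this[of "- 1"]
      moreover have "(\<Sum>i<n. Z 1 c (f i)) < \<theta>" "(\<Sum>i<n. Z (- 1) c (f i)) < \<theta>"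
        using nE c unfolding Ev2_def not_le[symmetric] by blast+
      ultimately show ?thesis by linarith
    qed
    \<comment> \<open>The squares need no concentration of their own: on good children a square is
      at most \<open>b\<close> times an expression linear in the belief, so \<open>S\<close>
      controls their sum.\<close>
    have Q: "(\<Sum>i<n. (X (f i) c - 1 / k)\<^sup>2) \<le> \<theta>" if c: "c \<in> {1..k}" for c
    proof -
      have "(\<Sum>i<n. (X (f i) c - 1 / k)\<^sup>2) \<le> (\<Sum>i<n. b * ((X (f i) c - 1 / k) + 2 / k))"
      proof (intro sum_mono)
        fix i assume i: "i \<in> {..<n}"
        have "\<bar>X (f i) c - 1 / k\<bar> \<le> (X (f i) c - 1 / k) + 2 / k"
          using X01[OF fA[OF i] c] k0 by (auto simp: abs_le_iff)
        then have "\<bar>X (f i) c - 1 / k\<bar> * \<bar>X (f i) c - 1 / k\<bar> \<le> b * ((X (f i) c - 1 / k) + 2 / k)"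
          using Yb[OF fA[OF i] c] good i b by (intro mult_mono) auto
        then show "(X (f i) c - 1 / k)\<^sup>2 \<le> b * ((X (f i) c - 1 / k) + 2 / k)"
          by (simp add: power2_eq_square abs_mult_self_eq)
      qed
      also have "\<dots> = b * ((\<Sum>i<n. (X (f i) c - 1 / k)) + 2 * (D / k))"
        unfolding sum_distrib_left[symmetric] sum.distrib by simp
      also have "\<dots> \<le> b * (1 + 2 * ln D)"
        using S[OF c] th Dk b by (intro mult_left_mono) (auto simp: abs_le_iff)
      also have "\<dots> \<le> \<theta>" using mod3 by (simp add: b_def \<theta>_def add.commute)
      finally show ?thesis .
    qed
    have "\<bar>bp k {..<n} (\<lambda>i. X (f i)) c - 1 / k\<bar> \<le> D powr (- 1 - 4 * g)" if c: "c \<in> {1..k}" for c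
    proof -
      have "\<bar>bp k {..<n} (\<lambda>i. X (f i)) c - 1 / k\<bar> \<le> 16 * (\<theta> + \<theta>) / k"
      proof (rule bp_bulk(2)[OF _ k4 _ S Q _ c])
        fix i c assume "i \<in> {..<n}" "c \<in> {1..k}"
        then show "\<bar>X (f i) c - 1 / k\<bar> \<le> 1 / 4" using Yb[of "f i" c] fA[of i] good[of i] b by auto
      qed (use th in auto)
      also have "\<dots> = 32 * \<theta> * (1 / k)" by simp
      also have "\<dots> \<le> 32 * \<theta> * (ln D / D)" using kln th by (intro mult_left_mono) auto
      also have "\<dots> \<le> D powr (- 1 - 4 * g)" using mod5 by (simp add: \<theta>_def)
      finally show ?thesis .
    qed
    then have "dev k (bp k {..<n} (\<lambda>i. X (f i))) \<le> D powr (- 1 - 4 * g)"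
      using k4 by (subst dev_le_iff) auto
    with gt show False by simp
  qed
  also have "\<dots> \<le> 3 * exp (- t) + 2 * k * exp (- (D powr (8 * g)) + 1 + 2 * ln D)"
    by (rule order_trans[OF freq_disj_le[OF fin] add_mono[OF p1 p2]])
  also have "\<dots> \<le> 3 * exp (- t) + 2 * D\<^sup>2 * exp (- (D powr (8 * g)) + 1 + 2 * ln D)"
    using k_upper by (intro add_left_mono mult_right_mono) auto
  finally have "D * freq ({..<n} \<rightarrow>\<^sub>E A) (\<lambda>f. dev k (bp k {..<n} (\<lambda>i. X (f i))) > D powr (- 1 - 4 * g))
     \<le> D * (3 * exp (- t) + 2 * D\<^sup>2 * exp (- (D powr (8 * g)) + 1 + 2 * ln D))"
    using D by (intro mult_left_mono) auto
  also have "\<dots> \<le> exp (- (D powr (4 * g)))" using mod6 by (simp add: t_def)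
  finally show ?thesis .
qed

end

section \<open>Colorings of trees\<close>

definition agree :: "nat \<Rightarrow> nat \<Rightarrow> (nat list \<Rightarrow> nat) \<Rightarrow> (nat list \<Rightarrow> nat) \<Rightarrow> bool" where
  "agree n l \<sigma> \<tau> \<longleftrightarrow> restrict \<sigma> (leaves n l) = restrict \<tau> (leaves n l)"

definition marg :: "nat \<Rightarrow> nat \<Rightarrow> nat \<Rightarrow> (nat list \<Rightarrow> nat) \<Rightarrow> nat \<Rightarrow> real" where
  "marg k n l \<tau> c = real (card {\<sigma> \<in> colorings k n l. \<sigma> [] = c \<and> agree n l \<sigma> \<tau>}) /
     real (card {\<sigma> \<in> colorings k n l. agree n l \<sigma> \<tau>})"

text \<open>Restricting both the index and the address makes the result an element of the
  extensional function space itself, so that \<open>graft\<close> inverts it exactly once the root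
  color is known.\<close>

definition subtree :: "nat \<Rightarrow> nat \<Rightarrow> (nat list \<Rightarrow> nat) \<Rightarrow> nat \<Rightarrow> nat list \<Rightarrow> nat" where
  "subtree n l \<sigma> = (\<lambda>i\<in>{..<n}. \<lambda>v\<in>tree_verts n l. \<sigma> (i # v))"

definition graft :: "nat \<Rightarrow> nat \<Rightarrow> nat \<Rightarrow> (nat \<Rightarrow> nat list \<Rightarrow> nat) \<Rightarrow> nat list \<Rightarrow> nat" where
  "graft n l a f = (\<lambda>v\<in>tree_verts n (Suc l). case v of [] \<Rightarrow> a | i # w \<Rightarrow> f i w)"

lemma agree_iff: "agree n l \<sigma> \<tau> \<longleftrightarrow> (\<forall>v\<in>leaves n l. \<sigma> v = \<tau> v)"
  unfolding agree_def by (auto simp: restrict_def fun_eq_iff)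

lemma Nil_in_tree_verts: "[] \<in> tree_verts n l"
  by (simp add: tree_verts_def)

lemma Cons_in_tree_verts: "i # v \<in> tree_verts n (Suc l) \<longleftrightarrow> i < n \<and> v \<in> tree_verts n l"
  by (auto simp: tree_verts_def)

lemma leaves_Suc: "v \<in> leaves n (Suc l) \<longleftrightarrow> (\<exists>i<n. \<exists>w\<in>leaves n l. v = i # w)"
  by (cases v) (auto simp: leaves_def Cons_in_tree_verts)

text \<open>Edges extend an address at its end, whereas the recursion strips its first index; on
  nonempty addresses the two operations commute.\<close>

lemma tree_edges_Suc:
  "(v, w) \<in> tree_edges n (Suc l) \<longleftrightarrow>
    (\<exists>i<n. v = [] \<and> w = [i]) \<or> (\<exists>i<n. \<exists>(v', w')\<in>tree_edges n l. v = i # v' \<and> w = i # w')"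
  (is "?L \<longleftrightarrow> ?R")
proof
  assume ?L
  then obtain j where j: "w = v @ [j]" "v \<in> tree_verts n (Suc l)" "v @ [j] \<in> tree_verts n (Suc l)"
    by (auto simp: tree_edges_def)
  show ?R
  proof (cases v)
    case Nil
    then show ?thesis using j by (auto simp: Cons_in_tree_verts)
  next
    case (Cons i v')
    then have "i < n" "(v', v' @ [j]) \<in> tree_edges n l"
      using j by (auto simp: Cons_in_tree_verts tree_edges_def)
    then show ?thesis using j Cons by auto
  qed
next
  assume ?R
  then consider (root) i where "i < n" "v = []" "w = [i]"
    | (sub) i v' w' where "i < n" "(v', w') \<in> tree_edges n l" "v = i # v'" "w = i # w'"
    by blast
  then show ?L
  proof cases
    case root
    have "[i] \<in> tree_verts n (Suc l)" using root by (simp add: Cons_in_tree_verts Nil_in_tree_verts)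
    then show ?thesis using root Nil_in_tree_verts[of n "Suc l"] by (auto simp: tree_edges_def)
  next
    case sub
    then obtain j where "w' = v' @ [j]" "v' \<in> tree_verts n l" "v' @ [j] \<in> tree_verts n l"
      by (auto simp: tree_edges_def)
    then have "w = v @ [j]" "v \<in> tree_verts n (Suc l)" "v @ [j] \<in> tree_verts n (Suc l)"
      using sub by (auto simp: Cons_in_tree_verts)
    then show ?thesis unfolding tree_edges_def by blast
  qed
qed

lemma colorings_root: "\<sigma> \<in> colorings k n l \<Longrightarrow> \<sigma> [] \<in> {1..k}"
  using Nil_in_tree_verts by (auto simp: colorings_def)

lemma subtree_root: "i < n \<Longrightarrow> subtree n l \<sigma> i [] = \<sigma> [i]"
  by (simp add: subtree_def Nil_in_tree_verts)

lemma subtree_coloring: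
  assumes \<sigma>: "\<sigma> \<in> colorings k n (Suc l)"
  shows "subtree n l \<sigma> \<in> {..<n} \<rightarrow>\<^sub>E colorings k n l"
    and "i < n \<Longrightarrow> subtree n l \<sigma> i [] \<noteq> \<sigma> []"
proof -
  have e: "\<sigma> v \<noteq> \<sigma> w" if "(v, w) \<in> tree_edges n (Suc l)" for v w
    using \<sigma> that by (auto simp: colorings_def)
  have r: "\<sigma> v \<in> {1..k}" if "v \<in> tree_verts n (Suc l)" for v
    using \<sigma> that by (auto simp: colorings_def)
  have "subtree n l \<sigma> i \<in> colorings k n l" if i: "i < n" for i
  proof -
    have "\<sigma> (i # v) \<noteq> \<sigma> (i # w)" if "(v, w) \<in> tree_edges n l" for v w
      using that i by (intro e) (auto simp: tree_edges_Suc)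
    then show ?thesis using i r[of "i # _"]
      by (auto simp: colorings_def subtree_def Cons_in_tree_verts tree_edges_def)
  qed
  then show "subtree n l \<sigma> \<in> {..<n} \<rightarrow>\<^sub>E colorings k n l" by (auto simp: subtree_def)
  show "subtree n l \<sigma> i [] \<noteq> \<sigma> []" if "i < n"
    using e[of "[]" "[i]"] that by (auto simp: subtree_root tree_edges_Suc)
qed

lemma graft_coloring:
  assumes a: "a \<in> {1..k}" and f: "f \<in> {..<n} \<rightarrow>\<^sub>E colorings k n l" and ne: "\<And>i. i < n \<Longrightarrow> f i [] \<noteq> a"
  shows "graft n l a f \<in> colorings k n (Suc l)" "graft n l a f [] = a" "subtree n l (graft n l a f) = f"
proof -
  have fi: "f i \<in> colorings k n l" if "i < n" for i using f that by auto
  have G: "graft n l a f (i # v) = f i v" if "i < n" "v \<in> tree_verts n l" for i v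
    using that by (simp add: graft_def Cons_in_tree_verts)
  show G0: "graft n l a f [] = a" by (simp add: graft_def Nil_in_tree_verts)
  show "graft n l a f \<in> colorings k n (Suc l)"
    unfolding colorings_def
  proof (intro CollectI conjI ballI)
    show "graft n l a f \<in> tree_verts n (Suc l) \<rightarrow>\<^sub>E {1..k}"
    proof (intro PiE_I)
      fix v assume v: "v \<in> tree_verts n (Suc l)"
      show "graft n l a f v \<in> {1..k}"
      proof (cases v)
        case Nil
        then show ?thesis using a G0 by simp
      next
        case (Cons i w)
        then have "i < n" "w \<in> tree_verts n l" using v by (auto simp: Cons_in_tree_verts)
        then show ?thesis using Cons G fi[of i] by (auto simp: colorings_def)
      qed
    qed (simp add: graft_def)
    fix p assume p: "p \<in> tree_edges n (Suc l)"
    obtain v w where vw: "p = (v, w)" by force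
    have "graft n l a f v \<noteq> graft n l a f w"
      using p unfolding vw tree_edges_Suc
    proof (elim disjE exE conjE bexE)
      fix i assume "i < n" "v = []" "w = [i]"
      then show ?thesis using G0 G[of i "[]"] ne[of i] by (auto simp: Nil_in_tree_verts)
    next
      fix i q assume i: "i < n" and q: "q \<in> tree_edges n l" "case q of (v', w') \<Rightarrow> v = i # v' \<and> w = i # w'"
      obtain v' w' where vw': "q = (v', w')" by force
      have "v' \<in> tree_verts n l" "w' \<in> tree_verts n l" "f i v' \<noteq> f i w'"
        using q(1) fi[OF i] unfolding vw' by (auto simp: tree_edges_def colorings_def)
      then show ?thesis using q(2) G i unfolding vw' by auto
    qed
    then show "case p of (v, w) \<Rightarrow> graft n l a f v \<noteq> graft n l a f w" by (simp add: vw)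
  qed
  show "subtree n l (graft n l a f) = f"
  proof
    fix i
    show "subtree n l (graft n l a f) i = f i"
    proof (cases "i < n")
      case True
      show ?thesis
      proof
        fix v
        show "subtree n l (graft n l a f) i v = f i v"
          using True G fi[OF True] by (cases "v \<in> tree_verts n l") (auto simp: subtree_def colorings_def)
      qed
    next
      case False
      then show ?thesis using PiE_arb[OF f, of i] by (simp add: subtree_def)
    qed
  qed
qed

lemma graft_subtree:
  assumes "\<sigma> \<in> colorings k n (Suc l)"
  shows "graft n l (\<sigma> []) (subtree n l \<sigma>) = \<sigma>"
proof
  fix v
  show "graft n l (\<sigma> []) (subtree n l \<sigma>) v = \<sigma> v"
  proof (cases "v \<in> tree_verts n (Suc l)")
    case True
    then show ?thesis
      by (cases v) (simp_all add: graft_def subtree_def Nil_in_tree_verts Cons_in_tree_verts)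
  next
    case False
    have "\<sigma> \<in> tree_verts n (Suc l) \<rightarrow>\<^sub>E {1..k}" using assms by (simp add: colorings_def)
    from PiE_arb[OF this False] False show ?thesis by (simp add: graft_def)
  qed
qed

section \<open>Counting colorings through their subtrees\<close>

text \<open>Once the root color is fixed, the only remaining constraint between subtrees and root is
  that each subtree's root avoids \<open>c\<close>. The predicate \<open>Q\<close> is kept arbitrary
  so that the same bijection serves total counts, prescribed leaves and general events.\<close>

lemma card_colorings_Suc:
  assumes c: "c \<in> {1..k}"
  shows "card {\<sigma> \<in> colorings k n (Suc l). \<sigma> [] = c \<and> Q (subtree n l \<sigma>)}
    = card {f \<in> {..<n} \<rightarrow>\<^sub>E {\<sigma> \<in> colorings k n l. \<sigma> [] \<noteq> c}. Q f}"
proof (rule bij_betw_same_card, rule bij_betw_byWitness[where f = "subtree n l" and f' = "graft n l c"])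
  let ?B = "{f \<in> {..<n} \<rightarrow>\<^sub>E {\<sigma> \<in> colorings k n l. \<sigma> [] \<noteq> c}. Q f}"
  have G: "graft n l c f \<in> colorings k n (Suc l)" "graft n l c f [] = c" "subtree n l (graft n l c f) = f" "Q f"
    if f: "f \<in> ?B" for f
  proof -
    have "f \<in> {..<n} \<rightarrow>\<^sub>E colorings k n l" "\<And>i. i < n \<Longrightarrow> f i [] \<noteq> c"
      using f by (auto simp: PiE_iff)
    from graft_coloring[OF c this]
    show "graft n l c f \<in> colorings k n (Suc l)" "graft n l c f [] = c" "subtree n l (graft n l c f) = f"
      by blast+
  qed (use f in simp)
  show "\<forall>\<sigma>\<in>{\<sigma> \<in> colorings k n (Suc l). \<sigma> [] = c \<and> Q (subtree n l \<sigma>)}. graft n l c (subtree n l \<sigma>) = \<sigma>"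
    using graft_subtree by blast
  show "\<forall>f\<in>?B. subtree n l (graft n l c f) = f"
    using G(3) by blast
  show "subtree n l ` {\<sigma> \<in> colorings k n (Suc l). \<sigma> [] = c \<and> Q (subtree n l \<sigma>)} \<subseteq> ?B"
  proof (rule image_subsetI)
    fix \<sigma> assume "\<sigma> \<in> {\<sigma> \<in> colorings k n (Suc l). \<sigma> [] = c \<and> Q (subtree n l \<sigma>)}"
    then have \<sigma>: "\<sigma> \<in> colorings k n (Suc l)" "\<sigma> [] = c" "Q (subtree n l \<sigma>)" by auto
    have "subtree n l \<sigma> \<in> {..<n} \<rightarrow>\<^sub>E {\<rho> \<in> colorings k n l. \<rho> [] \<noteq> c}"
      using subtree_coloring[OF \<sigma>(1)] \<sigma>(2) by (simp add: PiE_iff)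
    then show "subtree n l \<sigma> \<in> ?B" using \<sigma>(3) by simp
  qed
  show "graft n l c ` ?B \<subseteq> {\<sigma> \<in> colorings k n (Suc l). \<sigma> [] = c \<and> Q (subtree n l \<sigma>)}"
  proof (rule image_subsetI)
    fix f assume "f \<in> ?B"
    from G[OF this] show "graft n l c f \<in> {\<sigma> \<in> colorings k n (Suc l). \<sigma> [] = c \<and> Q (subtree n l \<sigma>)}"
      by simp
  qed
qed

lemma card_colorings_split:
  "card {\<sigma> \<in> colorings k n l. P \<sigma>} = (\<Sum>c\<in>{1..k}. card {\<sigma> \<in> colorings k n l. \<sigma> [] = c \<and> P \<sigma>})"
proof -
  have "{\<sigma> \<in> colorings k n l. P \<sigma>} = (\<Union>c\<in>{1..k}. {\<sigma> \<in> colorings k n l. \<sigma> [] = c \<and> P \<sigma>})"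
    using colorings_root[of _ k n l] by auto
  then show ?thesis
    using finite_colorings[of k n l] by (simp only:) (intro card_UN_disjoint; auto)
qed

lemma card_root_ne:
  "card {\<sigma> \<in> colorings k n l. \<sigma> [] \<noteq> c \<and> P \<sigma>} =
    card {\<sigma> \<in> colorings k n l. P \<sigma>} - card {\<sigma> \<in> colorings k n l. \<sigma> [] = c \<and> P \<sigma>}"
proof -
  have "{\<sigma> \<in> colorings k n l. \<sigma> [] \<noteq> c \<and> P \<sigma>} =
      {\<sigma> \<in> colorings k n l. P \<sigma>} - {\<sigma> \<in> colorings k n l. \<sigma> [] = c \<and> P \<sigma>}" by auto
  then show ?thesis
    using finite_colorings[of k n l] by (simp only:) (intro card_Diff_subset; auto)
qed

text \<open>Uniformity is obtained by counting instead of by permuting colors: if roots are uniform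
  at depth \<open>l\<close>, then excluding any one color removes the same fraction
  \<open>1 / k\<close> of the colorings of each subtree, so all root colors have equal counts at
  depth \<open>Suc l\<close>.\<close>

lemma freq_root:
  assumes k: "k \<ge> 2" and c: "c \<in> {1..k}"
  shows "freq (colorings k n l) (\<lambda>\<sigma>. \<sigma> [] = c) = 1 / k"
    and "real (card (colorings k n (Suc l))) = k * (card (colorings k n l) * (1 - 1 / k)) ^ n"
proof -
  have step: "real (card (colorings k n (Suc l))) = k * (card (colorings k n l) * (1 - 1 / k)) ^ n \<and>
      card {\<sigma> \<in> colorings k n (Suc l). \<sigma> [] = c} = (card (colorings k n l) * (1 - 1 / k)) ^ n"
    if IH: "\<And>c. c \<in> {1..k} \<Longrightarrow> freq (colorings k n l) (\<lambda>\<sigma>. \<sigma> [] = c) = 1 / k" and c: "c \<in> {1..k}" for l c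
  proof -
    define C where "C = real (card (colorings k n l))"
    have C: "C > 0" using colorings_nonempty[OF k] finite_colorings by (simp add: C_def card_gt_0_iff)
    have N: "real (card {\<sigma> \<in> colorings k n (Suc l). \<sigma> [] = c}) = (C * (1 - 1 / k)) ^ n" if c: "c \<in> {1..k}" for c
    proof -
      have "card {\<sigma> \<in> colorings k n l. \<sigma> [] = c} \<le> card (colorings k n l)"
        by (intro card_mono finite_colorings) auto
      then have "real (card {\<sigma> \<in> colorings k n l. \<sigma> [] \<noteq> c}) = C - card {\<sigma> \<in> colorings k n l. \<sigma> [] = c}"
        using card_root_ne[of k n l c "\<lambda>_. True"] by (simp add: of_nat_diff C_def)
      also have "real (card {\<sigma> \<in> colorings k n l. \<sigma> [] = c}) = C / k"
        using IH[OF c] C by (simp add: freq_def C_def[symmetric] field_simps)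
      finally have "real (card {\<sigma> \<in> colorings k n l. \<sigma> [] \<noteq> c}) = C * (1 - 1 / k)"
        by (simp add: right_diff_distrib)
      then show ?thesis
        using card_colorings_Suc[OF c, of n l "\<lambda>_. True"] by (simp add: card_PiE)
    qed
    have "real (card (colorings k n (Suc l))) = (\<Sum>c\<in>{1..k}. real (card {\<sigma> \<in> colorings k n (Suc l). \<sigma> [] = c}))"
      using card_colorings_split[of k n "Suc l" "\<lambda>_. True"] by simp
    also have "\<dots> = (\<Sum>c\<in>{1..k}. (C * (1 - 1 / k)) ^ n)" by (intro sum.cong refl N)
    finally show ?thesis using N[OF c] by (simp add: C_def)
  qed
  have *: "freq (colorings k n l) (\<lambda>\<sigma>. \<sigma> [] = c) = 1 / k" if "c \<in> {1..k}" for l c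
    using that
  proof (induction l arbitrary: c)
    case 0
    have tv: "tree_verts n 0 = {[]}" by (auto simp: tree_verts_def)
    have te: "tree_edges n 0 = {}" by (auto simp: tree_edges_def tree_verts_def)
    have "colorings k n 0 = (\<lambda>c. \<lambda>v\<in>{[]}. c) ` {1..k}"
      by (auto simp: colorings_def tv te PiE_iff image_iff extensional_def fun_eq_iff restrict_def)
    moreover have inj: "inj_on (\<lambda>c. \<lambda>v\<in>{[]::nat list}. c) S" for S :: "nat set"
      by (auto simp: inj_on_def fun_eq_iff restrict_def dest: spec[of _ "[]"])
    ultimately have "card (colorings k n 0) = k" by (simp add: card_image)
    moreover have "{\<sigma> \<in> colorings k n 0. \<sigma> [] = c} = {\<lambda>v\<in>{[]}. c}"
      using 0 by (auto simp: colorings_def tv te PiE_iff extensional_def fun_eq_iff restrict_def)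
    ultimately show ?case by (simp add: freq_def)
  next
    case (Suc l)
    define y where "y = (card (colorings k n l) * (1 - 1 / real k)) ^ n"
    have y: "y > 0"
      unfolding y_def using k colorings_nonempty[OF k] finite_colorings
      by (intro mult_pos_pos zero_less_power) (auto simp: card_gt_0_iff)
    have "freq (colorings k n (Suc l)) (\<lambda>\<sigma>. \<sigma> [] = c) = y / (k * y)"
      using step[OF Suc.IH Suc.prems] by (simp only: freq_def y_def)
    then show ?case using y by simp
  qed
  from *[OF c] show "freq (colorings k n l) (\<lambda>\<sigma>. \<sigma> [] = c) = 1 / k" .
  from step[OF * c] show "real (card (colorings k n (Suc l))) = k * (card (colorings k n l) * (1 - 1 / k)) ^ n"
    by blast
qed

text \<open>Given the root color \<open>c\<close> the subtrees are independent, uniform up to the constraint that their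
  root is not colored \<open>c\<close>; forgetting this constraint costs a factor \<open>k / (k - 1)\<close> per subtree.\<close>
lemma freq_subtree_le:
  assumes k: "k \<ge> 2"
  shows "freq (colorings k n (Suc l)) (\<lambda>\<sigma>. Q (subtree n l \<sigma>))
    \<le> (real k / (real k - 1)) ^ n * freq ({..<n} \<rightarrow>\<^sub>E colorings k n l) Q"
proof -
  define C where "C = real (card (colorings k n l))"
  define q where "q = card {f \<in> {..<n} \<rightarrow>\<^sub>E colorings k n l. Q f}"
  have C: "C > 0" using colorings_nonempty[OF k] finite_colorings by (simp add: C_def card_gt_0_iff)
  have c1: "1 \<in> {1..k}" using k by simp
  have "card {\<sigma> \<in> colorings k n (Suc l). Q (subtree n l \<sigma>)} \<le> (\<Sum>c\<in>{1..k}. q)"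
    unfolding card_colorings_split[of k n "Suc l" "\<lambda>\<sigma>. Q (subtree n l \<sigma>)"]
  proof (intro sum_mono)
    fix c assume "c \<in> {1..k}"
    then show "card {\<sigma> \<in> colorings k n (Suc l). \<sigma> [] = c \<and> Q (subtree n l \<sigma>)} \<le> q"
      unfolding card_colorings_Suc[OF \<open>c \<in> {1..k}\<close>] q_def
    proof (intro card_mono)
      show "finite {f \<in> {..<n} \<rightarrow>\<^sub>E colorings k n l. Q f}"
        by (simp add: finite_PiE finite_colorings)
    qed (auto simp: PiE_iff)
  qed
  then have "card {\<sigma> \<in> colorings k n (Suc l). Q (subtree n l \<sigma>)} \<le> k * q" by simp
  then have "real (card {\<sigma> \<in> colorings k n (Suc l). Q (subtree n l \<sigma>)}) \<le> k * q"
    by (simp only: of_nat_mult[symmetric] of_nat_le_iff)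
  then have "freq (colorings k n (Suc l)) (\<lambda>\<sigma>. Q (subtree n l \<sigma>)) \<le> k * q / (k * (C * (1 - 1 / k)) ^ n)"
    unfolding freq_def C_def freq_root(2)[OF k c1] using k by (intro divide_right_mono) auto
  also have "\<dots> = (1 / (1 - 1 / k)) ^ n * (q / C ^ n)"
    using k by (simp add: power_mult_distrib power_divide)
  also have "1 / (1 - 1 / real k) = real k / (real k - 1)" using k by (simp add: field_simps)
  also have "q / C ^ n = freq ({..<n} \<rightarrow>\<^sub>E colorings k n l) Q"
    by (simp add: freq_def q_def C_def card_PiE)
  finally show ?thesis .
qed

section \<open>Conditional root marginals and their recursion\<close>

lemma card_agree_pos:
  assumes "\<tau> \<in> colorings k n l"
  shows "card {\<sigma> \<in> colorings k n l. agree n l \<sigma> \<tau>} > 0"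
  using assms by (auto simp: card_gt_0_iff finite_colorings agree_iff)

lemma prob_vec_marg:
  assumes "\<tau> \<in> colorings k n l"
  shows "prob_vec k (marg k n l \<tau>)"
proof -
  have "(\<Sum>c\<in>{1..k}. marg k n l \<tau> c) = 1"
    using card_agree_pos[OF assms]
    unfolding marg_def sum_divide_distrib[symmetric] of_nat_sum[symmetric] card_colorings_split[symmetric]
    by simp
  then show ?thesis by (auto simp: prob_vec_def marg_def)
qed

text \<open>The tower property as a double count: \<open>agree\<close> is an equivalence relation
  and \<open>Z\<close> is constant on its classes. After swapping the sums, every coloring with root
  color \<open>c\<close> therefore contributes \<open>Z \<sigma> / Z \<sigma> = 1\<close>.\<close>

lemma avg_marg:
  assumes k: "k \<ge> 2" and c: "c \<in> {1..k}"
  shows "avg (colorings k n l) (\<lambda>\<tau>. marg k n l \<tau> c) = 1 / k"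
proof -
  let ?C = "colorings k n l"
  define Z where "Z \<tau> = real (card {\<sigma> \<in> ?C. agree n l \<sigma> \<tau>})" for \<tau>
  have fin: "finite ?C" by (rule finite_colorings)
  have card_sum: "real (card {\<sigma> \<in> ?C. P \<sigma>}) = (\<Sum>\<sigma>\<in>?C. of_bool (P \<sigma>))" for P
    using fin by (simp add: Collect_conj_eq Int_commute sum.If_cases of_bool_def)
  have Z: "Z \<tau> = (\<Sum>\<sigma>\<in>?C. of_bool (agree n l \<sigma> \<tau>))" for \<tau> by (simp add: Z_def card_sum)
  have "(\<Sum>\<tau>\<in>?C. marg k n l \<tau> c) =
      (\<Sum>\<tau>\<in>?C. \<Sum>\<sigma>\<in>?C. of_bool (\<sigma> [] = c) * (of_bool (agree n l \<tau> \<sigma>) / Z \<sigma>))"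
  proof (intro sum.cong refl)
    fix \<tau> assume "\<tau> \<in> ?C"
    have "marg k n l \<tau> c = (\<Sum>\<sigma>\<in>?C. of_bool (\<sigma> [] = c \<and> agree n l \<sigma> \<tau>) / Z \<tau>)"
      by (simp add: marg_def Z_def card_sum[of "\<lambda>\<sigma>. \<sigma> [] = c \<and> agree n l \<sigma> \<tau>"] sum_divide_distrib)
    also have "\<dots> = (\<Sum>\<sigma>\<in>?C. of_bool (\<sigma> [] = c) * (of_bool (agree n l \<tau> \<sigma>) / Z \<sigma>))"
    proof (intro sum.cong refl)
      fix \<sigma> assume "\<sigma> \<in> ?C"
      have "Z \<tau> = Z \<sigma>" if "agree n l \<sigma> \<tau>" using that by (simp add: Z_def agree_def)
      then show "of_bool (\<sigma> [] = c \<and> agree n l \<sigma> \<tau>) / Z \<tau> = of_bool (\<sigma> [] = c) * (of_bool (agree n l \<tau> \<sigma>) / Z \<sigma>)"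
        by (auto simp: agree_def)
    qed
    finally show "marg k n l \<tau> c = (\<Sum>\<sigma>\<in>?C. of_bool (\<sigma> [] = c) * (of_bool (agree n l \<tau> \<sigma>) / Z \<sigma>))" .
  qed
  also have "\<dots> = (\<Sum>\<sigma>\<in>?C. of_bool (\<sigma> [] = c) * (Z \<sigma> / Z \<sigma>))"
    by (subst sum.swap) (simp only: sum_distrib_left[symmetric] sum_divide_distrib[symmetric] Z[symmetric])
  also have "\<dots> = (\<Sum>\<sigma>\<in>?C. of_bool (\<sigma> [] = c))"
  proof (intro sum.cong refl)
    fix \<sigma> assume "\<sigma> \<in> ?C"
    then have "Z \<sigma> \<noteq> 0" using card_agree_pos[of \<sigma> k n l] unfolding Z_def by linarith
    then show "of_bool (\<sigma> [] = c) * (Z \<sigma> / Z \<sigma>) = (of_bool (\<sigma> [] = c) :: real)" by simp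
  qed
  finally have "avg ?C (\<lambda>\<tau>. marg k n l \<tau> c) = freq ?C (\<lambda>\<sigma>. \<sigma> [] = c)"
    by (simp only: avg_def freq_eq_avg[OF fin])
  then show ?thesis using freq_root(1)[OF k c] by simp
qed

lemma agree_Suc:
  "agree n (Suc l) \<sigma> \<tau> \<longleftrightarrow> (\<forall>i<n. agree n l (subtree n l \<sigma> i) (subtree n l \<tau> i))"
proof -
  have "leaves n l \<subseteq> tree_verts n l" by (auto simp: leaves_def)
  then have "agree n l (subtree n l \<sigma> i) (subtree n l \<tau> i) \<longleftrightarrow> (\<forall>v\<in>leaves n l. \<sigma> (i # v) = \<tau> (i # v))"
    if "i < n" for i
    using that by (auto simp: agree_iff subtree_def subset_iff)
  then show ?thesis by (auto simp: agree_iff[of n "Suc l"] leaves_Suc)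
qed

lemma Collect_PiE: "{f \<in> I \<rightarrow>\<^sub>E A. \<forall>i\<in>I. P i (f i)} = (\<Pi>\<^sub>E i\<in>I. {x \<in> A. P i x})"
  by (auto simp: PiE_iff extensional_def)

text \<open>With root color and leaves fixed, the subtrees are chosen independently. Subtree
  \<open>i\<close> has \<open>Z i * (1 - marg)\<close> admissible colorings, and the factors
  \<open>Z i\<close>, which do not depend on \<open>c\<close>, cancel in the normalization.\<close>

lemma marg_Suc:
  assumes \<tau>: "\<tau> \<in> colorings k n (Suc l)" and c: "c \<in> {1..k}"
  shows "marg k n (Suc l) \<tau> c = bp k {..<n} (\<lambda>i. marg k n l (subtree n l \<tau> i)) c"
proof -
  define Z where "Z i = real (card {\<sigma> \<in> colorings k n l. agree n l \<sigma> (subtree n l \<tau> i)})" for i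
  have sub: "subtree n l \<tau> i \<in> colorings k n l" if "i < n" for i
    using PiE_mem[OF subtree_coloring(1)[OF \<tau>], of i] that by simp
  have Z: "Z i > 0" if "i < n" for i using card_agree_pos[OF sub[OF that]] by (simp add: Z_def)
  have ZP: "(\<Prod>i<n. Z i) > 0" using Z by (intro prod_pos) auto
  have N: "real (card {\<sigma> \<in> colorings k n (Suc l). \<sigma> [] = c \<and> agree n (Suc l) \<sigma> \<tau>})
      = (\<Prod>i<n. Z i) * (\<Prod>i<n. 1 - marg k n l (subtree n l \<tau> i) c)" if c: "c \<in> {1..k}" for c
  proof -
    have "card {\<sigma> \<in> colorings k n (Suc l). \<sigma> [] = c \<and> agree n (Suc l) \<sigma> \<tau>}
        = card {f \<in> {..<n} \<rightarrow>\<^sub>E {\<sigma> \<in> colorings k n l. \<sigma> [] \<noteq> c}. \<forall>i<n. agree n l (f i) (subtree n l \<tau> i)}"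
      unfolding agree_Suc
      by (rule card_colorings_Suc[OF c, of n l "\<lambda>f. \<forall>i<n. agree n l (f i) (subtree n l \<tau> i)"])
    also have "{f \<in> {..<n} \<rightarrow>\<^sub>E {\<sigma> \<in> colorings k n l. \<sigma> [] \<noteq> c}. \<forall>i<n. agree n l (f i) (subtree n l \<tau> i)}
        = (\<Pi>\<^sub>E i\<in>{..<n}. {\<sigma> \<in> {\<sigma> \<in> colorings k n l. \<sigma> [] \<noteq> c}. agree n l \<sigma> (subtree n l \<tau> i)})"
      using Collect_PiE[of "{..<n}" "{\<sigma> \<in> colorings k n l. \<sigma> [] \<noteq> c}" "\<lambda>i \<sigma>. agree n l \<sigma> (subtree n l \<tau> i)"]
      by (simp only: Ball_def lessThan_iff)
    also have "\<dots> = (\<Pi>\<^sub>E i\<in>{..<n}. {\<sigma> \<in> colorings k n l. \<sigma> [] \<noteq> c \<and> agree n l \<sigma> (subtree n l \<tau> i)})"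
      by (simp only: mem_Collect_eq conj_assoc)
    finally have "real (card {\<sigma> \<in> colorings k n (Suc l). \<sigma> [] = c \<and> agree n (Suc l) \<sigma> \<tau>}) = (\<Prod>i<n. real (card {\<sigma> \<in> colorings k n l. \<sigma> [] \<noteq> c \<and> agree n l \<sigma> (subtree n l \<tau> i)}))"
      by (simp only: card_PiE finite_lessThan of_nat_prod)
    also have "\<dots> = (\<Prod>i<n. Z i * (1 - marg k n l (subtree n l \<tau> i) c))"
    proof (intro prod.cong refl)
      fix i assume i: "i \<in> {..<n}"
      have le: "card {\<sigma> \<in> colorings k n l. \<sigma> [] = c \<and> agree n l \<sigma> (subtree n l \<tau> i)}
          \<le> card {\<sigma> \<in> colorings k n l. agree n l \<sigma> (subtree n l \<tau> i)}"
      proof (rule card_mono)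
        show "finite {\<sigma> \<in> colorings k n l. agree n l \<sigma> (subtree n l \<tau> i)}"
          using finite_colorings by (rule finite_subset[rotated]) blast
      qed blast
      show "real (card {\<sigma> \<in> colorings k n l. \<sigma> [] \<noteq> c \<and> agree n l \<sigma> (subtree n l \<tau> i)})
          = Z i * (1 - marg k n l (subtree n l \<tau> i) c)"
      proof -
        have "real (card {\<sigma> \<in> colorings k n l. \<sigma> [] \<noteq> c \<and> agree n l \<sigma> (subtree n l \<tau> i)})
            = Z i - real (card {\<sigma> \<in> colorings k n l. \<sigma> [] = c \<and> agree n l \<sigma> (subtree n l \<tau> i)})"
          unfolding Z_def card_root_ne[of k n l c "\<lambda>\<sigma>. agree n l \<sigma> (subtree n l \<tau> i)"]
          by (rule of_nat_diff[OF le])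
        moreover have "Z i * marg k n l (subtree n l \<tau> i) c
            = real (card {\<sigma> \<in> colorings k n l. \<sigma> [] = c \<and> agree n l \<sigma> (subtree n l \<tau> i)})"
          using Z[of i] i unfolding marg_def Z_def by simp
        ultimately show ?thesis by (simp only: right_diff_distrib mult_1_right)
      qed
    qed
    finally show ?thesis by (simp add: prod.distrib)
  qed
  have "real (card {\<sigma> \<in> colorings k n (Suc l). agree n (Suc l) \<sigma> \<tau>})
      = (\<Sum>c\<in>{1..k}. real (card {\<sigma> \<in> colorings k n (Suc l). \<sigma> [] = c \<and> agree n (Suc l) \<sigma> \<tau>}))"
    unfolding card_colorings_split[of k n "Suc l" "\<lambda>\<sigma>. agree n (Suc l) \<sigma> \<tau>"] by simp
  also have "\<dots> = (\<Sum>c\<in>{1..k}. (\<Prod>i<n. Z i) * (\<Prod>i<n. 1 - marg k n l (subtree n l \<tau> i) c))"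
    by (intro sum.cong refl N)
  also have "\<dots> = (\<Prod>i<n. Z i) * (\<Sum>c\<in>{1..k}. \<Prod>i<n. 1 - marg k n l (subtree n l \<tau> i) c)"
    by (rule sum_distrib_left[symmetric])
  finally have "marg k n (Suc l) \<tau> c = (\<Prod>i<n. Z i) * (\<Prod>i<n. 1 - marg k n l (subtree n l \<tau> i) c) /
      ((\<Prod>i<n. Z i) * (\<Sum>c\<in>{1..k}. \<Prod>i<n. 1 - marg k n l (subtree n l \<tau> i) c))"
    unfolding marg_def[of k n "Suc l"] N[OF c] by (rule arg_cong)
  then show ?thesis using less_imp_neq[OF ZP] by (simp only: bp_def mult_divide_mult_cancel_left_if) simp
qed

lemma marg_0:
  assumes "\<tau> \<in> colorings k n 0"
  shows "marg k n 0 \<tau> c = of_bool (\<tau> [] = c)"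
proof -
  have tv: "tree_verts n 0 = {[]}" by (auto simp: tree_verts_def)
  have "leaves n 0 = {[]}" by (auto simp: leaves_def tv)
  moreover have "\<sigma> = \<tau>" if "\<sigma> \<in> colorings k n 0" "\<sigma> [] = \<tau> []" for \<sigma>
  proof (rule PiE_ext)
    show "\<sigma> \<in> {[]} \<rightarrow>\<^sub>E {1..k}" "\<tau> \<in> {[]} \<rightarrow>\<^sub>E {1..k}" using that(1) assms by (auto simp: colorings_def tv)
  qed (use that in auto)
  ultimately have "{\<sigma> \<in> colorings k n 0. agree n 0 \<sigma> \<tau>} = {\<tau>}"
    "{\<sigma> \<in> colorings k n 0. \<sigma> [] = c \<and> agree n 0 \<sigma> \<tau>} = (if \<tau> [] = c then {\<tau>} else {})"
    using assms by (auto simp: agree_iff)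
  then show ?thesis by (simp add: marg_def)
qed

section \<open>Decay of the deviation\<close>

lemma dev_cong: "(\<And>c. c \<in> {1..k} \<Longrightarrow> x c = y c) \<Longrightarrow> dev k x = dev k y"
  unfolding dev_def by (intro arg_cong[where f = Max] image_cong) auto

lemma dev_marg_Suc:
  assumes "\<tau> \<in> colorings k n (Suc l)"
  shows "dev k (marg k n (Suc l) \<tau>) = dev k (bp k {..<n} (\<lambda>i. marg k n l (subtree n l \<tau> i)))"
  using marg_Suc[OF assms] by (rule dev_cong)

text \<open>Here a child has influence \<open>4 / k\<close>, and even \<open>n\<close> children
  without cancellation contribute only \<open>4 * n / k \<le> 4 / n\<close> times their deviation.
  No exceptional event arises.\<close>

lemma dev_marg_many_colors:
  assumes n: "n \<ge> 2" and k: "real k \<ge> (real n)\<^sup>2" and \<tau>: "\<tau> \<in> colorings k n l"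
  shows "dev k (marg k n l \<tau>) \<le> (4 / real n) ^ l"
  using \<tau>
proof (induction l arbitrary: \<tau>)
  case 0
  have "k > 0" using k n by (cases k) auto
  then show ?case using dev_le_1[OF _ prob_vec_marg[OF 0]] by simp
next
  case (Suc l)
  have n0: "real n \<ge> 2" using n by simp
  have "(real n)\<^sup>2 \<ge> 2 * real n" unfolding power2_eq_square using n0 by (intro mult_right_mono) auto
  then have k2: "real k \<ge> 2 * real n" using k by linarith
  then have k0: "k > 0" using n0 by (cases k) auto
  have sub: "subtree n l \<tau> i \<in> colorings k n l" if "i \<in> {..<n}" for i
    using PiE_mem[OF subtree_coloring(1)[OF Suc.prems] that] .
  have "\<bar>bp k ({} \<union> {..<n}) (\<lambda>i. marg k n l (subtree n l \<tau> i)) c - 1 / k\<bar>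
      \<le> 0 + 4 / k * (\<Sum>i\<in>{..<n}. dev k (marg k n l (subtree n l \<tau> i)))" if c: "c \<in> {1..k}" for c
  \<comment> \<open>All children are treated as added ones, starting from the empty family, whose
    belief is exactly uniform; this gives \<open>r = k\<close> and initial deviation 0.\<close>
  proof (rule bp_union_perturb[where r = "real k"])
    fix i assume "i \<in> {} \<union> {..<n}"
    then show "prob_vec k (marg k n l (subtree n l \<tau> i))" using sub by (intro prob_vec_marg) simp
  qed (use k0 k2 n0 c in \<open>simp_all add: bp_def\<close>)
  then have "\<bar>bp k {..<n} (\<lambda>i. marg k n l (subtree n l \<tau> i)) c - 1 / k\<bar> \<le> (4 / real n) ^ Suc l"
    if c: "c \<in> {1..k}" for c
  proof -
    have "(\<Sum>i\<in>{..<n}. dev k (marg k n l (subtree n l \<tau> i))) \<le> real (card {..<n}) * (4 / real n) ^ l"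
      using Suc.IH[OF sub] by (rule sum_bounded_above)
    then have "4 / k * (\<Sum>i\<in>{..<n}. dev k (marg k n l (subtree n l \<tau> i)))
        \<le> 4 / (real n)\<^sup>2 * (real n * (4 / real n) ^ l)"
      using k n0 by (intro mult_mono divide_left_mono mult_pos_pos)
        (auto intro!: sum_nonneg dev_nonneg k0 simp: power2_eq_square intro: order_less_le_trans)
    also have "\<dots> = (4 / real n) ^ Suc l" using n0 by (simp add: power2_eq_square)
    finally show ?thesis using \<open>\<And>c. c \<in> {1..k} \<Longrightarrow> _ c\<close>[OF c] by simp
  qed
  then show ?case unfolding dev_marg_Suc[OF Suc.prems] using k0 by (subst dev_le_iff) auto
qed

section \<open>At most \<open>n\<^sup>2\<close> colors: induction on the depth\<close>

context moderate_degree
begin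

lemma freq_Suc_le:
  "freq (colorings k n (Suc l)) (\<lambda>\<tau>. Q (subtree n l \<tau>)) \<le> D * freq ({..<n} \<rightarrow>\<^sub>E colorings k n l) Q"
proof -
  have "freq (colorings k n (Suc l)) (\<lambda>\<tau>. Q (subtree n l \<tau>))
      \<le> (real k / (real k - 1)) ^ n * freq ({..<n} \<rightarrow>\<^sub>E colorings k n l) Q"
    using k4 by (intro freq_subtree_le) simp
  also have "\<dots> \<le> D * freq ({..<n} \<rightarrow>\<^sub>E colorings k n l) Q"
    using density by (intro mult_right_mono freq_nonneg)
  finally show ?thesis .
qed

lemma freq_dev_Suc_le:
  "freq (colorings k n (Suc l)) (\<lambda>\<tau>. dev k (marg k n (Suc l) \<tau>) > s)
    \<le> D * freq ({..<n} \<rightarrow>\<^sub>E colorings k n l) (\<lambda>f. dev k (bp k {..<n} (\<lambda>i. marg k n l (f i))) > s)"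
proof -
  have "freq (colorings k n (Suc l)) (\<lambda>\<tau>. dev k (marg k n (Suc l) \<tau>) > s)
      \<le> freq (colorings k n (Suc l)) (\<lambda>\<tau>. dev k (bp k {..<n} (\<lambda>i. marg k n l (subtree n l \<tau> i))) > s)"
    by (intro freq_mono finite_colorings) (simp add: dev_marg_Suc)
  also have "\<dots> \<le> D * freq ({..<n} \<rightarrow>\<^sub>E colorings k n l) (\<lambda>f. dev k (bp k {..<n} (\<lambda>i. marg k n l (f i))) > s)"
    by (rule freq_Suc_le)
  finally show ?thesis .
qed

lemma colorings_facts:
  "finite (colorings k n l)" "colorings k n l \<noteq> {}"
  "\<tau> \<in> colorings k n l \<Longrightarrow> prob_vec k (marg k n l \<tau>)"
  "c \<in> {1..k} \<Longrightarrow> avg (colorings k n l) (\<lambda>\<tau>. marg k n l \<tau> c) = 1 / k"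
  using k4 by (auto intro!: finite_colorings colorings_nonempty prob_vec_marg avg_marg)

lemma freq_level_one:
  "freq (colorings k n 1) (\<lambda>\<tau>. \<exists>c\<in>{1..k}. marg k n 1 \<tau> c > D powr (- 32 * g)) \<le> D * exp (- (D powr (32 * g)))"
proof -
  define Q where "Q f \<longleftrightarrow> (\<exists>c\<in>{1..k}. bp k {..<n} (\<lambda>i c. of_bool (f i [] = c)) c > D powr (- 32 * g))"
    for f :: "nat \<Rightarrow> nat list \<Rightarrow> nat"
  have "freq (colorings k n 1) (\<lambda>\<tau>. \<exists>c\<in>{1..k}. marg k n 1 \<tau> c > D powr (- 32 * g))
      \<le> freq (colorings k n (Suc 0)) (\<lambda>\<tau>. Q (subtree n 0 \<tau>))"
    unfolding One_nat_def
  proof (rule freq_mono[OF finite_colorings])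
    fix \<tau> assume \<tau>: "\<tau> \<in> colorings k n (Suc 0)"
      and "\<exists>c\<in>{Suc 0..k}. marg k n (Suc 0) \<tau> c > D powr (- 32 * g)"
    then obtain c where c: "c \<in> {1..k}" "marg k n (Suc 0) \<tau> c > D powr (- 32 * g)" by auto
    have "marg k n (Suc 0) \<tau> c = bp k {..<n} (\<lambda>i. marg k n 0 (subtree n 0 \<tau> i)) c"
      by (rule marg_Suc[OF \<tau> c(1)])
    also have "\<dots> = bp k {..<n} (\<lambda>i c. of_bool (subtree n 0 \<tau> i [] = c)) c"
      using marg_0[OF PiE_mem[OF subtree_coloring(1)[OF \<tau>]]] c(1) by (intro bp_cong)
    finally show "Q (subtree n 0 \<tau>)" using c unfolding Q_def by auto
  qed
  also have "\<dots> \<le> D * freq ({..<n} \<rightarrow>\<^sub>E colorings k n 0) Q" by (rule freq_Suc_le)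
  also have "\<dots> \<le> D * exp (- (D powr (32 * g)))"
  proof (intro mult_left_mono)
    show "freq ({..<n} \<rightarrow>\<^sub>E colorings k n 0) Q \<le> exp (- (D powr (32 * g)))"
      unfolding Q_def
    proof (rule level_one[where \<kappa> = "\<lambda>\<sigma>. \<sigma> []"])
      show "c \<in> {1..k} \<Longrightarrow> freq (colorings k n 0) (\<lambda>\<sigma>. \<sigma> [] = c) = 1 / k" for c
        using k4 by (intro freq_root) auto
    qed (use colorings_facts colorings_root in auto)
  qed (use D in auto)
  finally show ?thesis .
qed

lemma freq_level_two:
  "freq (colorings k n 2) (\<lambda>\<tau>. dev k (marg k n 2 \<tau>) > s0) \<le> exp (- (D powr (4 * g)))"
proof -
  have "freq (colorings k n 2) (\<lambda>\<tau>. dev k (marg k n 2 \<tau>) > s0)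
      \<le> D * freq ({..<n} \<rightarrow>\<^sub>E colorings k n 1) (\<lambda>f. dev k (bp k {..<n} (\<lambda>i. marg k n 1 (f i))) > D powr (- 1 - 4 * g))"
    using freq_dev_Suc_le[of 1 s0] by (simp only: s0_def Suc_1)
  also have "\<dots> \<le> exp (- (D powr (4 * g)))"
    by (rule level_two[OF colorings_facts freq_level_one])
  finally show ?thesis .
qed

text \<open>\<open>m\<close> counts the levels above level two, where the scale starts at
  \<open>s0\<close>. The bound is kept for all \<open>s\<close> above the scale, because the next
  step needs the exponential moments of \<open>W\<close> and not just one quantile.\<close>

lemma tail_bound:
  "s \<ge> s0 * D powr (- (real m / 8)) \<Longrightarrow>
    freq (colorings k n (m + 2)) (\<lambda>\<tau>. dev k (marg k n (m + 2) \<tau>) > s)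
      \<le> exp (- (L * (s / (s0 * D powr (- (real m / 8)))) powr g))"
proof (induction m arbitrary: s)
  case 0
  then have s: "s \<ge> s0" using D by simp
  show ?case
  proof (cases "s \<le> 1")
    case True
    have "freq (colorings k n 2) (\<lambda>\<tau>. dev k (marg k n 2 \<tau>) > s) \<le> freq (colorings k n 2) (\<lambda>\<tau>. dev k (marg k n 2 \<tau>) > s0)"
      using s by (intro freq_mono finite_colorings) auto
    also note freq_level_two
    \<comment> \<open>Deviations never exceed 1, so \<open>s / s0\<close> is at most
      \<open>D powr (1 + 4 * g)\<close>. The required exponent is then at most
      \<open>g + (1 + 4 * g) * g\<close>, which the \<open>4 * g\<close> from level two covers; a
      single estimate thus starts the entire tail.\<close>
    also have "exp (- (D powr (4 * g))) \<le> exp (- (L * (s / s0) powr g))"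
    proof -
      have "s / s0 \<le> 1 / s0" using True s0(1) by (intro divide_right_mono) auto
      also have "\<dots> = D powr (1 + 4 * g)"
        using powr_minus_divide[of D "- 1 - 4 * g"] by (simp add: s0_def add.commute)
      finally have "(s / s0) powr g \<le> (D powr (1 + 4 * g)) powr g"
        using s s0(1) g by (intro powr_mono2) auto
      then have "L * (s / s0) powr g \<le> D powr g * (D powr (1 + 4 * g)) powr g"
        unfolding L_def by (intro mult_left_mono) auto
      also have "\<dots> = D powr (g + (1 + 4 * g) * g)"
        by (simp only: powr_powr powr_add[of D g])
      also have "\<dots> \<le> D powr (4 * g)"
      proof (intro powr_mono)
        have "(1 + 4 * g) * g \<le> 3 * g" using g by (intro mult_right_mono) auto
        then show "g + (1 + 4 * g) * g \<le> 4 * g" by simp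
      qed (use D in auto)
      finally show ?thesis by simp
    qed
    finally show ?thesis using D by (simp add: numeral_2_eq_2)
  next
    case False
    have "freq (colorings k n 2) (\<lambda>\<tau>. dev k (marg k n 2 \<tau>) > s) = 0"
    proof (rule freq_eq_0)
      fix \<tau> assume "\<tau> \<in> colorings k n 2"
      then have "dev k (marg k n 2 \<tau>) \<le> 1" using k4 by (intro dev_le_1 prob_vec_marg) auto
      then show "\<not> dev k (marg k n 2 \<tau>) > s" using False by simp
    qed
    then show ?thesis by (simp add: numeral_2_eq_2)
  qed
next
  case (Suc m)
  define e where "e = s0 * D powr (- (real m / 8))"
  have e: "0 < e" "e \<le> s0"
  proof -
    show "0 < e" using s0(1) D by (simp add: e_def)
    have "D powr (- (real m / 8)) \<le> D powr 0" using D by (intro powr_mono) auto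
    then show "e \<le> s0" using s0(1) D by (simp add: e_def mult_left_le)
  qed
  have e': "s0 * D powr (- (real (Suc m) / 8)) = e * D powr (- (1 / 8))"
  proof -
    have "- (real (Suc m) / 8) = - (real m / 8) + - (1 / 8)"
      by (simp add: add_divide_distrib)
    then show ?thesis unfolding e_def mult.assoc powr_add[symmetric] by (rule arg_cong)
  qed
  interpret belief_step n k g "colorings k n (m + 2)" "marg k n (m + 2)" e
    using colorings_facts e Suc.IH by unfold_locales (auto simp: e_def)
  have "freq (colorings k n (Suc m + 2)) (\<lambda>\<tau>. dev k (marg k n (Suc m + 2) \<tau>) > s)
      \<le> D * freq ({..<n} \<rightarrow>\<^sub>E colorings k n (m + 2)) (\<lambda>f. dev k (bp k {..<n} (\<lambda>i. marg k n (m + 2) (f i))) > s)"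
    using freq_dev_Suc_le[of "m + 2" s] by (simp only: add_Suc)
  also have "\<dots> \<le> exp (- (L * (s / (e * D powr (- (1 / 8)))) powr g))"
    using Suc.prems unfolding e' by (rule step_tail)
  finally show ?case unfolding e' .
qed

lemma freq_deviation_le:
  assumes l: "l \<ge> 2"
  shows "freq (colorings k n l) (\<lambda>\<tau>. dev k (marg k n l \<tau>) > D powr (- (1/16) * real l))
    \<le> exp (- (D powr (g / 16 * real l)))"
proof -
  obtain m where m: "l = m + 2" using l by (metis add.commute le_Suc_ex)
  define e where "e = s0 * D powr (- (real m / 8))"
  define s where "s = D powr (- (1/16) * real l)"
  have ee: "e = D powr (- 1 - 4 * g - real m / 8)"
    unfolding e_def s0_def powr_add[symmetric] by simp
  have se: "s / e = D powr (- (1/16) * real l - (- 1 - 4 * g - real m / 8))"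
    unfolding s_def ee powr_diff ..
  have lm: "real l = real m + 2" "0 \<le> real m" by (simp_all add: m)
  have "- 1 - 4 * g - real m / 8 \<le> - (1/16) * real l" using lm g(1) by linarith
  then have "s \<ge> e" unfolding s_def ee by (rule powr_mono[OF _ D(4)])
  then have "freq (colorings k n l) (\<lambda>\<tau>. dev k (marg k n l \<tau>) > s) \<le> exp (- (L * (s / e) powr g))"
    using tail_bound[of m s] by (simp only: m e_def)
  also have "\<dots> \<le> exp (- (D powr (g / 16 * real l)))"
  proof -
    \<comment> \<open>The summand 1 comes from the prefactor \<open>L = D powr g\<close>; the rest
      is the exponent of \<open>s / e\<close>.\<close>
    have "(1/16) * real l \<le> 1 + (- (1/16) * real l - (- 1 - 4 * g - real m / 8))"
      using g(1) lm by linarith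
    then have "g * ((1/16) * real l) \<le> g * (1 + (- (1/16) * real l - (- 1 - 4 * g - real m / 8)))"
      using g by (intro mult_left_mono) auto
    then have "D powr (g / 16 * real l) \<le> D powr (g + (- (1/16) * real l - (- 1 - 4 * g - real m / 8)) * g)"
      using D by (intro powr_mono) (auto simp: algebra_simps)
    also have "\<dots> = L * (s / e) powr g"
      unfolding L_def se powr_powr powr_add ..
    finally show ?thesis by simp
  qed
  finally show ?thesis by (simp only: s_def)
qed

end

section \<open>Translation to probabilities, asymptotics and the choice of constants\<close>

lemma prob_coloring_pmf:
  assumes "k \<ge> 2"
  shows "\<P>(\<tau> in coloring_pmf k n l. P \<tau>) = freq (colorings k n l) P"
proof -
  have "{x \<in> colorings k n l. P x} = colorings k n l \<inter> {x. P x}" by auto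
  then show ?thesis
    using assms by (simp add: coloring_pmf_def measure_pmf_of_set finite_colorings colorings_nonempty freq_def)
qed

lemma cond_prob_coloring_pmf:
  assumes k: "k \<ge> 2"
  shows "\<P>(\<sigma> in coloring_pmf k n l. \<sigma> tree_root = c \<bar>
      restrict \<sigma> (leaves n l) = restrict \<tau> (leaves n l)) = marg k n l \<tau> c"
proof -
  have "card (colorings k n l) > 0" using colorings_nonempty[OF k] finite_colorings by (simp add: card_gt_0_iff)
  then show ?thesis
    unfolding cond_prob_def prob_coloring_pmf[OF k] by (simp add: freq_def marg_def agree_def tree_root_def)
qed

text \<open>The proportion of missing colors at a vertex above the leaves is about
  \<open>(1 - 1 / k) ^ n\<close>, roughly \<open>n powr (- 1 / C)\<close>; this is where \<open>C > 1\<close> enters.\<close>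
lemma missing_proportion_ge:
  fixes \<epsilon> :: real
  assumes eps: "0 < \<epsilon>" "\<epsilon> \<le> 1 / 3" and n: "n \<ge> 2" and k: "k \<ge> 2" "real k > (1 + \<epsilon>) * real n / ln (real n)"
    and ln_le: "ln (real n) \<le> \<epsilon> / 3 * real n"
  shows "real n powr (- (1 - \<epsilon> / 2)) \<le> (1 - 1 / real k) ^ n"
proof -
  have ln: "ln (real n) > 0" using n by simp
  have k1: "real k - 1 > 0" using k(1) by simp
  have "real n \<le> (1 - \<epsilon> / 2) * ln (real n) * (real k - 1)"
  proof -
    \<comment> \<open>The cap of 1/3 on \<open>\<epsilon>\<close> enters here. It makes
      \<open>(1 - \<epsilon> / 2) * (1 + \<epsilon>)\<close> at least
      \<open>1 + \<epsilon> / 3\<close>, and the surplus \<open>\<epsilon> / 3 * n\<close> pays for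
      replacing \<open>k\<close> by \<open>k - 1\<close>.\<close>
    have "\<epsilon> * \<epsilon> \<le> \<epsilon> * (1 / 3)" using eps by (intro mult_left_mono) auto
    moreover have "(1 - \<epsilon> / 2) * (1 + \<epsilon>) = 1 + \<epsilon> / 2 - \<epsilon> * \<epsilon> / 2" by (simp add: field_simps)
    ultimately have "1 + \<epsilon> / 3 \<le> (1 - \<epsilon> / 2) * (1 + \<epsilon>)" by linarith
    then have "(1 + \<epsilon> / 3) * real n \<le> (1 - \<epsilon> / 2) * (1 + \<epsilon>) * real n" by (intro mult_right_mono) auto
    moreover have "(1 - \<epsilon> / 2) * ((1 + \<epsilon>) * real n) \<le> (1 - \<epsilon> / 2) * (ln (real n) * real k)"
      using k(2) ln eps by (intro mult_left_mono) (auto simp: pos_divide_less_eq mult.commute less_imp_le)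
    moreover have "(1 - \<epsilon> / 2) * ln (real n) \<le> 1 * ln (real n)" using eps ln by (intro mult_right_mono) auto
    moreover have "(1 - \<epsilon> / 2) * ln (real n) * (real k - 1)
        = (1 - \<epsilon> / 2) * (ln (real n) * real k) - (1 - \<epsilon> / 2) * ln (real n)"
      by (simp only: right_diff_distrib mult_1_right mult.assoc)
    moreover have "(1 + \<epsilon> / 3) * real n = real n + \<epsilon> / 3 * real n" by (simp add: distrib_right)
    ultimately show ?thesis using ln_le by linarith
  qed
  then have *: "real n * (1 / (real k - 1)) \<le> (1 - \<epsilon> / 2) * ln (real n)"
    using k1 by (simp add: pos_divide_le_eq)
  have "real n powr (- (1 - \<epsilon> / 2)) = exp (- ((1 - \<epsilon> / 2) * ln (real n)))"
    using n unfolding powr_def by (simp add: algebra_simps)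
  also have "\<dots> \<le> exp (- (real n * (1 / (real k - 1))))" using * by simp
  also have "\<dots> = exp (- (1 / (real k - 1))) ^ n"
    by (simp add: exp_of_nat_mult[symmetric])
  also have "\<dots> \<le> (1 - 1 / real k) ^ n"
  proof (intro power_mono)
    have "1 + 1 / (real k - 1) \<le> exp (1 / (real k - 1))" by (rule exp_ge_add_one_self)
    then have "inverse (exp (1 / (real k - 1))) \<le> inverse (1 + 1 / (real k - 1))"
      using k1 by (intro le_imp_inverse_le) (auto simp: add_pos_pos)
    also have "inverse (1 + 1 / (real k - 1)) = 1 - 1 / real k" using k1 by (simp add: field_simps)
    finally show "exp (- (1 / (real k - 1))) \<le> 1 - 1 / real k" by (simp add: exp_minus)
  qed auto
  finally show ?thesis .
qed

text \<open>The threshold for \<open>n\<close> must be uniform in \<open>k\<close>, so every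
  asymptotic condition is stated in \<open>n\<close> alone and \<open>k\<close> is inserted
  afterwards through its bounds. The value \<open>\<epsilon> / 128\<close> makes
  \<open>64 * g = \<epsilon> / 2\<close>, the exponent gained in the expected number of missing
  colors; \<open>few\<close> uses half of it and leaves the rest for
  \<open>4 * ln n\<close>.\<close>

lemma eventually_moderate_degree:
  fixes \<epsilon> :: real
  assumes eps: "0 < \<epsilon>" "\<epsilon> \<le> 1 / 3"
  shows "\<forall>\<^sub>F n in at_top. \<forall>k. real k > (1 + \<epsilon>) * real n / ln (real n) \<longrightarrow> real k \<le> (real n)\<^sup>2 \<longrightarrow>
    moderate_degree n k (\<epsilon> / 128)"
proof -
  define g where "g = \<epsilon> / 128"
  have g: "0 < g" "g \<le> 1 / 384" using eps by (auto simp: g_def)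
  have "\<forall>\<^sub>F n::nat in at_top. 96 \<le> real n powr (4 * g)"
    "\<forall>\<^sub>F n::nat in at_top. 2 * real n * exp (- (real n powr g / 3)) \<le> 1"
    "\<forall>\<^sub>F n::nat in at_top. 3 / g \<le> real n powr g"
    "\<forall>\<^sub>F n::nat in at_top. 6 \<le> real n powr (g / 2)"
    "\<forall>\<^sub>F n::nat in at_top. 6 * real n \<le> exp (real n powr g)"
    using g by real_asymp+
  moreover have "\<forall>\<^sub>F n::nat in at_top. 4 * real n ^ 3 * exp (- (real n powr (1/2))) \<le> exp (- (real n powr (1/4)))"
    "\<forall>\<^sub>F n::nat in at_top. 64 * (1 + 2 * real n powr (1/2)) \<le> real n powr (9/16)"
    "\<forall>\<^sub>F n::nat in at_top. 64 \<le> real n powr (1/16)"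
    by real_asymp+
  moreover have "\<forall>\<^sub>F n::nat in at_top. (real n)\<^sup>2 * exp (- (real n powr (32 * g) / 2)) \<le> 1"
    "\<forall>\<^sub>F n::nat in at_top. real n powr (2 + 16 * g) * exp (- (real n powr (32 * g))) \<le> 1"
    "\<forall>\<^sub>F n::nat in at_top. real n powr (- 32 * g) * (2 * ln (real n) + 1) \<le> real n powr (- 8 * g)"
    "\<forall>\<^sub>F n::nat in at_top. real n powr (- 8 * g) \<le> 1 / 16"
    "\<forall>\<^sub>F n::nat in at_top. 32 * real n powr (- 8 * g) * ln (real n) / real n \<le> real n powr (- 1 - 4 * g)"
    "\<forall>\<^sub>F n::nat in at_top. real n * (3 * exp (- (real n powr (32 * g) / 2)) +
        2 * (real n)\<^sup>2 * exp (- (real n powr (8 * g)) + 1 + 2 * ln (real n))) \<le> exp (- (real n powr (4 * g)))"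
    "\<forall>\<^sub>F n::nat in at_top. ln (real n) / real n \<le> real n powr (- 32 * g)"
    using g by real_asymp+
  moreover have "\<forall>\<^sub>F n::nat in at_top. real n powr (32 * g) \<le> real n powr (64 * g) / (4 * ln (real n))"
    "\<forall>\<^sub>F n::nat in at_top. ln (real n) \<le> 128 * g / 3 * real n"
    using g by real_asymp+
  moreover have "\<forall>\<^sub>F n::nat in at_top. real n powr (15/16) \<le> real n / ln (real n)"
    "\<forall>\<^sub>F n::nat in at_top. 2 \<le> real n / ln (real n)" "\<forall>\<^sub>F n::nat in at_top. 2 \<le> n"
    by (real_asymp, real_asymp, rule eventually_ge_at_top)
  ultimately have "\<forall>\<^sub>F n in at_top. \<forall>k. real k > (1 + \<epsilon>) * real n / ln (real n) \<longrightarrow> real k \<le> (real n)\<^sup>2 \<longrightarrow>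
    moderate_degree n k g"
  proof eventually_elim
    case (elim n)
    show ?case
    proof (intro allI impI)
      fix k :: nat
      assume k: "real k > (1 + \<epsilon>) * real n / ln (real n)" "real k \<le> (real n)\<^sup>2"
      have ln: "ln (real n) > 0" using elim(20) by simp
      have "real n / ln (real n) \<le> (1 + \<epsilon>) * real n / ln (real n)"
        using eps ln by (intro divide_right_mono) (auto simp: mult_le_cancel_right1)
      with k(1) have kn: "real n / ln (real n) \<le> real k" by linarith
      then have k2: "k \<ge> 2" using elim(19) by linarith
      have miss: "real n powr (- (1 - \<epsilon> / 2)) \<le> (1 - 1 / real k) ^ n"
        using elim(17) by (intro missing_proportion_ge eps elim(20) k2 k(1)) (simp add: g_def)
      show "moderate_degree n k g"
      proof
        have "real n powr (2 * g) \<le> real n powr (1/4)" using elim(20) g by (intro powr_mono) auto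
        then have "exp (- (real n powr (1/4))) \<le> exp (- (real n powr (2 * g)))" by simp
        with elim(6) show "4 * real n ^ 3 * exp (- (real n powr (1/2))) \<le> exp (- (real n powr (2 * g)))"
          by (rule order_trans)
        show "real n powr (32 * g) \<le> real k * (1 - 1 / real k) ^ n / 4"
        proof -
          note elim(16)
          also have "real n powr (64 * g) / (4 * ln (real n)) = real n / ln (real n) * real n powr (- (1 - \<epsilon> / 2)) / 4"
          proof -
            have "real n powr (64 * g) = real n powr 1 * real n powr (- (1 - \<epsilon> / 2))"
              unfolding powr_add[symmetric] by (simp add: g_def)
            then show ?thesis using elim(20) by simp
          qed
          also have "\<dots> \<le> real k * (1 - 1 / real k) ^ n / 4"
            using kn miss by (intro divide_right_mono mult_mono) auto
          finally show ?thesis .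
        qed
        show "(real k / (real k - 1)) ^ n \<le> real n"
        proof -
          have pos: "0 < real n powr (- (1 - \<epsilon> / 2))" using elim(20) by simp
          \<comment> \<open>The density factor is the reciprocal of the missing proportion, so one
            estimate serves both.\<close>
          have "(real k / (real k - 1)) ^ n = inverse ((1 - 1 / real k) ^ n)"
            unfolding power_inverse[symmetric] using k2 by (simp add: field_simps)
          also have "\<dots> \<le> inverse (real n powr (- (1 - \<epsilon> / 2)))"
            using miss pos by (rule le_imp_inverse_le)
          also have "\<dots> = real n powr (1 - \<epsilon> / 2)" unfolding powr_minus by simp
          also have "\<dots> \<le> real n powr 1" using elim(20) eps by (intro powr_mono) auto
          finally show ?thesis by simp
        qed
        show "real n powr (15/16) \<le> real k" using elim(18) kn by linarith
      qed (use elim g k kn in simp_all)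
    qed
  qed
  then show ?thesis by (simp add: g_def)
qed

theorem theorem1p3:
  shows "\<exists>(\<alpha> :: real \<Rightarrow> real) (\<alpha>' :: real \<Rightarrow> real) (\<Delta>\<^sub>0 :: real \<Rightarrow> nat) (l\<^sub>0 :: real \<Rightarrow> nat).
    \<forall>(C::real) (\<epsilon>::real). C > 1 \<longrightarrow> \<epsilon> = min (C - 1) (1/3) \<longrightarrow>
      \<alpha> \<epsilon> > 0 \<and> \<alpha>' \<epsilon> > 0 \<and>
      (\<forall>(\<Delta>::nat) (k::nat) (c::nat) (l::nat).
        \<Delta> > \<Delta>\<^sub>0 \<epsilon> \<longrightarrow> real k > C * real \<Delta> / ln (real \<Delta>) \<longrightarrow> c \<in> {1..k} \<longrightarrow> l > l\<^sub>0 \<epsilon> \<longrightarrow>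
        \<P>(\<tau> in coloring_pmf k \<Delta> l.
            \<bar>\<P>(\<sigma> in coloring_pmf k \<Delta> l. \<sigma> tree_root = c \<bar>
                restrict \<sigma> (leaves \<Delta> l) = restrict \<tau> (leaves \<Delta> l)) - 1 / real k\<bar>
            > real \<Delta> powr (- \<alpha> \<epsilon> * real l))
        \<le> exp (- (real \<Delta> powr (\<alpha>' \<epsilon> * real l))))"
proof -
  define good where "good \<epsilon> n \<longleftrightarrow> n \<ge> 2 \<and> 4 / real n \<le> real n powr (- (1/16)) \<and> 2 \<le> real n / ln (real n) \<and>
    (\<forall>k. real k > (1 + \<epsilon>) * real n / ln (real n) \<longrightarrow> real k \<le> (real n)\<^sup>2 \<longrightarrow> moderate_degree n k (\<epsilon> / 128))"
    for \<epsilon> :: real and n :: nat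
  have "\<forall>\<^sub>F n in at_top. good \<epsilon> n" if "0 < \<epsilon>" "\<epsilon> \<le> 1 / 3" for \<epsilon>
  proof -
    have "\<forall>\<^sub>F n::nat in at_top. 4 / real n \<le> real n powr (- (1/16))"
      "\<forall>\<^sub>F n::nat in at_top. 2 \<le> real n / ln (real n)"
      by real_asymp+
    then show ?thesis
      using eventually_moderate_degree[OF that] eventually_ge_at_top[of 2]
      unfolding good_def by eventually_elim simp
  qed
  \<comment> \<open>The conditions on \<open>\<epsilon>\<close> are moved under the existential
    quantifier, so that choice yields a threshold defined for every real and depending on
    \<open>\<epsilon>\<close> only.\<close>
  then have "\<exists>N. 0 < \<epsilon> \<longrightarrow> \<epsilon> \<le> 1 / 3 \<longrightarrow> (\<forall>n>N. good \<epsilon> n)" for \<epsilon>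
    unfolding eventually_at_top_dense by blast
  then obtain N where N: "\<And>\<epsilon> n. 0 < \<epsilon> \<Longrightarrow> \<epsilon> \<le> 1 / 3 \<Longrightarrow> n > N \<epsilon> \<Longrightarrow> good \<epsilon> n"
    by metis
  show ?thesis
  \<comment> \<open>The default \<open>1\<close> makes the second exponent positive for every real
    \<open>\<epsilon>\<close>; on positive \<open>\<epsilon>\<close> it is \<open>g / 16\<close>.
    The depth threshold 1 provides the two levels on which the tail bound starts.\<close>
  proof (rule exI[of _ "\<lambda>_. 1/16"], rule exI[of _ "\<lambda>\<epsilon>. if \<epsilon> > 0 then \<epsilon> / 128 / 16 else 1"],
      rule exI[of _ N], rule exI[of _ "\<lambda>_. 1"], intro allI impI conjI)
    fix C \<epsilon> :: real and \<Delta> k c l :: nat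
    assume C: "C > 1" and eps: "\<epsilon> = min (C - 1) (1/3)" and Delta: "\<Delta> > N \<epsilon>"
      and k: "real k > C * real \<Delta> / ln (real \<Delta>)" and c: "c \<in> {1..k}" and l: "l > 1"
    have e: "0 < \<epsilon>" "\<epsilon> \<le> 1 / 3" "1 + \<epsilon> \<le> C" using C by (auto simp: eps min_def)
    have G: "good \<epsilon> \<Delta>" by (rule N[OF e(1,2) Delta])
    then have D2: "\<Delta> \<ge> 2" by (simp add: good_def)
    have ln: "ln (real \<Delta>) > 0" using D2 by simp
    have "(1 + \<epsilon>) * real \<Delta> / ln (real \<Delta>) \<le> C * real \<Delta> / ln (real \<Delta>)"
      using e ln by (intro divide_right_mono mult_right_mono) auto
    with k have ke: "real k > (1 + \<epsilon>) * real \<Delta> / ln (real \<Delta>)" by linarith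
    have "real \<Delta> / ln (real \<Delta>) \<le> (1 + \<epsilon>) * real \<Delta> / ln (real \<Delta>)"
      using e ln by (intro divide_right_mono) (auto simp: mult_le_cancel_right1)
    then have k2: "k \<ge> 2" using ke G unfolding good_def by linarith
    define s where "s = real \<Delta> powr (- (1/16) * real l)"
    have "freq (colorings k \<Delta> l) (\<lambda>\<tau>. \<bar>marg k \<Delta> l \<tau> c - 1 / real k\<bar> > s)
        \<le> freq (colorings k \<Delta> l) (\<lambda>\<tau>. dev k (marg k \<Delta> l \<tau>) > s)"
      using dev_ge[OF c] by (intro freq_mono finite_colorings) (rule less_le_trans)
    also have "\<dots> \<le> exp (- (real \<Delta> powr (\<epsilon> / 128 / 16 * real l)))"
    proof (cases "real k \<le> (real \<Delta>)\<^sup>2")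
      case True
      then interpret moderate_degree \<Delta> k "\<epsilon> / 128" using G ke by (simp add: good_def)
      show ?thesis unfolding s_def using l by (intro freq_deviation_le) simp
    next
      case False
      have "freq (colorings k \<Delta> l) (\<lambda>\<tau>. dev k (marg k \<Delta> l \<tau>) > s) = 0"
      proof (rule freq_eq_0)
        fix \<tau> assume "\<tau> \<in> colorings k \<Delta> l"
        then have "dev k (marg k \<Delta> l \<tau>) \<le> (4 / real \<Delta>) ^ l"
          using D2 False by (intro dev_marg_many_colors) auto
        also have "\<dots> \<le> (real \<Delta> powr (- (1/16))) ^ l"
          using G by (intro power_mono) (auto simp: good_def)
        also have "\<dots> = s" using D2 by (simp add: s_def powr_realpow[symmetric] powr_powr)
        finally show "\<not> dev k (marg k \<Delta> l \<tau>) > s" by simp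
      qed
      then show ?thesis by simp
    qed
    finally show "\<P>(\<tau> in coloring_pmf k \<Delta> l.
            \<bar>\<P>(\<sigma> in coloring_pmf k \<Delta> l. \<sigma> tree_root = c \<bar>
                restrict \<sigma> (leaves \<Delta> l) = restrict \<tau> (leaves \<Delta> l)) - 1 / real k\<bar>
            > real \<Delta> powr (- (1/16) * real l))
        \<le> exp (- (real \<Delta> powr ((if \<epsilon> > 0 then \<epsilon> / 128 / 16 else 1) * real l)))"
      unfolding cond_prob_coloring_pmf[OF k2] prob_coloring_pmf[OF k2] using e(1) by (simp add: s_def)
  qed auto
qed

end
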